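(* Let $\nu\in\mathbb{C}\setminus\mathbb{Z}$ with $\Re(\nu)\ge0$, let $\chi$ be a non-principal even primitive Dirichlet character modulo $q$, and let $N$ be an integer with $N\ge\lfloor\frac{\Re(\nu)+1}{2}\rfloor$. Then for every $x>0$ with $qx\notin\mathbb{Z}_{>0}$, \begin{align*} &8\pi x^{\nu/2} \sum_{n=1}^{\infty} \sigma_{-\nu, \bar{\chi}}(n) n^{\nu/2}K_{\nu}(4\pi\sqrt{nx}) =-\frac{ \Gamma(\nu) L(\nu, \bar{\chi})}{(2\pi)^{\nu-1} } + \frac{2\Gamma(1+\nu) L(1+\nu, \bar{\chi})}{(2\pi)^{\nu+1} }x^{ -1} \\ & \quad + \frac{2q^{1-\nu} }{\tau(\chi) \sin \left(\frac{\pi \nu}{2}\right)} \left\{\sum_{j=1}^{N} \zeta(2j)\, L(2j-\nu, \chi)(qx)^{2j-1} + (qx)^{2N+1}\sum_{n=1}^{\infty}\bar{\sigma}_{-\nu, \chi}(n) \left(\frac{ n^{\nu-2N}-(qx)^{\nu-2N} }{ n^2-(qx)^2} \right) \right\}. \end{align*}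
   Context: For a Dirichlet character $\chi$ and $z\in\mathbb{C}$: $\sigma_{z,\chi}(n)=\sum_{d\mid n}d^z\chi(d)$ and $\bar{\sigma}_{z,\chi}(n)=\sum_{d\mid n}d^z\chi(n/d)$. $\tau(\chi)=\sum_{h=1}^q\chi(h)e^{2\pi i h/q}$ is the Gauss sum, $L(s,\chi)$ the Dirichlet $L$-function, $\zeta$ the Riemann zeta function, and $K_\nu$ the modified Bessel function of the second kind. *)

theory Defs
  imports "HOL-Complex_Analysis.Complex_Analysis" "HOL-Number_Theory.Cong"
begin

definition dirichlet_char :: "nat \<Rightarrow> (nat \<Rightarrow> complex) \<Rightarrow> bool" where
  "dirichlet_char q chi \<longleftrightarrow> q > 0 \<and> (\<forall>n. chi (n + q) = chi n) \<and>
     (\<forall>m n. chi (m * n) = chi m * chi n) \<and> chi 1 = 1 \<and>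
     (\<forall>n. chi n = 0 \<longleftrightarrow> \<not> coprime n q)"

definition principal_char :: "nat \<Rightarrow> (nat \<Rightarrow> complex) \<Rightarrow> bool" where
  "principal_char q chi \<longleftrightarrow> (\<forall>n. coprime n q \<longrightarrow> chi n = 1)"

text \<open>Even: chi(-1) = chi(1), i.e. chi(q-1) = 1.\<close>
definition even_char :: "nat \<Rightarrow> (nat \<Rightarrow> complex) \<Rightarrow> bool" where
  "even_char q chi \<longleftrightarrow> chi (q - 1) = chi 1"

text \<open>Primitive: chi is not induced by a character of any proper divisor modulus d.\<close>
definition primitive_char :: "nat \<Rightarrow> (nat \<Rightarrow> complex) \<Rightarrow> bool" where
  "primitive_char q chi \<longleftrightarrow>
     (\<forall>d. d dvd q \<and> d < q \<longrightarrow> (\<exists>a. coprime a q \<and> [a = 1] (mod d) \<and> chi a \<noteq> 1))"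

definition conj_char :: "(nat \<Rightarrow> complex) \<Rightarrow> nat \<Rightarrow> complex" where
  "conj_char chi n = cnj (chi n)"

definition sigma_char :: "complex \<Rightarrow> (nat \<Rightarrow> complex) \<Rightarrow> nat \<Rightarrow> complex" where
  "sigma_char z chi n = (\<Sum>d\<in>{d. d dvd n}. of_nat d powr z * chi d)"

definition sigma_bar_char :: "complex \<Rightarrow> (nat \<Rightarrow> complex) \<Rightarrow> nat \<Rightarrow> complex" where
  "sigma_bar_char z chi n = (\<Sum>d\<in>{d. d dvd n}. of_nat d powr z * chi (n div d))"

definition gauss_sum :: "nat \<Rightarrow> (nat \<Rightarrow> complex) \<Rightarrow> complex" where
  "gauss_sum q chi = (\<Sum>h=1..q. chi h * exp (2 * of_real pi * \<i> * of_nat h / of_nat q))"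

text \<open>Dirichlet L-function: the entire analytic continuation of the Dirichlet series
  (meaningful for non-principal characters, where it is entire).\<close>
definition dirichlet_L :: "(nat \<Rightarrow> complex) \<Rightarrow> complex \<Rightarrow> complex" where
  "dirichlet_L chi = (THE f. f holomorphic_on UNIV \<and>
      (\<forall>s. 1 < Re s \<longrightarrow> f s = (\<Sum>n. chi (Suc n) / of_nat (Suc n) powr s)))"

text \<open>Riemann zeta via its Dirichlet series (only used for Re s > 1).\<close>
definition zeta_series :: "complex \<Rightarrow> complex" where
  "zeta_series s = (\<Sum>n. 1 / of_nat (Suc n) powr s)"

definition bessel_K :: "complex \<Rightarrow> real \<Rightarrow> complex" where
  "bessel_K nu y = integral {0..} (\<lambda>t::real. of_real (exp (- y * cosh t)) * cosh (nu * of_real t))"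

end

theory Submission
  imports Defs "HOL-Number_Theory.Residues"
begin

text \<open>
  Write \<open>F t = (\<Sum>d. cnj (chi d) * exp (- 2 pi d t))\<close> and substitute \<open>t = exp v\<close>, so that Mellin transforms become
  integrals over the real line.  The integral representation of the Bessel function turns the series on the
  left into the Mellin transform of \<open>F t / (exp (2 pi x / t) - 1)\<close> at \<open>nu\<close>.  The partial fractions of the
  cotangent expand both factors: \<open>1 / (exp (2 pi y) - 1)\<close> becomes \<open>- 1 / 2 + 1 / (2 pi y) + (y / pi) (\<Sum>m. 1 / (m^2 + y^2))\<close>,
  and separability of the Gauss sum together with evenness gives
  \<open>F t = q^2 t / (pi tau) * (\<Sum>n. chi n / (n^2 + q^2 t^2))\<close>.  The first two terms yield the \<open>L\<close>-values at
  \<open>nu\<close> and \<open>nu + 1\<close>; splitting off \<open>N\<close> terms of the geometric expansion of \<open>1 / (m^2 + y^2)\<close> yields the sum over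
  \<open>j\<close> via the functional equation, and what remains is a double series of elementary integrals
  that collects into divisor sums.  The same expansion of \<open>F\<close> continues the \<open>L\<close>-function and proves its functional
  equation, so no contour shift is needed.  This works for the least admissible \<open>N\<close>; passing from \<open>N\<close> to \<open>N + 1\<close> only
  moves one Dirichlet series.
\<close>

section \<open>Bilateral Laplace integrals\<close>

text \<open>What shapes the proof is termwise integration over the whole line, where both ends must
  be controlled at once. The exponentials in \<open>F\<close> decay fast for large \<open>t\<close>
  but do not show that \<open>F t = O(t)\<close> near \<open>0\<close>; the partial fractions show
  this, yet their terms decay only like \<open>1 / t\<close>. A single term is easily integrable
  while bounds summed over the index are not, so some decay in \<open>t\<close> is exchanged for
  decay in the index, by an amount tied to the distance of the exponent from the edge of its strip.
  With \<open>mu = nu - 2 N\<close> this works for \<open>-1 \<le> Re mu < 1\<close>, and that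
  window is what the floor selects; it also keeps the points \<open>nu - 1 - 2 j\<close>,
  \<open>j < N\<close>, in the half plane \<open>Re s > -1\<close>, where the Mellin transform of
  \<open>F\<close> converges because of \<open>F t = O(t)\<close>. That \<open>nu\<close> is no
  integer keeps \<open>sin (pi nu / 2)\<close> away from \<open>0\<close>; that \<open>q x\<close>
  is no positive integer keeps the quadratics with parameters \<open>n / q\<close> and
  \<open>x / m\<close> distinct. In the variable \<open>v\<close> a scaling of \<open>t\<close> is a
  translation.\<close>

lemma integrable_exp_neg_abs:
  fixes c :: real
  assumes "c > 0"
  shows "integrable lborel (\<lambda>v::real. exp (- c * \<bar>v\<bar>))"
proof -
  have *: "set_integrable lborel {0..} (\<lambda>v::real. exp (- c * v))"
  proof -
    have "(\<lambda>x::real. exp (- c * x)) integrable_on {0..}"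
      using has_integral_exp_minus_to_infinity[OF assms, of 0] by blast
    hence "(\<lambda>x::real. exp (- c * x)) absolutely_integrable_on {0..}"
      by (intro nonnegative_absolutely_integrable_1) auto
    thus ?thesis
      unfolding set_integrable_def
      by (subst (asm) integrable_completion) (auto intro!: borel_measurable_continuous_onI continuous_intros borel_measurable_indicator borel_measurable_scaleR)
  qed
  hence 1: "integrable lborel (\<lambda>v::real. indicator {0..} v *\<^sub>R exp (- c * v))"
    by (simp add: set_integrable_def)
  have 2: "integrable lborel (\<lambda>v::real. indicator {0..} (-v) *\<^sub>R exp (- c * (-v)))"
    using lborel_integrable_real_affine[OF 1, of "-1" 0] by simp
  show ?thesis
    by (rule Bochner_Integration.integrable_bound[OF Bochner_Integration.integrable_add[OF 1 2]])
       (auto simp: indicator_def abs_if)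
qed

text \<open>Each bound is used on the half line where it decays. Asking for both on the whole line
  lets them be given as plain powers of \<open>exp v\<close>; lowering both rates to a common
  \<open>c\<close> gives one integrable majorant.\<close>

lemma exp_neg_abs_bound:
  fixes x C c al be v :: real
  assumes "c \<le> al" "c \<le> be" "0 \<le> c" "x \<le> C * exp (al * v)" "x \<le> C * exp (- be * v)" "0 \<le> x"
  shows "x \<le> C * exp (- c * \<bar>v\<bar>)"
proof -
  have "0 \<le> C"
  proof (rule ccontr)
    assume "\<not> 0 \<le> C"
    hence "C * exp (al * v) < 0" by (simp add: mult_neg_pos)
    thus False using assms by simp
  qed
  show ?thesis
  proof (cases "v \<ge> 0")
    case True
    have "c * v \<le> be * v" using assms True by (intro mult_right_mono) auto
    hence "C * exp (- be * v) \<le> C * exp (- c * \<bar>v\<bar>)"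
      using True \<open>0 \<le> C\<close> by (intro mult_left_mono) auto
    thus ?thesis using assms by linarith
  next
    case False
    have "al * v \<le> c * v" using assms False by (intro mult_right_mono_neg) auto
    hence "C * exp (al * v) \<le> C * exp (- c * \<bar>v\<bar>)"
      using False \<open>0 \<le> C\<close> by (intro mult_left_mono) auto
    thus ?thesis using assms by linarith
  qed
qed

lemma integrable_two_sided_bound:
  fixes f :: "real \<Rightarrow> complex"
  assumes [measurable]: "f \<in> borel_measurable borel"
    and "al > 0" "be > 0"
    and "\<And>v. norm (f v) \<le> C * exp (al * v)" "\<And>v. norm (f v) \<le> C * exp (- be * v)"
  shows "integrable lborel f"
proof -
  define c where "c = min al be"
  have c: "c > 0" "c \<le> al" "c \<le> be" using assms by (auto simp: c_def)
  have "norm (f v) \<le> norm (C * exp (- c * \<bar>v\<bar>))" for v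
    using exp_neg_abs_bound[of c al be "norm (f v)" C v] c assms(4,5)[of v] abs_ge_self[of "C * exp (- c * \<bar>v\<bar>)"]
    by simp
  thus ?thesis
    by (intro Bochner_Integration.integrable_bound[OF integrable_mult_right[OF integrable_exp_neg_abs[OF c(1)], of C]]) auto
qed

text \<open>All terms share one integrable profile \<open>exp (- c * \<bar>v\<bar>)\<close> with
  summable weights \<open>C * a i\<close>, so the integrals of their norms are summable. The index
  set is either the positive integers or pairs of them.\<close>

lemma has_sum_integral_two_sided_bound:
  fixes f :: "'i \<Rightarrow> real \<Rightarrow> complex"
  assumes I: "countable I" "infinite I"
    and meas: "\<And>i. i \<in> I \<Longrightarrow> f i \<in> borel_measurable borel"
    and pos: "al > 0" "be > 0"
    and a: "a summable_on I" "\<And>i. i \<in> I \<Longrightarrow> a i \<ge> (0::real)"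
    and b1: "\<And>i v. i \<in> I \<Longrightarrow> norm (f i v) \<le> C * a i * exp (al * v)"
    and b2: "\<And>i v. i \<in> I \<Longrightarrow> norm (f i v) \<le> C * a i * exp (- be * v)"
    and S: "\<And>v. ((\<lambda>i. f i v) has_sum S v) I"
  shows "integrable lborel S" "((\<lambda>i. LINT v|lborel. f i v) has_sum (LINT v|lborel. S v)) I"
proof -
  \<comment> \<open>An enumeration reduces the claim to sequences; absolute summability permits the
    return to the unordered sum over \<open>I\<close>.\<close>
  define e where "e = from_nat_into I"
  have bij: "bij_betw e UNIV I" unfolding e_def using I by (rule bij_betw_from_nat_into)
  have eI [simp]: "e k \<in> I" for k using bij by (auto simp: bij_betw_def)
  have [measurable]: "f (e k) \<in> borel_measurable borel" for k by (rule meas) simp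
  define c where "c = min al be"
  have c: "c > 0" "c \<le> al" "c \<le> be" using pos by (auto simp: c_def)
  have bd: "norm (f i v) \<le> (C * a i) * exp (- c * \<bar>v\<bar>)" if "i \<in> I" for i v
    using exp_neg_abs_bound[of c al be "norm (f i v)" "C * a i" v] c b1[OF that, of v] b2[OF that, of v]
    by simp
  have int: "integrable lborel (f (e k))" for k
    by (rule integrable_two_sided_bound[OF _ pos b1 b2]) auto
  have suma: "summable (\<lambda>k. a (e k))"
    using a(1) summable_on_reindex_bij_betw[OF bij, of a] 
    by (simp add: summable_on_imp_summable)
  have sumn: "summable (\<lambda>k. norm (f (e k) v))" for v
    by (rule summable_comparison_test[OF _ summable_mult2[OF summable_mult[OF suma, of C], of "exp (- c * \<bar>v\<bar>)"]])
       (use bd in auto)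
  have sumi: "summable (\<lambda>k. LINT v|lborel. norm (f (e k) v))"
  proof (rule summable_comparison_test)
    show "summable (\<lambda>k. C * a (e k) * (LINT v|lborel. exp (- c * \<bar>v\<bar>)))"
      by (intro summable_mult2 summable_mult suma)
    have "(LINT v|lborel. norm (f (e k) v)) \<le> C * a (e k) * (LINT v|lborel. exp (- c * \<bar>v\<bar>))" for k
    proof -
      have "(LINT v|lborel. norm (f (e k) v)) \<le> (LINT v|lborel. C * a (e k) * exp (- c * \<bar>v\<bar>))"
        by (intro integral_mono integrable_norm int integrable_mult_right integrable_exp_neg_abs c bd) auto
      thus ?thesis by simp
    qed
    thus "\<exists>N. \<forall>k\<ge>N. norm (LINT v|lborel. norm (f (e k) v)) \<le> C * a (e k) * (LINT v|lborel. exp (- c * \<bar>v\<bar>))"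
      by (simp add: Bochner_Integration.integral_nonneg)
  qed
  have Sv: "S v = (\<Sum>k. f (e k) v)" for v
  proof -
    have "((\<lambda>k. f (e k) v) has_sum S v) UNIV"
      using S[of v] has_sum_reindex_bij_betw[OF bij, of "\<lambda>i. f i v"] by simp
    thus ?thesis using has_sum_imp_sums sums_unique by blast
  qed
  show "integrable lborel S"
    unfolding Sv[abs_def] by (rule integrable_suminf[OF int _ sumi]) (simp add: sumn)
  have "(\<lambda>k. LINT v|lborel. f (e k) v) sums (LINT v|lborel. S v)"
    unfolding Sv[abs_def] by (rule sums_integral[OF int _ sumi]) (simp add: sumn)
  moreover have "summable (\<lambda>k. norm (LINT v|lborel. f (e k) v))"
    by (rule summable_comparison_test[OF _ sumi]) (auto intro!: exI[of _ 0] integral_norm_bound)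
  ultimately have "((\<lambda>k. LINT v|lborel. f (e k) v) has_sum (LINT v|lborel. S v)) UNIV"
    by (intro norm_summable_imp_has_sum)
  thus "((\<lambda>i. LINT v|lborel. f i v) has_sum (LINT v|lborel. S v)) I"
    using has_sum_reindex_bij_betw[OF bij, of "\<lambda>i. LINT v|lborel. f i v"] by simp
qed

text \<open>In terms of \<open>t = exp v\<close> the bounds say that \<open>f\<close> is
  \<open>O(t^-a)\<close> and \<open>O(t^-b)\<close>, so \<open>a\<close> and \<open>b\<close> are
  the edges of the strip where the Mellin transform converges.\<close>

lemma integrable_bilateral_laplace:
  fixes f :: "real \<Rightarrow> complex" and s :: complex
  assumes [measurable]: "f \<in> borel_measurable borel"
    and b: "\<And>v. norm (f v) \<le> C * exp (- a * v)" "\<And>v. norm (f v) \<le> C * exp (- b * v)"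
    and s: "a < Re s" "Re s < b"
  shows "integrable lborel (\<lambda>v. exp (s * of_real v) * f v)"
proof (rule integrable_two_sided_bound)
  show "Re s - a > 0" "b - Re s > 0" using s by auto
  show "norm (exp (s * of_real v) * f v) \<le> C * exp ((Re s - a) * v)" for v
  proof -
    have "norm (exp (s * of_real v) * f v) = exp (Re s * v) * norm (f v)" by (simp add: norm_mult)
    also have "\<dots> \<le> exp (Re s * v) * (C * exp (- a * v))" by (intro mult_left_mono b) auto
    also have "\<dots> = C * exp ((Re s - a) * v)" by (simp add: algebra_simps flip: exp_add)
    finally show ?thesis .
  qed
  show "norm (exp (s * of_real v) * f v) \<le> C * exp (- (b - Re s) * v)" for v
  proof -
    have "norm (exp (s * of_real v) * f v) = exp (Re s * v) * norm (f v)" by (simp add: norm_mult)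
    also have "\<dots> \<le> exp (Re s * v) * (C * exp (- b * v))" by (intro mult_left_mono b) auto
    also have "\<dots> = C * exp (- (b - Re s) * v)" by (simp add: algebra_simps flip: exp_add)
    finally show ?thesis .
  qed
qed measurable

text \<open>Around each \<open>z\<close> the kernel \<open>exp ((w - z) v)\<close> is expanded in
  powers of \<open>w - z\<close> and integrated termwise; a function with local power series is
  holomorphic.\<close>

lemma holomorphic_bilateral_laplace:
  fixes f :: "real \<Rightarrow> complex"
  assumes [measurable]: "f \<in> borel_measurable borel"
    and b: "\<And>v. norm (f v) \<le> C * exp (- a * v)" "\<And>v. norm (f v) \<le> C * exp (- b * v)"
  shows "(\<lambda>s. LINT v|lborel. exp (s * of_real v) * f v) holomorphic_on {s. a < Re s \<and> Re s < b}"
proof -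
  define M where "M = (\<lambda>s. LINT v|lborel. exp (s * of_real v) * f v)"
  have "\<exists>r>0. M holomorphic_on ball z r" if z: "a < Re z" "Re z < b" for z
  proof (intro exI conjI)
    \<comment> \<open>The distance to the nearer edge: for \<open>norm h < r\<close> both
      \<open>Re z + norm h\<close> and \<open>Re z - norm h\<close> stay inside the strip.\<close>
    define r where "r = min (Re z - a) (b - Re z)"
    show "r > 0" using z by (auto simp: r_def)
    show "M holomorphic_on ball z r"
    proof (rule power_series_holomorphic)
      fix w assume w: "w \<in> ball z r"
      define h where "h = w - z"
      have h: "norm h < r" using w by (simp add: h_def dist_norm norm_minus_commute)
      define g where "g = (\<lambda>n v. exp (z * of_real v) * f v * (of_real v ^ n / fact n) * h ^ n)"
      \<comment> \<open>The sum of the norms of all \<open>g n\<close>, hence the majorant for every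
        partial sum.\<close>
      define H where "H = (\<lambda>v. exp (norm h * \<bar>v\<bar>) * norm (exp (z * of_real v) * f v))"
      have [measurable]: "g n \<in> borel_measurable borel" for n unfolding g_def by measurable
      have gn: "norm (g n v) = norm (exp (z * of_real v) * f v) * ((norm h * \<bar>v\<bar>) ^ n / fact n)" for n v
        by (simp add: g_def norm_mult norm_divide norm_power power_mult_distrib)
      have gs: "(\<lambda>n. norm (g n v)) sums H v" for v
      proof -
        have "(\<lambda>n. (norm h * \<bar>v\<bar>) ^ n / fact n) sums exp (norm h * \<bar>v\<bar>)"
          using exp_converges[of "norm h * \<bar>v\<bar>"] by (simp add: scaleR_conv_of_real field_simps)
        from sums_mult[OF this, of "norm (exp (z * of_real v) * f v)"] show ?thesis
          unfolding gn H_def by (simp add: mult.commute)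
      qed
      have intH: "integrable lborel H"
      proof -
        have i1: "integrable lborel (\<lambda>v. exp ((z + of_real (norm h)) * of_real v) * f v)"
          using z h add_pos_nonneg[of "Re z - a" "norm h"] add_pos_nonneg[of "b - Re z" "norm h"]
          by (intro integrable_bilateral_laplace[OF _ b]) (auto simp: r_def)
        have i2: "integrable lborel (\<lambda>v. exp ((z - of_real (norm h)) * of_real v) * f v)"
          using z h add_pos_nonneg[of "Re z - a" "norm h"] add_pos_nonneg[of "b - Re z" "norm h"]
          by (intro integrable_bilateral_laplace[OF _ b]) (auto simp: r_def)
        show ?thesis
        proof (rule Bochner_Integration.integrable_bound[OF Bochner_Integration.integrable_add[OF integrable_norm[OF i1] integrable_norm[OF i2]]])
          show "H \<in> borel_measurable lborel" unfolding H_def by measurable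
          have "norm (H v) \<le> norm (norm (exp ((z + of_real (norm h)) * of_real v) * f v) +
                 norm (exp ((z - of_real (norm h)) * of_real v) * f v))" for v
          proof -
            have n: "norm (exp ((z + of_real c) * of_real v) * f v) = exp ((Re z + c) * v) * norm (f v)" for c
              by (simp add: norm_mult)
            \<comment> \<open>The sign of \<open>v\<close> decides which of the two shifted kernels
              equals \<open>H v\<close>; both are integrable.\<close>
            have "H v = norm (exp ((z + of_real (norm h)) * of_real v) * f v) \<or>
                  H v = norm (exp ((z + of_real (- norm h)) * of_real v) * f v)"
              unfolding n by (cases "v \<ge> 0") (auto simp: H_def norm_mult algebra_simps simp flip: exp_add)
            thus ?thesis by auto
          qed
          thus "AE v in lborel. norm (H v) \<le> norm (norm (exp ((z + of_real (norm h)) * of_real v) * f v) +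
                 norm (exp ((z - of_real (norm h)) * of_real v) * f v))" by simp
        qed
      qed
      have gle: "norm (g n v) \<le> norm (H v)" for n v
      proof -
        have "norm (g n v) \<le> (\<Sum>n. norm (g n v))"
          using sum_le_suminf[of "\<lambda>n. norm (g n v)" "{n}"] gs[of v] by (auto simp: sums_iff)
        also have "\<dots> = H v" using gs by (simp add: sums_iff)
        finally show ?thesis by simp
      qed
      have intg: "integrable lborel (g n)" for n
        by (rule Bochner_Integration.integrable_bound[OF intH]) (use gle in auto)
      have bdd: "(\<Sum>n<m. LINT v|lborel. norm (g n v)) \<le> (LINT v|lborel. H v)" for m
      proof -
        have "(\<Sum>n<m. LINT v|lborel. norm (g n v)) = (LINT v|lborel. (\<Sum>n<m. norm (g n v)))"
          by (subst Bochner_Integration.integral_sum) (auto intro: integrable_norm intg)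
        also have "\<dots> \<le> (LINT v|lborel. H v)"
        proof (intro integral_mono intH Bochner_Integration.integrable_sum integrable_norm intg)
          fix v show "(\<Sum>n<m. norm (g n v)) \<le> H v"
            using sum_le_suminf[of "\<lambda>n. norm (g n v)" "{..<m}"] gs[of v] by (auto simp: sums_iff)
        qed
        finally show ?thesis .
      qed
      have sumi: "summable (\<lambda>n. LINT v|lborel. norm (g n v))"
      proof -
        have "Bseq (\<lambda>m. \<Sum>n<m. LINT v|lborel. norm (g n v))"
          using bdd by (intro BseqI'[of _ "LINT v|lborel. H v"]) (auto simp: sum_nonneg)
        moreover have "monoseq (\<lambda>m. \<Sum>n<m. LINT v|lborel. norm (g n v))"
          by (intro incseq_imp_monoseq incseq_SucI) simp
        ultimately show ?thesis by (simp add: summable_iff_convergent Bseq_monoseq_convergent)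
      qed
      have "(\<lambda>n. LINT v|lborel. g n v) sums (LINT v|lborel. (\<Sum>n. g n v))"
        using gs by (intro sums_integral intg sumi) (auto simp: sums_iff)
      also have "(LINT v|lborel. (\<Sum>n. g n v)) = M w"
        unfolding M_def
      proof (rule Bochner_Integration.integral_cong[OF refl])
        fix v
        have "(\<lambda>n. (h * of_real v) ^ n / fact n) sums exp (h * of_real v)"
          using exp_converges[of "h * of_real v"] by (simp add: scaleR_conv_of_real field_simps)
        from sums_mult[OF this, of "exp (z * of_real v) * f v"]
        have "(\<lambda>n. g n v) sums (exp (z * of_real v) * f v * exp (h * of_real v))"
          by (simp add: g_def power_mult_distrib mult_ac)
        thus "(\<Sum>n. g n v) = exp (w * of_real v) * f v"
          by (simp add: sums_iff h_def algebra_simps exp_diff)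
      qed
      finally show "(\<lambda>n. (LINT v|lborel. exp (z * of_real v) * f v * (of_real v ^ n / fact n)) * (w - z) ^ n) sums M w"
        unfolding g_def h_def by simp
    qed
  qed
  hence "\<forall>z\<in>{s. a < Re s \<and> Re s < b}. M field_differentiable at z"
    by (metis (mono_tags, lifting) mem_Collect_eq centre_in_ball holomorphic_on_imp_differentiable_at open_ball)
  thus ?thesis unfolding M_def
    by (metis (mono_tags, lifting) holomorphic_on_def field_differentiable_at_within)
qed

text \<open>This is \<open>u / p \<le> exp (u / p)\<close> raised to the power \<open>p\<close>. It
  turns exponential decay into a power of any chosen order, so that the dependence on the summation
  index and on \<open>v\<close> separates.\<close>

lemma exp_minus_le_powr:
  fixes u p :: real
  assumes "u > 0" "p > 0"
  shows "exp (- u) \<le> p powr p * u powr (- p)"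
proof -
  have "u / p \<le> exp (u / p)" using exp_ge_add_one_self[of "u / p"] by linarith
  hence "(u / p) powr p \<le> exp (u / p) powr p" using assms by (intro powr_mono2) auto
  also have "\<dots> = exp u" using assms by (simp add: exp_powr_real)
  finally have "exp (- u) \<le> 1 / (u / p) powr p"
    using assms by (simp add: exp_minus field_simps)
  also have "\<dots> = p powr p * u powr (- p)" using assms by (simp add: powr_divide powr_minus field_simps)
  finally show ?thesis .
qed

section \<open>Gamma integrals and Mellin transforms of reciprocal quadratics\<close>

lemma lborel_integral_shift:
  fixes f :: "real \<Rightarrow> complex"
  shows "(LINT v|lborel. f (v + t)) = (LINT v|lborel. f v)"
  using lborel_integral_real_affine[of 1 f t] by (simp add: add.commute)

lemma of_real_exp_powr: "complex_of_real (exp v) powr s = exp (s * of_real v)"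
  by (simp add: powr_def Ln_of_real)

lemma of_real_powr_eq_exp: "A > 0 \<Longrightarrow> complex_of_real A powr s = exp (s * of_real (ln A))"
  by (simp add: powr_def Ln_of_real)

text \<open>Euler's integral under \<open>t = exp v\<close>; the Jacobian raises the exponent from
  \<open>s - 1\<close> to \<open>s\<close>.\<close>

lemma Gamma_integral_exp:
  assumes "Re s > 0"
  shows "integrable lborel (\<lambda>v. exp (s * of_real v) * of_real (exp (- exp v)))"
    and "(LINT v|lborel. exp (s * of_real v) * of_real (exp (- exp v))) = Gamma s"
proof -
  define p where "p = Re s + 1"
  have p: "p > 0" using assms by (simp add: p_def)
  show int: "integrable lborel (\<lambda>v. exp (s * of_real v) * of_real (exp (- exp v)))"
  proof (rule integrable_bilateral_laplace)
    show "norm (complex_of_real (exp (- exp v))) \<le> max 1 (p powr p) * exp (- 0 * v)" for v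
      by (simp add: le_max_iff_disj)
    show "norm (complex_of_real (exp (- exp v))) \<le> max 1 (p powr p) * exp (- p * v)" for v
    proof -
      have "exp (- exp v) \<le> p powr p * exp v powr (-p)" by (rule exp_minus_le_powr) (use p in auto)
      also have "\<dots> \<le> max 1 (p powr p) * exp (- p * v)"
        by (intro mult_mono) (auto simp: exp_powr_real mult.commute)
      finally show ?thesis by simp
    qed
    show "0 < Re s" "Re s < p" using assms by (auto simp: p_def)
  qed simp
  let ?f = "\<lambda>t. of_real t powr (s - 1) / of_real (exp t)"
  have "range exp = {0::real<..}" using exp_ln by (auto simp: image_def intro: exp_gt_zero) (metis exp_ln)
  moreover have "?f absolutely_integrable_on {0<..} \<and> integral {0<..} ?f = Gamma s"
    using absolutely_integrable_Gamma_integral'[OF assms] Gamma_integral_complex'[OF assms]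
    by (auto simp: integral_unique)
  moreover have "(\<lambda>v. \<bar>exp v\<bar> *\<^sub>R ?f (exp v)) absolutely_integrable_on UNIV \<and>
      integral UNIV (\<lambda>v. \<bar>exp v\<bar> *\<^sub>R ?f (exp v)) = Gamma s
      \<longleftrightarrow> ?f absolutely_integrable_on range exp \<and> integral (range exp) ?f = Gamma s"
    by (rule has_absolute_integral_change_of_variables_real)
       (auto intro!: derivative_eq_intros inj_onI)
  ultimately have "integral UNIV (\<lambda>v. \<bar>exp v\<bar> *\<^sub>R ?f (exp v)) = Gamma s" by auto
  also have "(\<lambda>v. \<bar>exp v\<bar> *\<^sub>R ?f (exp v)) = (\<lambda>v. exp (s * of_real v) * of_real (exp (- exp v)))"
    unfolding of_real_exp_powr
    by (auto simp: fun_eq_iff scaleR_conv_of_real exp_diff exp_minus field_simps of_real_exp)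
  finally show "(LINT v|lborel. exp (s * of_real v) * of_real (exp (- exp v))) = Gamma s"
    using integral_lborel[OF int] by simp
qed

text \<open>Scaling \<open>t\<close> by \<open>A\<close> is a translation of \<open>v\<close> by
  \<open>ln A\<close>.\<close>

lemma Gamma_integral_exp_scaled:
  assumes "Re s > 0" "A > 0"
  shows "integrable lborel (\<lambda>v. exp (s * of_real v) * of_real (exp (- A * exp v)))"
    and "(LINT v|lborel. exp (s * of_real v) * of_real (exp (- A * exp v))) = of_real A powr (-s) * Gamma s"
proof -
  let ?f = "\<lambda>v. exp (s * of_real v) * of_real (exp (- exp v))"
  have eq: "exp (s * of_real v) * of_real (exp (- A * exp v)) = of_real A powr (-s) * ?f (v + ln A)" for v
    using assms by (simp add: of_real_powr_eq_exp exp_add algebra_simps exp_minus)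
  show "integrable lborel (\<lambda>v. exp (s * of_real v) * of_real (exp (- A * exp v)))"
    unfolding eq
    using lborel_integrable_real_affine[OF Gamma_integral_exp(1)[OF assms(1)], of 1 "ln A"]
    by (intro integrable_mult_right) (simp add: add.commute)
  show "(LINT v|lborel. exp (s * of_real v) * of_real (exp (- A * exp v))) = of_real A powr (-s) * Gamma s"
    unfolding eq integral_mult_right_zero lborel_integral_shift[of ?f] Gamma_integral_exp(2)[OF assms(1)] ..
qed

lemma integrable_exp_over_quadratic:
  assumes "0 < Re s" "Re s < 2" "A > 0"
  shows "integrable lborel (\<lambda>v. exp (s * of_real v) / (of_real A ^ 2 + of_real (exp (2 * v))))"
proof -
  have "integrable lborel (\<lambda>v. exp (s * of_real v) * (1 / (of_real A ^ 2 + of_real (exp (2 * v)))))"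
  proof (rule integrable_bilateral_laplace)
    have n: "norm (1 / (of_real A ^ 2 + of_real (exp (2 * v))) :: complex) = 1 / (A ^ 2 + exp (2 * v))" for v
    proof -
      have "1 / (of_real A ^ 2 + of_real (exp (2 * v))) = complex_of_real (1 / (A ^ 2 + exp (2 * v)))" by simp
      thus ?thesis by (simp only: norm_of_real) (simp add: add_nonneg_nonneg)
    qed
    show "norm (1 / (of_real A ^ 2 + of_real (exp (2 * v))) :: complex) \<le> max 1 (1 / A ^ 2) * exp (- 0 * v)" for v
    proof -
      have "1 / (A ^ 2 + exp (2 * v)) \<le> 1 / A ^ 2" using assms by (intro divide_left_mono) (auto intro!: mult_pos_pos add_pos_pos)
      thus ?thesis unfolding n by simp
    qed
    show "norm (1 / (of_real A ^ 2 + of_real (exp (2 * v))) :: complex) \<le> max 1 (1 / A ^ 2) * exp (- 2 * v)" for v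
    proof -
      have "1 / (A ^ 2 + exp (2 * v)) \<le> 1 / exp (2 * v)" using assms by (intro divide_left_mono) (auto intro!: mult_pos_pos add_pos_pos)
      also have "\<dots> = 1 * exp (- 2 * v)" by (simp add: exp_minus field_simps)
      also have "\<dots> \<le> max 1 (1 / A ^ 2) * exp (- 2 * v)" by (intro mult_right_mono) auto
      finally show ?thesis unfolding n .
    qed
  qed (use assms in auto)
  thus ?thesis by simp
qed

text \<open>With \<open>t = exp v\<close> and \<open>u = exp w\<close>, the factor
  \<open>1 / (1 + t^2)\<close> is the integral of \<open>exp (- (1 + t^2) u)\<close> over
  \<open>u\<close>. Exchanging the integrals gives
  \<open>Gamma (s / 2) * Gamma (1 - s / 2) / 2\<close>, and the reflection formula finishes.\<close>

lemma integral_exp_over_one_plus_exp: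
  assumes "0 < Re s" "Re s < 2"
  shows "(LINT v|lborel. exp (s * of_real v) / (1 + of_real (exp (2 * v)))) = of_real pi / (2 * sin (of_real pi * s / 2))"
proof -
  define f where "f = (\<lambda>v w. exp (s * of_real v) * of_real (exp w * exp (- (1 + exp (2 * v)) * exp w)) :: complex)"
  have inner_w: "integrable lborel (\<lambda>w. exp w * exp (- A * exp w))" 
      "(LINT w|lborel. exp w * exp (- A * exp w)) = 1 / A" if "A > 0" for A :: real
  proof -
    have eq: "exp (1 * complex_of_real w) * of_real (exp (- A * exp w)) = of_real (exp w * exp (- A * exp w))" for w
      by (simp add: exp_of_real)
    have "integrable lborel (\<lambda>w. complex_of_real (exp w * exp (- A * exp w)))"
      using Gamma_integral_exp_scaled(1)[of 1 A] that unfolding eq by simp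
    thus "integrable lborel (\<lambda>w. exp w * exp (- A * exp w))" by (simp only: complex_of_real_integrable_eq)
    have "complex_of_real (LINT w|lborel. exp w * exp (- A * exp w)) = of_real A powr (-1)"
      using Gamma_integral_exp_scaled(2)[of 1 A] that unfolding eq integral_complex_of_real by simp
    also have "\<dots> = of_real (1 / A)" using that by (simp add: powr_minus_divide)
    finally show "(LINT w|lborel. exp w * exp (- A * exp w)) = 1 / A" by (simp only: of_real_eq_iff)
  qed
  have pos: "1 + exp (2 * v) > 0" for v :: real by (simp add: add_pos_pos)
  have nf: "norm (f v w) = exp (Re s * v) * (exp w * exp (- (1 + exp (2 * v)) * exp w))" for v w
    by (simp add: f_def norm_mult)
  have I: "integrable (lborel \<Otimes>\<^sub>M lborel) (case_prod f)"
  proof (rule lborel_pair.Fubini_integrable)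
    show "case_prod f \<in> borel_measurable (lborel \<Otimes>\<^sub>M lborel)" unfolding f_def by measurable
    have eq: "(\<lambda>x. LINT y|lborel. norm (case_prod f (x, y))) = (\<lambda>v. exp (Re s * v) / (1 + exp (2 * v)))"
    proof
      fix v show "(LINT y|lborel. norm (case_prod f (v, y))) = exp (Re s * v) / (1 + exp (2 * v))"
        unfolding prod.case nf integral_mult_right_zero inner_w(2)[OF pos] by simp
    qed
    have "integrable lborel (\<lambda>v. exp (Re s * v) / (1 + exp (2 * v)))"
    proof -
      have "integrable lborel (\<lambda>v. norm (exp (s * of_real v) / (of_real 1 ^ 2 + of_real (exp (2 * v)))))"
        using integrable_exp_over_quadratic[OF assms, of 1] by (intro integrable_norm) simp
      also have "(\<lambda>v. norm (exp (s * of_real v) / (of_real 1 ^ 2 + of_real (exp (2 * v))))) = (\<lambda>v. exp (Re s * v) / (1 + exp (2 * v)))"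
      proof
        fix v :: real
        have "exp (s * of_real v) / (of_real 1 ^ 2 + of_real (exp (2 * v))) = exp (s * of_real v) / complex_of_real (1 + exp (2 * v))" by simp
        thus "norm (exp (s * of_real v) / (of_real 1 ^ 2 + of_real (exp (2 * v)))) = exp (Re s * v) / (1 + exp (2 * v))"
          using pos[of v] by (simp only: norm_divide norm_of_real) simp
      qed
      finally show ?thesis .
    qed
    thus "integrable lborel (\<lambda>x. LINT y|lborel. norm (case_prod f (x, y)))" unfolding eq .
    show "AE x in lborel. integrable lborel (\<lambda>y. case_prod f (x, y))"
      unfolding f_def prod.case
      by (intro AE_I2 integrable_mult_right) (simp only: complex_of_real_integrable_eq inner_w(1)[OF pos])
  qed
  have "(LINT v|lborel. (LINT w|lborel. f v w)) = (LINT v|lborel. exp (s * of_real v) / (1 + of_real (exp (2 * v))))"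
  proof (rule Bochner_Integration.integral_cong[OF refl])
    fix v
    show "(LINT w|lborel. f v w) = exp (s * of_real v) / (1 + of_real (exp (2 * v)))"
      unfolding f_def integral_mult_right_zero integral_complex_of_real inner_w(2)[OF pos] by simp
  qed
  moreover have "(LINT w|lborel. (LINT v|lborel. f v w)) = of_real pi / (2 * sin (of_real pi * s / 2))"
  proof -
    have "(LINT v|lborel. f v w) = 1 / 2 * Gamma (s / 2) * (exp ((1 - s / 2) * of_real w) * of_real (exp (- exp w)))" for w
    proof -
      \<comment> \<open>The integrand is written in \<open>2 v\<close>, that is in
        \<open>t^2\<close>; this halves the exponent and brings the Jacobian
        \<open>1 / 2\<close>.\<close>
      have fe: "f v w = of_real (exp w * exp (- exp w)) * (exp (s / 2 * of_real (0 + 2 * v)) * of_real (exp (- exp w * exp (0 + 2 * v))))" for v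
      proof -
        have "exp (- (1 + exp (2 * v)) * exp w) = exp (- exp w) * exp (- exp w * exp (0 + 2 * v))"
          unfolding exp_add [symmetric] by (simp add: ring_distribs mult.commute)
        moreover have "s / 2 * complex_of_real (0 + 2 * v) = s * of_real v" by simp
        ultimately show ?thesis unfolding f_def by (simp only: of_real_mult mult_ac)
      qed
      have "(LINT v|lborel. f v w) = of_real (exp w * exp (- exp w)) * (LINT v|lborel. exp (s / 2 * of_real (0 + 2 * v)) * of_real (exp (- exp w * exp (0 + 2 * v))))"
        unfolding fe integral_mult_right_zero ..
      also have "(LINT v|lborel. exp (s / 2 * of_real (0 + 2 * v)) * of_real (exp (- exp w * exp (0 + 2 * v)))) =
         1 / 2 * (LINT v|lborel. exp (s / 2 * of_real v) * of_real (exp (- exp w * exp v)))"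
        using lborel_integral_real_affine[of 2 "\<lambda>v. exp (s / 2 * of_real v) * of_real (exp (- exp w * exp v))" 0]
        by (simp add: scaleR_conv_of_real)
      also have "(LINT v|lborel. exp (s / 2 * of_real v) * of_real (exp (- exp w * exp v))) = of_real (exp w) powr (- (s / 2)) * Gamma (s / 2)"
        using Gamma_integral_exp_scaled(2)[of "s / 2" "exp w"] assms by simp
      finally have "(LINT v|lborel. f v w) = 1 / 2 * Gamma (s / 2) *
          (of_real (exp w) * of_real (exp w) powr (- (s / 2)) * of_real (exp (- exp w)))"
        by (simp only: of_real_mult mult_ac)
      moreover have "of_real (exp w) * of_real (exp w) powr (- (s / 2)) = exp ((1 - s / 2) * of_real w)"
        unfolding of_real_exp_powr unfolding exp_of_real [symmetric] exp_add [symmetric] by (simp add: algebra_simps)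
      ultimately show ?thesis by (simp only:)
    qed
    hence "(LINT w|lborel. (LINT v|lborel. f v w)) = 1 / 2 * Gamma (s / 2) * Gamma (1 - s / 2)"
      using assms by (simp only: integral_mult_right_zero) (subst Gamma_integral_exp(2), auto)
    thus ?thesis using Gamma_reflection_complex[of "s / 2"] by simp
  qed
  ultimately show ?thesis using lborel_pair.Fubini_integral[OF I] by simp
qed

text \<open>Substituting \<open>A t\<close> for \<open>t\<close> reduces to \<open>A = 1\<close>;
  homogeneity yields the exponent \<open>s - 2\<close>.\<close>

lemma integral_exp_over_quadratic:
  assumes "0 < Re s" "Re s < 2" "A > 0"
  shows "(LINT v|lborel. exp (s * of_real v) / (of_real A ^ 2 + of_real (exp (2 * v)))) =
           of_real A powr (s - 2) * (of_real pi / (2 * sin (of_real pi * s / 2)))"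
proof -
  let ?f = "\<lambda>v. exp (s * of_real v) / (1 + of_real (exp (2 * v))) :: complex"
  have eq: "exp (s * of_real v) / (of_real A ^ 2 + of_real (exp (2 * v))) = of_real A powr (s - 2) * ?f (v - ln A)" for v
  proof -
    have A2: "exp (2 * ln A) = A ^ 2" using assms by (simp only: exp_double exp_ln)
    have "1 + exp (2 * (v - ln A)) = (A ^ 2 + exp (2 * v)) / A ^ 2"
    proof -
      have "exp (2 * (v - ln A)) = exp (2 * v) / A ^ 2" by (simp only: right_diff_distrib exp_diff A2)
      thus ?thesis using assms by (simp add: field_simps)
    qed
    hence *: "1 + complex_of_real (exp (2 * (v - ln A))) = (of_real A ^ 2 + of_real (exp (2 * v))) / of_real A ^ 2"
      by (metis of_real_1 of_real_add of_real_divide of_real_power)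
    have "of_real A powr (s - 2) * exp (s * of_real (v - ln A)) = exp (s * of_real v) / of_real A ^ 2"
    proof -
      have "of_real A powr (s - 2) * exp (s * of_real (v - ln A)) = exp (s * of_real v) * complex_of_real (exp (- (2 * ln A)))"
        using assms by (simp add: of_real_powr_eq_exp algebra_simps flip: exp_add exp_of_real)
      thus ?thesis unfolding exp_minus A2 by (simp add: field_simps)
    qed
    hence "of_real A powr (s - 2) * ?f (v - ln A) = exp (s * of_real v) / of_real A ^ 2 / (1 + of_real (exp (2 * (v - ln A))))"
      by (metis times_divide_eq_right)
    also have "\<dots> = exp (s * of_real v) / (of_real A ^ 2 + of_real (exp (2 * v)))"
      unfolding * using assms by simp
    finally show ?thesis ..
  qed
  show ?thesis
    unfolding eq integral_mult_right_zero 
    using lborel_integral_shift[of ?f "- ln A"] integral_exp_over_one_plus_exp[OF assms(1,2)] by simp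
qed

section \<open>Partial fractions\<close>

lemma sin_pi_times_eq_0_iff:
  fixes z :: complex
  shows "sin (of_real pi * z) = 0 \<longleftrightarrow> z \<in> \<int>"
proof
  assume "sin (of_real pi * z) = 0"
  then obtain n :: int where "of_real pi * z = of_real (n * pi)" by (auto simp: sin_eq_0)
  hence "z = of_int n" by simp
  thus "z \<in> \<int>" by simp
next
  assume "z \<in> \<int>"
  then obtain n where "z = of_int n" by (elim Ints_cases)
  thus "sin (of_real pi * z) = 0" by (auto simp: sin_eq_0 intro!: exI[of _ n])
qed

text \<open>Splitting into partial fractions gives convergent integrals only for \<open>0 < Re nu < 2\<close>;
  the rest of the strip, in particular the line \<open>Re nu = 0\<close>, follows by analytic continuation.\<close>
lemma integral_exp_over_two_quadratics:
  fixes A B :: real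
  assumes nu: "- 2 < Re nu" "Re nu < 2" and AB: "A > 0" "B > 0" "A \<noteq> B"
    and sn: "sin (of_real pi * nu / 2) \<noteq> 0"
  shows "(LINT v|lborel. exp ((nu + 2) * of_real v) /
            ((of_real A ^ 2 + of_real (exp (2 * v))) * (of_real B ^ 2 + of_real (exp (2 * v))))) =
         of_real pi / (2 * sin (of_real pi * nu / 2)) *
           ((of_real A powr nu - of_real B powr nu) / (of_real A ^ 2 - of_real B ^ 2))"
proof -
  \<comment> \<open>The factor \<open>exp (2 * v)\<close> stays inside \<open>f\<close>, which makes
    the strip of \<open>P\<close> symmetric about \<open>0\<close> and lets \<open>nu\<close> itself
    be the variable.\<close>
  define f :: "real \<Rightarrow> complex" where
    "f = (\<lambda>v. of_real (exp (2 * v) / ((A ^ 2 + exp (2 * v)) * (B ^ 2 + exp (2 * v)))))"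
  define P where "P = (\<lambda>s. LINT v|lborel. exp (s * of_real v) * f v)"
  define C where "C = max 1 (1 / (A ^ 2 * B ^ 2))"
  have pos: "A ^ 2 + exp (2 * v) > 0" "B ^ 2 + exp (2 * v) > 0" for v by (auto intro: add_nonneg_pos)
  have pos': "of_real A ^ 2 + of_real (exp (2 * v)) \<noteq> (0::complex)" "of_real B ^ 2 + of_real (exp (2 * v)) \<noteq> (0::complex)" for v
    using pos[of v] by (metis less_irrefl of_real_0 of_real_add of_real_eq_iff of_real_power)+
  have D: "of_real A ^ 2 - of_real B ^ 2 \<noteq> (0::complex)"
  proof -
    have "A ^ 2 - B ^ 2 \<noteq> 0" using AB by (simp add: power2_eq_iff)
    thus ?thesis by (metis of_real_0 of_real_diff of_real_eq_iff of_real_power)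
  qed
  have nf: "norm (f v) = exp (2 * v) / ((A ^ 2 + exp (2 * v)) * (B ^ 2 + exp (2 * v)))" for v
    unfolding f_def norm_of_real using pos[of v] by simp
  have "P holomorphic_on {s. - 2 < Re s \<and> Re s < 2}"
    unfolding P_def
  proof (rule holomorphic_bilateral_laplace)
    show "f \<in> borel_measurable borel" unfolding f_def by measurable
    show "norm (f v) \<le> C * exp (- (- 2) * v)" for v
    proof -
      have "norm (f v) \<le> exp (2 * v) / (A ^ 2 * B ^ 2)"
        unfolding nf using AB by (intro divide_left_mono mult_mono mult_pos_pos pos) auto
      also have "\<dots> = 1 / (A ^ 2 * B ^ 2) * exp (- (- 2) * v)" by simp
      also have "\<dots> \<le> C * exp (- (- 2) * v)" by (intro mult_right_mono) (auto simp: C_def)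
      finally show ?thesis .
    qed
    show "norm (f v) \<le> C * exp (- 2 * v)" for v
    proof -
      have "norm (f v) \<le> exp (2 * v) / (exp (2 * v) * exp (2 * v))"
        unfolding nf using AB by (intro divide_left_mono mult_mono mult_pos_pos pos) auto
      also have "\<dots> = 1 * exp (- 2 * v)" by (simp add: exp_minus field_simps)
      also have "\<dots> \<le> C * exp (- 2 * v)" by (intro mult_right_mono) (auto simp: C_def)
      finally show ?thesis .
    qed
  qed
  hence holP: "(\<lambda>s. P s * (2 * sin (of_real pi * s / 2)) * (of_real A ^ 2 - of_real B ^ 2)) holomorphic_on {s. - 2 < Re s \<and> Re s < 2}"
    by (intro holomorphic_intros) auto
  \<comment> \<open>Denominators are cleared so that both sides are holomorphic on the whole strip,
    including \<open>s = 0\<close>, where the sine vanishes.\<close>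
  have "P nu * (2 * sin (of_real pi * nu / 2)) * (of_real A ^ 2 - of_real B ^ 2) =
        of_real pi * (of_real A powr nu - of_real B powr nu)"
  proof (rule analytic_continuation_open[where f = "\<lambda>s. P s * (2 * sin (of_real pi * s / 2)) * (of_real A ^ 2 - of_real B ^ 2)"
        and g = "\<lambda>s. of_real pi * (of_real A powr s - of_real B powr s)"
        and s = "{s. 0 < Re s \<and> Re s < 2}" and s' = "{s. - 2 < Re s \<and> Re s < 2}"])
    show "open {s. 0 < Re s \<and> Re s < 2}" "open {s. - 2 < Re s \<and> Re s < 2}"
      by (simp_all add: Collect_conj_eq open_Int open_halfspace_Re_gt open_halfspace_Re_lt)
    show "{s. 0 < Re s \<and> Re s < 2} \<noteq> {}" by (auto intro!: exI[of _ 1])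
    show "connected {s. - 2 < Re s \<and> Re s < 2}"
      by (intro convex_connected) (simp add: Collect_conj_eq convex_Int convex_halfspace_Re_gt convex_halfspace_Re_lt)
    show "(\<lambda>s. of_real pi * (of_real A powr s - of_real B powr s)) holomorphic_on {s. - 2 < Re s \<and> Re s < 2}"
      using AB by (intro holomorphic_intros) auto
    fix s assume s: "s \<in> {s. 0 < Re s \<and> Re s < 2}"
    have sins: "sin (of_real pi * s / 2) \<noteq> 0"
    proof
      assume "sin (of_real pi * s / 2) = 0"
      hence "s / 2 \<in> \<int>" using sin_pi_times_eq_0_iff[of "s / 2"] by simp
      then obtain n where "s / 2 = of_int n" by (elim Ints_cases)
      hence "s = 2 * of_int n" by (simp add: field_simps)
      hence "Re s = 2 * of_int n" by simp
      hence "0 < n" "n < 1" using s by auto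
      thus False by linarith
    qed
    have "P s = (LINT v|lborel. (of_real B ^ 2 / (of_real B ^ 2 - of_real A ^ 2)) * (exp (s * of_real v) / (of_real B ^ 2 + of_real (exp (2 * v))))
             - (of_real A ^ 2 / (of_real B ^ 2 - of_real A ^ 2)) * (exp (s * of_real v) / (of_real A ^ 2 + of_real (exp (2 * v)))))"
      unfolding P_def
    proof (rule Bochner_Integration.integral_cong[OF refl])
      fix v
      have alg: "E * (x / ((a + x) * (b + x))) = b / (b - a) * (E / (b + x)) - a / (b - a) * (E / (a + x))"
        if "a + x \<noteq> 0" "b + x \<noteq> 0" "a - b \<noteq> 0" for a b x E :: complex
      proof -
        have "b - a \<noteq> 0" using that by auto
        thus ?thesis using that by (simp add: divide_simps) (simp add: algebra_simps)
      qed
      show "exp (s * of_real v) * f v = (of_real B ^ 2 / (of_real B ^ 2 - of_real A ^ 2)) * (exp (s * of_real v) / (of_real B ^ 2 + of_real (exp (2 * v))))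
             - (of_real A ^ 2 / (of_real B ^ 2 - of_real A ^ 2)) * (exp (s * of_real v) / (of_real A ^ 2 + of_real (exp (2 * v))))"
        using alg[OF pos' D, of "exp (s * of_real v)" v] by (simp add: f_def)
    qed
    also have "\<dots> = (of_real B ^ 2 / (of_real B ^ 2 - of_real A ^ 2)) * (of_real B powr (s - 2) * (of_real pi / (2 * sin (of_real pi * s / 2))))
             - (of_real A ^ 2 / (of_real B ^ 2 - of_real A ^ 2)) * (of_real A powr (s - 2) * (of_real pi / (2 * sin (of_real pi * s / 2))))"
    proof -
      have s': "0 < Re s" "Re s < 2" using s by auto
      show ?thesis
        by (subst Bochner_Integration.integral_diff)
           (intro integrable_mult_right integrable_exp_over_quadratic s' AB |
            simp only: integral_mult_right_zero integral_exp_over_quadratic[OF s' AB(1)] integral_exp_over_quadratic[OF s' AB(2)])+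
    qed
    also have "\<dots> = (of_real B powr s - of_real A powr s) / (of_real B ^ 2 - of_real A ^ 2) * (of_real pi / (2 * sin (of_real pi * s / 2)))"
    proof -
      have c: "of_real c ^ 2 * of_real c powr (s - 2) = of_real c powr s" if "c > 0" for c :: real
        using that by (simp add: powr_diff)
      show ?thesis unfolding c[OF AB(1), symmetric] c[OF AB(2), symmetric]
        by (simp add: diff_divide_distrib ring_distribs mult_ac)
    qed
    finally have e: "P s = (of_real B powr s - of_real A powr s) / (of_real B ^ 2 - of_real A ^ 2) * (of_real pi / (2 * sin (of_real pi * s / 2)))" .
    have alg: "(b - a) / (B2 - A2) * (p / (2 * sn)) * (2 * sn) * (A2 - B2) = p * (a - b)"
      if "A2 - B2 \<noteq> 0" "sn \<noteq> 0" for a b A2 B2 p sn :: complex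
    proof -
      have "B2 - A2 \<noteq> 0" using that by auto
      thus ?thesis using that by (simp add: divide_simps) (simp add: algebra_simps)
    qed
    show "P s * (2 * sin (of_real pi * s / 2)) * (of_real A ^ 2 - of_real B ^ 2) =
                  of_real pi * (of_real A powr s - of_real B powr s)"
      unfolding e by (rule alg[OF D sins])
  qed (use nu holP in auto)
  moreover have "P nu = (LINT v|lborel. exp ((nu + 2) * of_real v) /
            ((of_real A ^ 2 + of_real (exp (2 * v))) * (of_real B ^ 2 + of_real (exp (2 * v)))))"
    unfolding P_def f_def by (intro Bochner_Integration.integral_cong) (auto simp: ring_distribs exp_add exp_of_real [symmetric])
  moreover have "P' = p / (2 * sn) * (d / D')" if "P' * (2 * sn) * D' = p * d" "sn \<noteq> 0" "D' \<noteq> 0" for P' p sn d D' :: complex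
    using that by (simp add: field_simps)
  ultimately show ?thesis using sn D by metis
qed

text \<open>Both sides arise from differentiating the reflection formula for
  \<open>Gamma z * Gamma (1 - z)\<close>.\<close>

lemma Digamma_reflection:
  fixes z :: complex
  assumes "z \<notin> \<int>"
  shows "Digamma (1 - z) - Digamma z = of_real pi * cot (of_real pi * z)"
proof -
  have z1: "z \<notin> \<int>\<^sub>\<le>\<^sub>0" "1 - z \<notin> \<int>\<^sub>\<le>\<^sub>0"
  proof -
    show "z \<notin> \<int>\<^sub>\<le>\<^sub>0" using assms nonpos_Ints_subset_Ints by blast
    show "1 - z \<notin> \<int>\<^sub>\<le>\<^sub>0"
    proof
      assume "1 - z \<in> \<int>\<^sub>\<le>\<^sub>0"
      hence "1 - z \<in> \<int>" using nonpos_Ints_subset_Ints by blast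
      hence "1 - (1 - z) \<in> \<int>" using Ints_diff[OF Ints_1] by blast
      thus False using assms by simp
    qed
  qed
  have sn: "sin (of_real pi * z) \<noteq> 0"
    using assms by (simp add: sin_pi_times_eq_0_iff)
  have "((\<lambda>z. Gamma z * Gamma (1 - z)) has_field_derivative
          Gamma z * Gamma (1 - z) * (Digamma z - Digamma (1 - z))) (at z)"
    using z1 by (auto intro!: derivative_eq_intros simp: algebra_simps)
  moreover have "((\<lambda>z. Gamma z * Gamma (1 - z)) has_field_derivative
          - (of_real pi / sin (of_real pi * z)) * (of_real pi * cot (of_real pi * z))) (at z)"
    unfolding Gamma_reflection_complex
    using sn by (auto intro!: derivative_eq_intros simp: cot_def field_simps power2_eq_square)
  ultimately have "Gamma z * Gamma (1 - z) * (Digamma z - Digamma (1 - z)) =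
       - (of_real pi / sin (of_real pi * z)) * (of_real pi * cot (of_real pi * z))"
    by (rule DERIV_unique)
  hence "(of_real pi / sin (of_real pi * z)) * (Digamma (1 - z) - Digamma z - of_real pi * cot (of_real pi * z)) = 0"
    unfolding Gamma_reflection_complex by (simp add: algebra_simps)
  thus ?thesis using sn by simp
qed

text \<open>In the difference of the limit formulas for \<open>Digamma (1 - z)\<close> and
  \<open>Digamma z\<close> the logarithms cancel. The pairing of \<open>n\<close> with
  \<open>- (n + 1)\<close>, rather than with \<open>- n\<close>, is the one that later groups into
  residue classes modulo \<open>q\<close>.\<close>

lemma cot_partial_fractions_LIMSEQ:
  fixes z :: complex
  assumes "z \<notin> \<int>"
  shows "(\<lambda>m. \<Sum>n<m. 1 / (z + of_nat n) + 1 / (z - of_nat (Suc n))) \<longlonglongrightarrow> of_real pi * cot (of_real pi * z)"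
proof -
  have "z \<noteq> 0" "1 - z \<noteq> 0" using assms by auto
  from tendsto_diff[OF Digamma_LIMSEQ[OF this(2)] Digamma_LIMSEQ[OF this(1)]]
  have "(\<lambda>m. (\<Sum>n<m. inverse (z + of_nat n)) - (\<Sum>n<m. inverse (1 - z + of_nat n))) \<longlonglongrightarrow> of_real pi * cot (of_real pi * z)"
    unfolding Digamma_reflection[OF assms] by simp
  also have "(\<lambda>m. (\<Sum>n<m. inverse (z + of_nat n)) - (\<Sum>n<m. inverse (1 - z + of_nat n))) =
     (\<lambda>m. \<Sum>n<m. 1 / (z + of_nat n) + 1 / (z - of_nat (Suc n)))"
  proof
    fix m
    have "- inverse (1 - z + of_nat n) = 1 / (z - of_nat (Suc n))" for n
    proof -
      have "z - of_nat (Suc n) = - (1 - z + of_nat n)" by simp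
      thus ?thesis by (simp only: divide_inverse inverse_minus_eq mult_1)
    qed
    hence "- (\<Sum>n<m. inverse (1 - z + of_nat n)) = (\<Sum>n<m. 1 / (z - of_nat (Suc n)))"
      unfolding sum_negf [symmetric] by (intro sum.cong) auto
    thus "(\<Sum>n<m. inverse (z + of_nat n)) - (\<Sum>n<m. inverse (1 - z + of_nat n)) =
       (\<Sum>n<m. 1 / (z + of_nat n) + 1 / (z - of_nat (Suc n)))"
      by (simp add: sum.distrib divide_inverse)
  qed
  finally show ?thesis .
qed

text \<open>For \<open>norm w < 1\<close> the left side is the sum of \<open>w ^ d\<close> over
  \<open>d \<ge> 1\<close>. In terms of \<open>E = exp (\<i> * pi * z)\<close>, whose square is
  \<open>w\<close>, sine and cosine are rational and the claim is algebra.\<close>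

lemma geometric_eq_cot:
  fixes z :: complex
  assumes "z \<notin> \<int>"
  defines "w \<equiv> exp (2 * of_real pi * \<i> * z)"
  shows "w / (1 - w) = - 1 / 2 + \<i> / 2 * cot (of_real pi * z)"
proof -
  define E where "E = exp (\<i> * (of_real pi * z))"
  have E: "E \<noteq> 0" by (simp add: E_def)
  have w: "w = E ^ 2" unfolding w_def E_def by (simp add: algebra_simps flip: exp_double)
  have sn: "sin (of_real pi * z) \<noteq> 0"
    using assms by (simp add: sin_pi_times_eq_0_iff)
  have s: "sin (of_real pi * z) = (E - 1 / E) / (2 * \<i>)" and c: "cos (of_real pi * z) = (E + 1 / E) / 2"
    unfolding sin_exp_eq cos_exp_eq E_def by (simp_all add: exp_minus field_simps)
  have s': "sin (of_real pi * z) = (E ^ 2 - 1) / (2 * \<i> * E)" and c': "cos (of_real pi * z) = (E ^ 2 + 1) / (2 * E)"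
    unfolding s c using E by (simp_all add: field_simps power2_eq_square)
  have E1: "E ^ 2 - 1 \<noteq> 0" using sn unfolding s' by auto
  have "\<i> / 2 * cot (of_real pi * z) = - ((E ^ 2 + 1) / (2 * (E ^ 2 - 1)))"
    unfolding cot_def s' c' using E E1 by (simp add: field_simps)
  moreover have "w / (1 - w) = - 1 / 2 - (E ^ 2 + 1) / (2 * (E ^ 2 - 1))"
  proof -
    have "1 - E ^ 2 \<noteq> 0" using E1 by auto
    thus ?thesis unfolding w using E1 by (simp add: divide_simps) (simp add: algebra_simps)
  qed
  ultimately show ?thesis by (simp only: diff_conv_add_uminus)
qed

text \<open>Common source of both expansions: \<open>z = \<i> * y\<close> gives the Planck factor,
  \<open>z = h / q + \<i> * t\<close> the character series.\<close>

lemma geometric_partial_fractions_LIMSEQ: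
  fixes z :: complex
  assumes "z \<notin> \<int>"
  defines "w \<equiv> exp (2 * of_real pi * \<i> * z)"
  shows "(\<lambda>m. \<Sum>n<m. 1 / (z + of_nat n) + 1 / (z - of_nat (Suc n))) \<longlonglongrightarrow> - (2 * of_real pi * \<i>) * (w / (1 - w) + 1 / 2)"
proof -
  have "- (2 * of_real pi * \<i>) * (w / (1 - w) + 1 / 2) = of_real pi * cot (of_real pi * z)"
    using geometric_eq_cot[OF assms(1)] unfolding w_def by (simp add: field_simps)
  thus ?thesis using cot_partial_fractions_LIMSEQ[OF assms(1)] by simp
qed

lemma planck_partial_fractions:
  fixes y :: real
  assumes "y > 0"
  shows "(\<lambda>m. 1 / (real (Suc m) ^ 2 + y ^ 2)) sums (pi / y * (1 / (exp (2 * pi * y) - 1) + 1 / 2 - 1 / (2 * pi * y)))"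
proof -
  define z where "z = \<i> * of_real y"
  have z: "z \<notin> \<int>" using assms by (auto simp: z_def Ints_def complex_eq_iff)
  define w where "w = exp (2 * of_real pi * \<i> * z)"
  have w: "w = of_real (exp (- 2 * pi * y))"
  proof -
    have "2 * of_real pi * \<i> * z = of_real (- 2 * pi * y)" by (simp add: z_def)
    thus ?thesis unfolding w_def by (simp only: exp_of_real)
  qed
  have ww: "w / (1 - w) = of_real (1 / (exp (2 * pi * y) - 1))"
  proof -
    have "exp (2 * pi * y) > 1" using assms by simp
    hence "exp (- 2 * pi * y) / (1 - exp (- 2 * pi * y)) = 1 / (exp (2 * pi * y) - 1)"
      by (simp add: exp_minus divide_simps)
    thus ?thesis unfolding w by (metis of_real_1 of_real_diff of_real_divide)
  qed
  have t0: "(\<lambda>m. 1 / (z + of_nat m)) \<longlonglongrightarrow> 0"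
    unfolding divide_inverse by (intro tendsto_mult_right_zero filterlim_compose[OF tendsto_inverse_0] tendsto_add_filterlim_at_infinity[OF tendsto_const] tendsto_of_nat)
  \<comment> \<open>Dropping the term \<open>1 / z\<close> and adding the vanishing
    \<open>1 / (z + m)\<close> turns the pairs \<open>n\<close>, \<open>- (n + 1)\<close> into the
    symmetric pairs \<open>n + 1\<close>, \<open>- (n + 1)\<close>.\<close>
  have "(\<lambda>m. (\<Sum>n<m. 1 / (z + of_nat n) + 1 / (z - of_nat (Suc n))) - 1 / z + 1 / (z + of_nat m)) \<longlonglongrightarrow>
     - (2 * of_real pi * \<i>) * (w / (1 - w) + 1 / 2) - 1 / z + 0"
    unfolding w_def by (intro tendsto_intros geometric_partial_fractions_LIMSEQ z t0)
  also have "(\<lambda>m. (\<Sum>n<m. 1 / (z + of_nat n) + 1 / (z - of_nat (Suc n))) - 1 / z + 1 / (z + of_nat m)) =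
    (\<lambda>m. \<Sum>n<m. 1 / (z + of_nat (Suc n)) + 1 / (z - of_nat (Suc n)))"
  proof
    fix m show "(\<Sum>n<m. 1 / (z + of_nat n) + 1 / (z - of_nat (Suc n))) - 1 / z + 1 / (z + of_nat m) = (\<Sum>n<m. 1 / (z + of_nat (Suc n)) + 1 / (z - of_nat (Suc n)))"
      by (induction m) (simp_all add: algebra_simps)
  qed
  finally have s1: "(\<lambda>n. 1 / (z + of_nat (Suc n)) + 1 / (z - of_nat (Suc n))) sums (- (2 * of_real pi * \<i>) * (w / (1 - w) + 1 / 2) - 1 / z)"
    by (simp add: sums_def)
  have t: "1 / (z + of_nat (Suc n)) + 1 / (z - of_nat (Suc n)) = - 2 * \<i> * of_real (y * (1 / (real (Suc n) ^ 2 + y ^ 2)))" for n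
  proof -
    have nz: "z + of_nat (Suc n) \<noteq> 0" "z - of_nat (Suc n) \<noteq> 0"
      using assms by (auto simp: z_def complex_eq_iff)
    have pr: "(z + of_nat (Suc n)) * (z - of_nat (Suc n)) = - of_real (real (Suc n) ^ 2 + y ^ 2)"
      by (simp add: z_def algebra_simps power2_eq_square)
    have "1 / (z + of_nat (Suc n)) + 1 / (z - of_nat (Suc n)) = 2 * z / ((z + of_nat (Suc n)) * (z - of_nat (Suc n)))"
      using nz by (simp add: divide_simps)
    also have "\<dots> = - 2 * \<i> * of_real (y * (1 / (real (Suc n) ^ 2 + y ^ 2)))"
      unfolding pr divide_minus_right by (simp add: z_def)
    finally show ?thesis .
  qed
  \<comment> \<open>The factor \<open>\<i> / (2 * y)\<close> makes the terms real; the second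
    \<open>\<i>\<close> moves them to the imaginary part, from which the real series is read
    off.\<close>
  have "(\<lambda>n. Im (\<i> / (2 * of_real y) * (- 2 * \<i> * of_real (y * (1 / (real (Suc n) ^ 2 + y ^ 2)))) * \<i>)) sums
        Im (\<i> / (2 * of_real y) * (- (2 * of_real pi * \<i>) * (w / (1 - w) + 1 / 2) - 1 / z) * \<i>)"
    using s1 unfolding t by (intro sums_Im sums_mult2 sums_mult)
  also have "(\<lambda>n. Im (\<i> / (2 * of_real y) * (- 2 * \<i> * of_real (y * (1 / (real (Suc n) ^ 2 + y ^ 2)))) * \<i>)) = (\<lambda>n. 1 / (real (Suc n) ^ 2 + y ^ 2))"
    using assms by simp
  also have "Im (\<i> / (2 * of_real y) * (- (2 * of_real pi * \<i>) * (w / (1 - w) + 1 / 2) - 1 / z) * \<i>) =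
     pi / y * (1 / (exp (2 * pi * y) - 1) + 1 / 2 - 1 / (2 * pi * y))"
  proof -
    have "\<i> / (2 * of_real y) * (- (2 * of_real pi * \<i>) * (w / (1 - w) + 1 / 2) - 1 / z) * \<i> =
      \<i> * of_real (pi / y * (1 / (exp (2 * pi * y) - 1) + 1 / 2 - 1 / (2 * pi * y)))"
      unfolding ww z_def using assms by (simp add: algebra_simps divide_simps)
    thus ?thesis by (simp only: Im_i_times Re_complex_of_real)
  qed
  finally show ?thesis .
qed

section \<open>Even primitive characters and Gauss sums\<close>

definition root_of_unity_power :: "nat \<Rightarrow> nat \<Rightarrow> complex" where
  "root_of_unity_power q n = exp (2 * of_real pi * \<i> * of_nat n / of_nat q)"

lemma root_of_unity_power_add:
  "root_of_unity_power q (m + n) = root_of_unity_power q m * root_of_unity_power q n"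
  by (simp add: root_of_unity_power_def ring_distribs add_divide_distrib exp_add)

lemma root_of_unity_power_mult: "root_of_unity_power q (m * n) = root_of_unity_power q m ^ n"
  by (simp add: root_of_unity_power_def mult_ac flip: exp_of_nat_mult)

lemma root_of_unity_power_self: "q > 0 \<Longrightarrow> root_of_unity_power q q = 1"
  by (simp add: root_of_unity_power_def exp_eq_1)

lemma root_of_unity_power_mod: "q > 0 \<Longrightarrow> root_of_unity_power q (n mod q) = root_of_unity_power q n"
proof -
  assume "q > 0"
  have "root_of_unity_power q n = root_of_unity_power q (q * (n div q) + n mod q)" by simp
  also have "\<dots> = root_of_unity_power q (n mod q)"
    unfolding root_of_unity_power_add root_of_unity_power_mult using \<open>q > 0\<close> by (simp add: root_of_unity_power_self)
  finally show ?thesis by simp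
qed

lemma root_of_unity_power_eq_1_iff: "q > 0 \<Longrightarrow> root_of_unity_power q n = 1 \<longleftrightarrow> q dvd n"
proof
  assume q: "q > 0" and "root_of_unity_power q n = 1"
  then obtain k :: int where "2 * pi * real n / real q = 2 * of_int k * pi"
    by (auto simp: root_of_unity_power_def exp_eq_1)
  hence "real n = of_int k * real q" using q by (simp add: field_simps)
  hence "real_of_int (int n) = real_of_int (k * int q)" by simp
  hence "int n = k * int q" by (simp only: of_int_eq_iff)
  thus "q dvd n" by (metis dvd_triv_right int_dvd_int_iff)
next
  assume "q > 0" "q dvd n"
  then obtain k where "n = q * k" by auto
  thus "root_of_unity_power q n = 1" using \<open>q > 0\<close> by (simp add: root_of_unity_power_mult root_of_unity_power_self)
qed

text \<open>Multiplication by a unit permutes the residues modulo \<open>q\<close>, and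
  \<open>f\<close> depends on the residue only.\<close>

lemma sum_mult_coprime_mod:
  fixes f :: "nat \<Rightarrow> complex"
  assumes q: "q > 0" and a: "coprime a q" and f: "\<And>n. f (n mod q) = f n"
  shows "(\<Sum>h<q. f (a * h)) = (\<Sum>h<q. f h)"
proof -
  have inj: "inj_on (\<lambda>h. a * h mod q) {..<q}"
  proof (rule inj_onI)
    fix h h' assume h: "h \<in> {..<q}" "h' \<in> {..<q}" and "a * h mod q = a * h' mod q"
    hence "[a * h = a * h'] (mod q)" by (simp add: cong_def)
    hence "[h = h'] (mod q)" using a by (simp add: cong_mult_lcancel_nat)
    thus "h = h'" using h by (simp add: cong_def)
  qed
  have "(\<lambda>h. a * h mod q) ` {..<q} = {..<q}"
    using q by (intro endo_inj_surj inj) auto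
  hence "bij_betw (\<lambda>h. a * h mod q) {..<q} {..<q}" using inj by (simp add: bij_betw_def)
  from sum.reindex_bij_betw[OF this, of f] show ?thesis by (simp add: f)
qed

text \<open>At \<open>conj_char chi\<close> this is the \<open>F\<close> of the overview. The
  character is a parameter because the roles of \<open>chi\<close> and its conjugate get
  exchanged.\<close>

definition char_exp_series :: "(nat \<Rightarrow> complex) \<Rightarrow> real \<Rightarrow> complex" where
  "char_exp_series chi t = (\<Sum>\<^sub>\<infinity>d\<in>{0<..}. chi d * of_real (exp (- 2 * pi * real d * t)))"

lemma summable_inverse_powr_pos:
  assumes "p > 1"
  shows "(\<lambda>n::nat. real n powr (- p)) summable_on {0<..}"
proof -
  have "summable (\<lambda>n::nat. real n powr (- p))" using assms by (simp add: summable_real_powr_iff)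
  hence "(\<lambda>n::nat. real n powr (- p)) summable_on UNIV"
    by (intro summable_nonneg_imp_summable_on) auto
  thus ?thesis by (rule summable_on_subset_banach) auto
qed

lemma sums_imp_has_sum_pos:
  fixes f :: "nat \<Rightarrow> complex"
  assumes "f sums S" "summable (\<lambda>n. norm (f n))" "f 0 = 0"
  shows "(f has_sum S) {0<..}"
proof -
  have "(f has_sum S) UNIV" using assms by (intro norm_summable_imp_has_sum)
  thus ?thesis by (subst has_sum_cong_neutral[of _ _ _ f]) (use assms in auto)
qed

lemma has_sum_pos_imp_sums_Suc:
  fixes f :: "nat \<Rightarrow> complex"
  assumes "(f has_sum S) {0<..}"
  shows "(\<lambda>n. f (Suc n)) sums S"
proof -
  have "bij_betw Suc UNIV {0<..}" by (rule bij_betwI[of _ _ _ "\<lambda>n. n - 1"]) auto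
  from has_sum_reindex_bij_betw[OF this, of f] show ?thesis
    using assms has_sum_imp_sums by blast
qed

locale even_primitive_char =
  fixes q :: nat and chi :: "nat \<Rightarrow> complex"
  assumes char: "dirichlet_char q chi" and nonprincipal: "\<not> principal_char q chi"
    and even: "even_char q chi" and primitive: "primitive_char q chi"
begin

lemma q_pos: "q > 0" and chi_periodic: "chi (n + q) = chi n" and chi_mult: "chi (m * n) = chi m * chi n"
  and chi_1 [simp]: "chi 1 = 1" and chi_eq_0_iff: "chi n = 0 \<longleftrightarrow> \<not> coprime n q"
  using char by (auto simp: dirichlet_char_def)

lemma chi_Suc_0 [simp]: "chi (Suc 0) = 1"
  using chi_1 by simp

lemma chi_mod: "chi (n mod q) = chi n"
proof -
  have "chi (m + k * q) = chi m" for m k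
  proof (induction k)
    case (Suc k)
    have "m + Suc k * q = m + k * q + q" by simp
    thus ?case using Suc chi_periodic[of "m + k * q"] by metis
  qed simp
  from this[of "n mod q" "n div q"] show ?thesis by simp
qed

lemma chi_cong: "[m = n] (mod q) \<Longrightarrow> chi m = chi n"
  by (metis chi_mod cong_def)

lemma q_gt_1: "q > 1"
proof (rule ccontr)
  assume "\<not> q > 1"
  hence q: "q = 1" using q_pos by simp
  have "chi n = 1" for n
    using chi_cong[of n 1] chi_1 q by (simp add: cong_def del: One_nat_def)
  thus False using nonprincipal by (simp add: principal_char_def)
qed

lemma chi_0 [simp]: "chi 0 = 0" "chi q = 0"
  using q_gt_1 by (auto simp: chi_eq_0_iff)

lemma norm_chi_coprime: "coprime n q \<Longrightarrow> norm (chi n) = 1"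
proof -
  assume c: "coprime n q"
  have pw: "chi (n ^ k) = chi n ^ k" for k using chi_1 by (induction k) (auto simp: chi_mult)
  have "[n ^ totient q = 1] (mod q)" using c by (rule euler_theorem)
  hence "chi n ^ totient q = 1" using chi_cong pw chi_1 by metis
  moreover have "totient q \<noteq> 0" using q_pos by simp
  ultimately show ?thesis using Real_Vector_Spaces.power_eq_1_iff[of "chi n" "totient q"] by auto
qed

lemma norm_chi_le: "norm (chi n) \<le> 1"
  using norm_chi_coprime[of n] chi_eq_0_iff[of n] by (cases "coprime n q") auto

text \<open>Modulo \<open>q\<close>, \<open>q - h\<close> is \<open>(q - 1) * h\<close>, and
  evenness says that \<open>chi (q - 1)\<close> is \<open>1\<close>.\<close>

lemma chi_reflect: "h \<le> q \<Longrightarrow> chi (q - h) = chi h"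
proof -
  assume h: "h \<le> q"
  have "[q - h = (q - 1) * h] (mod q)"
  proof -
    have "int (q - h) - int ((q - 1) * h) = int q * (1 - int h)"
      using h q_pos by (simp add: of_nat_diff algebra_simps)
    hence "int q dvd int (q - h) - int ((q - 1) * h)" by simp
    thus ?thesis by (simp add: cong_iff_dvd_diff flip: cong_int_iff)
  qed
  hence "chi (q - h) = chi (q - 1) * chi h" using chi_cong chi_mult by metis
  thus ?thesis using even by (simp add: even_char_def del: One_nat_def)
qed

text \<open>Analytic facts are stated for \<open>conj_char chi\<close>, because separability turns
  its exponential series into a series in \<open>chi\<close>. Interpreting the locale at the
  conjugate turns them into facts about \<open>chi\<close>.\<close>

lemma conj: "even_primitive_char q (conj_char chi)"
proof
  show "dirichlet_char q (conj_char chi)" using char by (simp add: dirichlet_char_def conj_char_def)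
  show "\<not> principal_char q (conj_char chi)" using nonprincipal
    by (simp add: principal_char_def conj_char_def)
  show "even_char q (conj_char chi)" using even by (simp add: even_char_def conj_char_def)
  show "primitive_char q (conj_char chi)" using primitive
    by (simp add: primitive_char_def conj_char_def)
qed

lemma gauss_sum_lessThan: "gauss_sum q chi = (\<Sum>h<q. chi h * root_of_unity_power q h)"
proof -
  have "gauss_sum q chi = (\<Sum>h=1..q. chi h * root_of_unity_power q h)"
    by (simp add: gauss_sum_def root_of_unity_power_def)
  also have "\<dots> = (\<Sum>h<q. chi h * root_of_unity_power q h)"
  proof -
    have "{..<q} = insert 0 {1..<q}" "{1..q} = insert q {1..<q}" using q_gt_1 by auto
    thus ?thesis by simp
  qed
  finally show ?thesis .
qed

text \<open>For \<open>d\<close> coprime to \<open>q\<close>, replacing \<open>h\<close> by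
  \<open>d * h\<close> pulls out \<open>chi d\<close>. Otherwise primitivity supplies a unit
  \<open>a\<close> that fixes every factor \<open>root_of_unity_power q (h * d)\<close> while
  \<open>chi a\<close> is not \<open>1\<close>; then \<open>chi a * S = S\<close> forces
  \<open>S = 0\<close>.\<close>

lemma gauss_sum_separable:
  "(\<Sum>h<q. chi h * root_of_unity_power q (h * d)) = cnj (chi d) * gauss_sum q chi"
proof -
  define S where "S = (\<Sum>h<q. chi h * root_of_unity_power q (h * d))"
  have per: "chi (n mod q) * root_of_unity_power q (n mod q * k) = chi n * root_of_unity_power q (n * k)" for n k
    unfolding root_of_unity_power_mult root_of_unity_power_mod[OF q_pos] chi_mod ..
  show ?thesis
  proof (cases "coprime d q")
    case True
    have "(\<Sum>h<q. chi (d * h) * root_of_unity_power q (d * h * 1)) = (\<Sum>h<q. chi h * root_of_unity_power q (h * 1))"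
      by (rule sum_mult_coprime_mod[OF q_pos True]) (rule per)
    hence "gauss_sum q chi = chi d * S"
      by (simp add: gauss_sum_lessThan S_def chi_mult sum_distrib_left mult_ac)
    moreover have "cnj (chi d) * chi d = 1"
      using norm_chi_coprime[OF True] by (metis complex_norm_square mult.commute of_real_1 one_power2)
    ultimately have "cnj (chi d) * gauss_sum q chi = S" by (simp flip: mult.assoc)
    thus ?thesis by (simp add: S_def)
  next
    case False
    define g where "g = gcd d q"
    have g: "g dvd q" "g dvd d" "g > 0" using q_pos unfolding g_def by simp_all
    have g1: "g \<noteq> 1" using False unfolding g_def by (metis coprime_iff_gcd_eq_1)
    define m where "m = q div g"
    have qm: "q = m * g" using g by (simp add: m_def)
    have "m dvd q" "m < q"
    proof -
      show "m dvd q" using qm by simp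
      have "g > 1" using g(3) g1 by linarith
      thus "m < q" unfolding m_def using q_pos by (rule div_less_dividend)
    qed
    then obtain a where a: "coprime a q" "[a = 1] (mod m)" "chi a \<noteq> 1"
      using primitive unfolding primitive_char_def by blast
    \<comment> \<open>\<open>a - 1\<close> is divisible by \<open>q / g\<close> and \<open>d\<close>
      by \<open>g\<close>, so \<open>(a - 1) * d\<close> is divisible by \<open>q\<close>.\<close>
    have ad: "[a * d = d] (mod q)"
    proof -
      have "int m dvd int a - 1" using a(2) by (simp add: cong_iff_dvd_diff flip: cong_int_iff)
      moreover have "int g dvd int d" using g by simp
      ultimately have "int m * int g dvd (int a - 1) * int d" by (rule mult_dvd_mono)
      hence "int q dvd int (a * d) - int d" using qm by (simp add: algebra_simps)
      thus ?thesis by (simp add: cong_iff_dvd_diff flip: cong_int_iff)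
    qed
    have "(\<Sum>h<q. chi (a * h) * root_of_unity_power q (a * h * d)) = S"
      unfolding S_def by (rule sum_mult_coprime_mod[OF q_pos a(1), of "\<lambda>h. chi h * root_of_unity_power q (h * d)"]) (rule per)
    moreover have "root_of_unity_power q (a * h * d) = root_of_unity_power q (h * d)" for h
    proof -
      have "[a * h * d = h * d] (mod q)" using cong_mult[OF cong_refl ad, of h] by (simp add: mult_ac)
      thus ?thesis using root_of_unity_power_mod[OF q_pos] unfolding cong_def by metis
    qed
    ultimately have "chi a * S = S" by (simp add: chi_mult S_def sum_distrib_left mult_ac)
    hence "S = 0" using a(3) by simp
    moreover have "chi d = 0" using False by (simp add: chi_eq_0_iff)
    ultimately show ?thesis by (simp add: S_def)
  qed
qed

text \<open>A vanishing Gauss sum makes the whole discrete Fourier transform of \<open>chi\<close>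
  vanish by separability, whereas Fourier inversion at \<open>1\<close> recovers
  \<open>q * chi 1\<close>. The factor \<open>q - 1\<close> stands for \<open>-1\<close> modulo
  \<open>q\<close>.\<close>

lemma gauss_sum_nonzero: "gauss_sum q chi \<noteq> 0"
proof
  assume "gauss_sum q chi = 0"
  hence z: "(\<Sum>h<q. chi h * root_of_unity_power q (h * d)) = 0" for d
    unfolding gauss_sum_separable by simp
  have "0 = (\<Sum>d<q. root_of_unity_power q ((q - 1) * d) * (\<Sum>h<q. chi h * root_of_unity_power q (h * d)))"
    unfolding z by simp
  also have "\<dots> = (\<Sum>h<q. chi h * (\<Sum>d<q. root_of_unity_power q ((q - 1) * d) * root_of_unity_power q (h * d)))"
    unfolding sum_distrib_left by (subst sum.swap) (simp add: mult_ac)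
  also have "\<dots> = (\<Sum>h<q. chi h * (if h = 1 then of_nat q else 0))"
  proof (intro sum.cong refl arg_cong2[where f = "(*)"])
    fix h assume h: "h \<in> {..<q}"
    define w where "w = root_of_unity_power q (q - 1 + h)"
    have "(\<Sum>d<q. root_of_unity_power q ((q - 1) * d) * root_of_unity_power q (h * d)) = (\<Sum>d<q. w ^ d)"
      unfolding w_def by (simp only: root_of_unity_power_add root_of_unity_power_mult power_mult_distrib)
    also have "\<dots> = (if h = 1 then of_nat q else 0)"
    proof (cases "h = 1")
      case True
      hence "w = 1" using q_pos by (simp add: w_def root_of_unity_power_self)
      thus ?thesis using True by simp
    next
      case False
      have "\<not> q dvd q - 1 + h"
      proof
        assume "q dvd q - 1 + h"
        then obtain k where k: "q - 1 + h = q * k" by auto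
        have "q * k < q * 2" using k h q_pos unfolding lessThan_iff by linarith
        moreover have "q * k \<noteq> 0" using k q_gt_1 by linarith
        ultimately have "k = 1" by (simp add: less_2_cases_iff)
        thus False using k False q_gt_1 by simp
      qed
      hence "w \<noteq> 1" using root_of_unity_power_eq_1_iff[OF q_pos] by (simp add: w_def)
      moreover have "w ^ q = 1"
        unfolding w_def using root_of_unity_power_eq_1_iff[OF q_pos] by (simp flip: root_of_unity_power_mult)
      ultimately show ?thesis using False by (simp add: geometric_sum)
    qed
    finally show "(\<Sum>d<q. root_of_unity_power q ((q - 1) * d) * root_of_unity_power q (h * d)) = (if h = 1 then of_nat q else 0)" .
  qed
  also have "\<dots> = of_nat q" using q_gt_1 by (simp add: if_distrib sum.delta cong: if_cong)
  finally show False using q_pos by simp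
qed

lemma sum_chi_eq_0: "(\<Sum>h<q. chi h) = 0"
  using gauss_sum_separable[of 0] by (simp add: root_of_unity_power_def)

section \<open>The exponential series of the character and its partial fractions\<close>

lemma char_exp_series_has_sum:
  assumes "t > 0"
  shows "((\<lambda>d. chi d * of_real (exp (- 2 * pi * real d * t))) has_sum char_exp_series chi t) {0<..}"
    and "summable (\<lambda>d. norm (chi d * of_real (exp (- 2 * pi * real d * t))))"
proof -
  have "summable (\<lambda>d. exp (- 2 * pi * t) ^ d)" using assms by (intro summable_geometric) simp
  hence "summable (\<lambda>d. exp (- 2 * pi * real d * t))" by (simp add: mult_ac flip: exp_of_nat_mult)
  thus s: "summable (\<lambda>d. norm (chi d * of_real (exp (- 2 * pi * real d * t))))"
    by (rule summable_comparison_test[rotated])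
       (use norm_chi_le in \<open>auto intro!: exI[of _ 0] mult_left_le_one_le simp: norm_mult\<close>)
  hence "(\<lambda>d. chi d * of_real (exp (- 2 * pi * real d * t))) summable_on UNIV"
    by (rule norm_summable_imp_summable_on)
  hence "(\<lambda>d. chi d * of_real (exp (- 2 * pi * real d * t))) summable_on {0<..}"
    by (rule summable_on_subset_banach) auto
  thus "((\<lambda>d. chi d * of_real (exp (- 2 * pi * real d * t))) has_sum char_exp_series chi t) {0<..}"
    unfolding char_exp_series_def by (rule has_sum_infsum)
qed

text \<open>By separability the Gauss sum times \<open>cnj (chi d)\<close> is a combination of
  \<open>d\<close>-th powers of roots of unity, so the exponential series splits into
  \<open>q\<close> geometric series with ratios \<open>w h\<close>. Their partial fractions regroup
  over all integers, and evenness joins \<open>k\<close> with \<open>- k\<close> into one real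
  quadratic.\<close>

lemma char_exp_series_conj_partial_fractions:
  assumes t: "t > 0"
  shows "((\<lambda>n. chi n / of_real (real n ^ 2 + (real q * t) ^ 2)) has_sum
           (of_real pi * gauss_sum q chi / of_real (real q ^ 2 * t) * char_exp_series (conj_char chi) t)) {0<..}"
proof -
  interpret c: even_primitive_char q "conj_char chi" by (rule conj)
  define z where "z = (\<lambda>h::nat. of_nat h / of_nat q + \<i> * of_real t)"
  define w where "w = (\<lambda>h. exp (2 * of_real pi * \<i> * z h))"
  define F where "F = char_exp_series (conj_char chi) t"
  define y where "y = real q * t"
  have y: "y > 0" using t q_pos by (simp add: y_def)
  have zZ: "z h \<notin> \<int>" for h
  proof
    assume "z h \<in> \<int>"
    hence "Im (z h) = 0" by (auto simp: Ints_def)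
    thus False using t by (simp add: z_def)
  qed
  have weq: "w h = root_of_unity_power q h * of_real (exp (- 2 * pi * t))" for h
  proof -
    have "2 * of_real pi * \<i> * z h = 2 * of_real pi * \<i> * of_nat h / of_nat q + of_real (- 2 * pi * t)"
      by (simp add: z_def algebra_simps)
    thus ?thesis unfolding w_def root_of_unity_power_def exp_of_real [symmetric] exp_add [symmetric] by (simp only:)
  qed
  have nw: "norm (w h) < 1" for h
    using t by (simp add: weq norm_mult root_of_unity_power_def)
  have wpow: "w h ^ d = root_of_unity_power q (h * d) * of_real (exp (- 2 * pi * real d * t))" for h d
    unfolding weq power_mult_distrib root_of_unity_power_mult
    by (simp add: mult_ac flip: exp_of_nat_mult of_real_power)
  have "(\<lambda>d. conj_char chi (Suc d) * of_real (exp (- 2 * pi * real (Suc d) * t))) sums F"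
    unfolding F_def by (rule has_sum_pos_imp_sums_Suc[OF c.char_exp_series_has_sum(1)[OF t]])
  hence 1: "(\<lambda>d. gauss_sum q chi * (conj_char chi (Suc d) * of_real (exp (- 2 * pi * real (Suc d) * t)))) sums (gauss_sum q chi * F)"
    by (rule sums_mult)
  have "(\<lambda>d. \<Sum>h<q. chi h * (w h * w h ^ d)) sums (\<Sum>h<q. chi h * (w h * (1 / (1 - w h))))"
    by (intro sums_sum sums_mult geometric_sums nw)
  moreover have "(\<Sum>h<q. chi h * (w h * w h ^ d)) = gauss_sum q chi * (conj_char chi (Suc d) * of_real (exp (- 2 * pi * real (Suc d) * t)))" for d
  proof -
    have "(\<Sum>h<q. chi h * (w h * w h ^ d)) = (\<Sum>h<q. chi h * w h ^ Suc d)" by simp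
    also have "\<dots> = (\<Sum>h<q. chi h * root_of_unity_power q (h * Suc d)) * of_real (exp (- 2 * pi * real (Suc d) * t))"
      unfolding wpow sum_distrib_right by (simp only: mult.assoc)
    finally show ?thesis unfolding gauss_sum_separable conj_char_def by (simp only: mult_ac)
  qed
  ultimately have "(\<lambda>d. gauss_sum q chi * (conj_char chi (Suc d) * of_real (exp (- 2 * pi * real (Suc d) * t)))) sums (\<Sum>h<q. chi h * (w h * (1 / (1 - w h))))"
    by simp
  with 1 have Feq: "gauss_sum q chi * F = (\<Sum>h<q. chi h * (w h / (1 - w h)))"
    using sums_unique2 by fastforce
  have "(\<lambda>M. \<Sum>h<q. chi h * (\<Sum>n<M. 1 / (z h + of_nat n) + 1 / (z h - of_nat (Suc n)))) \<longlonglongrightarrow>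
      (\<Sum>h<q. chi h * (- (2 * of_real pi * \<i>) * (w h / (1 - w h) + 1 / 2)))"
    unfolding w_def by (intro tendsto_intros geometric_partial_fractions_LIMSEQ zZ)
  \<comment> \<open>The constant \<open>1 / 2\<close> from the cotangent drops out because the
    values of \<open>chi\<close> sum to \<open>0\<close>.\<close>
  also have "(\<Sum>h<q. chi h * (- (2 * of_real pi * \<i>) * (w h / (1 - w h) + 1 / 2))) = - (2 * of_real pi * \<i>) * (gauss_sum q chi * F)"
  proof -
    have "(\<Sum>h<q. chi h * (- (2 * of_real pi * \<i>) * (w h / (1 - w h) + 1 / 2))) =
       - (2 * of_real pi * \<i>) * ((\<Sum>h<q. chi h * (w h / (1 - w h))) + 1 / 2 * (\<Sum>h<q. chi h))"
      unfolding sum_distrib_left sum.distrib [symmetric] by (intro sum.cong refl) (simp only: ring_distribs mult_ac)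
    thus ?thesis by (simp only: Feq sum_chi_eq_0 mult_zero_right add_0_right)
  qed
  also have "(\<lambda>M. \<Sum>h<q. chi h * (\<Sum>n<M. 1 / (z h + of_nat n) + 1 / (z h - of_nat (Suc n)))) =
     (\<lambda>M. - 2 * \<i> * of_real (real q * y) * (\<Sum>k<M * q. chi k / of_real (real k ^ 2 + y ^ 2)))"
  proof
    fix M
    define g1 where "g1 = (\<lambda>k. chi k * (of_nat q / (of_nat k + \<i> * of_real y)))"
    define g2 where "g2 = (\<lambda>k. chi k * (of_nat q / (\<i> * of_real y - of_nat k)))"
    have q0: "of_nat q \<noteq> (0::complex)" using q_pos by simp
    have p1: "chi h * (1 / (z h + of_nat n)) = g1 (n * q + h)" for h n
    proof -
      have "z h + of_nat n = (of_nat (n * q + h) + \<i> * of_real y) / of_nat q"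
        using q0 by (simp add: z_def y_def field_simps)
      moreover have "chi (n * q + h) = chi h" by (rule chi_cong) (simp add: cong_def)
      ultimately show ?thesis by (simp only: g1_def divide_divide_eq_right mult_1)
    qed
    \<comment> \<open>Here the integer is \<open>- (n * q + (q - h))\<close>. Reflecting
      \<open>h\<close> to \<open>q - h\<close> aligns it with the index of \<open>p1\<close>; the
      residue \<open>0\<close> contributes nothing on either side.\<close>
    have p2: "(\<Sum>h<q. chi h * (1 / (z h - of_nat (Suc n)))) = (\<Sum>h<q. g2 (n * q + h))" for n
    proof -
      have split: "{..<q} = insert 0 {1..<q}" using q_gt_1 by auto
      have "chi (n * q) = chi 0" by (rule chi_cong) (simp add: cong_def)
      hence 0: "g2 (n * q) = 0" by (simp add: g2_def)
      have "(\<Sum>h<q. chi h * (1 / (z h - of_nat (Suc n)))) = (\<Sum>h\<in>{1..<q}. chi h * (1 / (z h - of_nat (Suc n))))"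
        unfolding split by simp
      also have "\<dots> = (\<Sum>h\<in>{1..<q}. g2 (n * q + h))"
      proof (rule sum.reindex_bij_witness[of _ "\<lambda>h. q - h" "\<lambda>h. q - h"])
        fix h assume h: "h \<in> {1..<q}"
        have "z h - of_nat (Suc n) = (\<i> * of_real y - of_nat (n * q + (q - h))) / of_nat q"
          using q0 h by (simp add: z_def y_def field_simps of_nat_diff)
        moreover have "chi (n * q + (q - h)) = chi (q - h)" by (rule chi_cong) (simp add: cong_def)
        ultimately show "g2 (n * q + (q - h)) = chi h * (1 / (z h - of_nat (Suc n)))"
          using h by (simp only: g2_def divide_divide_eq_right mult_1 chi_reflect atLeastLessThan_iff less_imp_le)
      qed auto
      finally show ?thesis unfolding split using 0 by simp
    qed
    have "(\<Sum>h<q. chi h * (\<Sum>n<M. 1 / (z h + of_nat n) + 1 / (z h - of_nat (Suc n)))) =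
      (\<Sum>n<M. (\<Sum>h<q. chi h * (1 / (z h + of_nat n))) + (\<Sum>h<q. chi h * (1 / (z h - of_nat (Suc n)))))"
      unfolding sum_distrib_left by (subst sum.swap) (simp only: ring_distribs sum.distrib)
    also have "\<dots> = (\<Sum>n<M. \<Sum>h<q. g1 (n * q + h) + g2 (n * q + h))"
      unfolding p1 p2 sum.distrib ..
    also have "\<dots> = (\<Sum>n<M. \<Sum>k\<in>{n * q..<n * q + q}. g1 k + g2 k)"
    proof (rule sum.cong[OF refl])
      fix n
      show "(\<Sum>h<q. g1 (n * q + h) + g2 (n * q + h)) = (\<Sum>k\<in>{n * q..<n * q + q}. g1 k + g2 k)"
        using sum.shift_bounds_nat_ivl[of "\<lambda>k. g1 k + g2 k" 0 "n * q" q] by (simp add: lessThan_atLeast0 add.commute)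
    qed
    also have "\<dots> = (\<Sum>k<M * q. g1 k + g2 k)" by (rule sum.nat_group)
    also have "\<dots> = (\<Sum>k<M * q. - 2 * \<i> * of_real (real q * y) * (chi k / of_real (real k ^ 2 + y ^ 2)))"
    proof (rule sum.cong[OF refl])
      fix k
      have nz: "of_nat k + \<i> * of_real y \<noteq> 0" "\<i> * of_real y - of_nat k \<noteq> 0"
        using y by (auto simp: complex_eq_iff)
      have pr: "(of_nat k + \<i> * of_real y) * (\<i> * of_real y - of_nat k) = - of_real (real k ^ 2 + y ^ 2)"
        by (simp add: algebra_simps power2_eq_square)
      have "g1 k + g2 k = chi k * of_nat q * (2 * \<i> * of_real y) / ((of_nat k + \<i> * of_real y) * (\<i> * of_real y - of_nat k))"
        unfolding g1_def g2_def using nz by (simp add: divide_simps) (simp add: algebra_simps)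
      also have "\<dots> = - 2 * \<i> * of_real (real q * y) * (chi k / of_real (real k ^ 2 + y ^ 2))"
        unfolding pr divide_minus_right by (simp add: mult_ac)
      finally show "g1 k + g2 k = - 2 * \<i> * of_real (real q * y) * (chi k / of_real (real k ^ 2 + y ^ 2))" .
    qed
    finally show "(\<Sum>h<q. chi h * (\<Sum>n<M. 1 / (z h + of_nat n) + 1 / (z h - of_nat (Suc n)))) =
     - 2 * \<i> * of_real (real q * y) * (\<Sum>k<M * q. chi k / of_real (real k ^ 2 + y ^ 2))"
      by (simp only: sum_distrib_left)
  qed
  finally have lim1: "(\<lambda>M. - 2 * \<i> * of_real (real q * y) * (\<Sum>k<M * q. chi k / of_real (real k ^ 2 + y ^ 2))) \<longlonglongrightarrow> - (2 * of_real pi * \<i>) * (gauss_sum q chi * F)" .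
  have sm: "summable (\<lambda>k. norm (chi k / of_real (real k ^ 2 + y ^ 2)))"
  proof (rule summable_comparison_test)
    show "summable (\<lambda>k. 1 / real k ^ 2)" using inverse_power_summable[of 2, where 'a = real] by (simp add: divide_inverse)
    have "norm (chi k / of_real (real k ^ 2 + y ^ 2)) \<le> 1 / real k ^ 2" if "k \<ge> 1" for k
    proof -
      have "norm (chi k / of_real (real k ^ 2 + y ^ 2)) = norm (chi k) / (real k ^ 2 + y ^ 2)"
        by (simp only: norm_divide norm_of_real) simp
      also have "\<dots> \<le> 1 / real k ^ 2" using that norm_chi_le[of k] y by (intro frac_le) auto
      finally show ?thesis .
    qed
    thus "\<exists>N. \<forall>n\<ge>N. norm (norm (chi n / of_real (real n ^ 2 + y ^ 2))) \<le> 1 / real n ^ 2" by auto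
  qed
  define S where "S = (\<Sum>k. chi k / of_real (real k ^ 2 + y ^ 2))"
  have S: "(\<lambda>k. chi k / of_real (real k ^ 2 + y ^ 2)) sums S"
    unfolding S_def by (rule summable_sums[OF summable_norm_cancel[OF sm]])
  \<comment> \<open>The limit above is known only along multiples of \<open>q\<close>; the
    absolutely convergent full series has the same limit along them.\<close>
  have "strict_mono (\<lambda>M. M * q)" using q_pos by (auto simp: strict_mono_def)
  from LIMSEQ_subseq_LIMSEQ[OF S[unfolded sums_def] this]
  have "(\<lambda>M. \<Sum>k<M * q. chi k / of_real (real k ^ 2 + y ^ 2)) \<longlonglongrightarrow> S" by (simp add: o_def)
  from LIMSEQ_unique[OF tendsto_mult_left[OF this] lim1]
  have "- 2 * \<i> * of_real (real q * y) * S = - (2 * of_real pi * \<i>) * (gauss_sum q chi * F)" .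
  hence "S = of_real pi * gauss_sum q chi / of_real (real q ^ 2 * t) * F"
    using y t q_pos by (simp add: y_def field_simps power2_eq_square)
  with sums_imp_has_sum_pos[OF S sm] show ?thesis by (simp add: F_def y_def)
qed

end

section \<open>Continuation and functional equation of the L-function\<close>

lemma conj_char_conj_char [simp]: "conj_char (conj_char chi) = chi"
  by (simp add: conj_char_def fun_eq_iff)

definition char_mellin :: "(nat \<Rightarrow> complex) \<Rightarrow> complex \<Rightarrow> complex" where
  "char_mellin chi s = (LINT v|lborel. exp (s * of_real v) * char_exp_series chi (exp v))"

lemma has_sum_cong_imp:
  assumes "(f has_sum S) A" "\<And>x. x \<in> A \<Longrightarrow> f x = g x"
  shows "(g has_sum S) A"
  using assms has_sum_cong[of A f g S] by blast

lemma of_real_divide_powr: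
  fixes a b :: real
  assumes "a > 0" "b > 0"
  shows "complex_of_real (a / b) powr s = of_real a powr s / of_real b powr s"
proof -
  have "a / b > 0" using assms by simp
  thus ?thesis
    using assms by (simp add: of_real_powr_eq_exp ln_div right_diff_distrib exp_diff del: of_real_divide)
qed

lemma norm_of_nat_powr: "n > 0 \<Longrightarrow> norm (of_nat n powr s :: complex) = real n powr Re s"
  using norm_powr_real_powr[of "of_nat n" s] by simp

lemma norm_summable_on_if_le_powr:
  fixes f :: "nat \<Rightarrow> complex"
  assumes "p > 1" "\<And>n. n > 0 \<Longrightarrow> norm (f n) \<le> C * real n powr (- p)"
  shows "(\<lambda>n. norm (f n)) summable_on {0<..}"
proof (rule summable_on_comparison_test)
  show "(\<lambda>n. C * real n powr (- p)) summable_on {0<..}"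
    by (intro summable_on_cmult_right summable_inverse_powr_pos assms)
qed (use assms in auto)

text \<open>The interpolation behind the domination arguments: it trades decay in one variable for decay in the other.\<close>
lemma powr_mult_powr_le_sum_squares:
  fixes X Y d :: real
  assumes "X > 0" "Y > 0" "0 \<le> d" "d \<le> 1"
  shows "X powr (1 + d) * Y powr (1 - d) \<le> X ^ 2 + Y ^ 2"
proof -
  define m where "m = max X Y"
  have m: "m > 0" "X \<le> m" "Y \<le> m" using assms by (auto simp: m_def)
  have "X powr (1 + d) * Y powr (1 - d) \<le> m powr (1 + d) * m powr (1 - d)"
    using assms m by (intro mult_mono powr_mono2) auto
  also have "\<dots> = m powr 2" using m by (simp flip: powr_add)
  also have "\<dots> = m ^ 2" using m by (simp add: powr_numeral)
  also have "\<dots> \<le> X ^ 2 + Y ^ 2" by (auto simp: m_def max_def)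
  finally show ?thesis .
qed

context even_primitive_char
begin

section \<open>Two termwise evaluations of the Mellin transform\<close>

lemma dirichlet_series_abs_summable:
  assumes "Re s > 1"
  shows "(\<lambda>n. norm (chi n / of_nat n powr s)) summable_on {0<..}"
proof (rule norm_summable_on_if_le_powr[OF assms, of _ 1])
  fix n :: nat assume "n > 0"
  thus "norm (chi n / of_nat n powr s) \<le> 1 * real n powr (- Re s)"
    using norm_chi_le[of n] by (simp add: norm_divide norm_of_nat_powr powr_minus divide_simps)
qed

lemma dirichlet_series_has_sum:
  assumes "Re s > 1"
  shows "((\<lambda>n. chi n / of_nat n powr s) has_sum (\<Sum>n. chi (Suc n) / of_nat (Suc n) powr s)) {0<..}"
proof -
  have "((\<lambda>n. chi n / of_nat n powr s) has_sum (\<Sum>\<^sub>\<infinity>n\<in>{0<..}. chi n / of_nat n powr s)) {0<..}"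
    using abs_summable_summable[OF dirichlet_series_abs_summable[OF assms]] by (rule has_sum_infsum)
  moreover from has_sum_pos_imp_sums_Suc[OF this]
  have "(\<Sum>\<^sub>\<infinity>n\<in>{0<..}. chi n / of_nat n powr s) = (\<Sum>n. chi (Suc n) / of_nat (Suc n) powr s)"
    by (simp add: sums_iff)
  ultimately show ?thesis by simp
qed

lemma char_exp_series_measurable [measurable]:
  "(\<lambda>v. char_exp_series chi (exp v)) \<in> borel_measurable borel"
proof -
  have "char_exp_series chi (exp v) = (\<Sum>d. chi (Suc d) * of_real (exp (- 2 * pi * real (Suc d) * exp v)))" for v
    using has_sum_pos_imp_sums_Suc[OF char_exp_series_has_sum(1)[of "exp v"]] by (simp add: sums_iff)
  thus ?thesis by simp
qed

text \<open>The linear bound for small \<open>t\<close> comes from the partial fractions and fixes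
  the left edge \<open>-1\<close> of the Mellin strip. Decay of order \<open>p\<close> comes from
  the exponentials; \<open>p > 1\<close> makes the sum over \<open>n\<close> converge.\<close>

lemma char_exp_series_conj_bound:
  assumes p: "p > 1"
  shows "\<exists>C. \<forall>v. norm (char_exp_series (conj_char chi) (exp v)) \<le> C * exp (- (- 1) * v) \<and>
    norm (char_exp_series (conj_char chi) (exp v)) \<le> C * exp (- p * v)"
proof -
  interpret c: even_primitive_char q "conj_char chi" by (rule conj)
  define F where "F = char_exp_series (conj_char chi)"
  define tau where "tau = gauss_sum q chi"
  define Z where "Z = (\<lambda>p. \<Sum>\<^sub>\<infinity>n\<in>{0<..}. real n powr (- p))"
  have Z: "((\<lambda>n. real n powr (- p)) has_sum Z p) {0<..}" if "p > 1" for p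
    unfolding Z_def by (intro has_sum_infsum summable_inverse_powr_pos that)
  have tau: "tau \<noteq> 0" unfolding tau_def by (rule gauss_sum_nonzero)
  define C1 where "C1 = Z 2 * real q ^ 2 / (pi * norm tau)"
  define C2 where "C2 = p powr p * (2 * pi) powr (- p) * Z p"
  have 1: "norm (F t) \<le> C1 * t" if t: "t > 0" for t
  proof -
    have "norm (of_real pi * tau / of_real (real q ^ 2 * t) * F t) \<le> Z 2"
      unfolding tau_def F_def
    proof (rule norm_infsum_le[OF char_exp_series_conj_partial_fractions[OF t] Z])
      fix n :: nat assume n: "n \<in> {0<..}"
      have "norm (chi n / of_real (real n ^ 2 + (real q * t) ^ 2)) = norm (chi n) / (real n ^ 2 + (real q * t) ^ 2)"
        by (simp only: norm_divide norm_of_real) simp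
      also have "\<dots> \<le> 1 / real n ^ 2" using n norm_chi_le[of n] by (intro frac_le) auto
      also have "\<dots> = real n powr (- 2)" using n by (simp add: powr_minus powr_numeral divide_inverse)
      finally show "norm (chi n / of_real (real n ^ 2 + (real q * t) ^ 2)) \<le> real n powr (- 2)" .
    qed auto
    also have "norm (of_real pi * tau / of_real (real q ^ 2 * t) * F t) = pi * norm tau / (real q ^ 2 * t) * norm (F t)"
      using t by (simp add: norm_mult norm_divide norm_power)
    finally show ?thesis using t tau q_pos by (simp add: C1_def field_simps)
  qed
  have 2: "norm (F t) \<le> C2 * t powr (- p)" if t: "t > 0" for t
    unfolding F_def
  proof (rule norm_infsum_le[OF c.char_exp_series_has_sum(1)[OF t]])
    have "((\<lambda>n. p powr p * (2 * pi) powr (- p) * t powr (- p) * (real n powr (- p))) has_sum (p powr p * (2 * pi) powr (- p) * t powr (- p) * Z p)) {0<..}"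
      by (intro has_sum_cmult_right Z p)
    thus "((\<lambda>n. p powr p * (2 * pi) powr (- p) * t powr (- p) * (real n powr (- p))) has_sum (C2 * t powr (- p))) {0<..}"
      by (simp add: C2_def mult_ac)
    fix n :: nat assume n: "n \<in> {0<..}"
    have "norm (conj_char chi n * of_real (exp (- 2 * pi * real n * t))) \<le> exp (- (2 * pi * real n * t))"
      using c.norm_chi_le[of n] by (simp add: norm_mult mult_left_le_one_le)
    also have "\<dots> \<le> p powr p * (2 * pi * real n * t) powr (- p)"
      using n t p by (intro exp_minus_le_powr) auto
    also have "\<dots> = p powr p * (2 * pi) powr (- p) * t powr (- p) * (real n powr (- p))"
      using t by (simp add: powr_mult)
    finally show "norm (conj_char chi n * of_real (exp (- 2 * pi * real n * t))) \<le> p powr p * (2 * pi) powr (- p) * t powr (- p) * (real n powr (- p))" .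
  qed
  show ?thesis
  proof (intro exI[of _ "max C1 C2"] allI conjI)
    fix v
    have "norm (F (exp v)) \<le> C1 * exp v" by (rule 1) simp
    also have "\<dots> \<le> max C1 C2 * exp v" by (intro mult_right_mono) auto
    finally show "norm (char_exp_series (conj_char chi) (exp v)) \<le> max C1 C2 * exp (- (- 1) * v)" by (simp add: F_def)
    have "norm (F (exp v)) \<le> C2 * exp v powr (- p)" by (rule 2) simp
    also have "\<dots> \<le> max C1 C2 * exp v powr (- p)" by (intro mult_right_mono) auto
    finally show "norm (char_exp_series (conj_char chi) (exp v)) \<le> max C1 C2 * exp (- p * v)"
      by (simp add: F_def exp_powr_real mult.commute)
  qed
qed

lemma char_mellin_conj_integrable:
  assumes "Re s > -1"
  shows "integrable lborel (\<lambda>v. exp (s * of_real v) * char_exp_series (conj_char chi) (exp v))"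
proof -
  interpret c: even_primitive_char q "conj_char chi" by (rule conj)
  have "\<bar>Re s\<bar> + 2 > 1" by simp
  then obtain C where C: "\<And>v. norm (char_exp_series (conj_char chi) (exp v)) \<le> C * exp (- (- 1) * v)"
    "\<And>v. norm (char_exp_series (conj_char chi) (exp v)) \<le> C * exp (- (\<bar>Re s\<bar> + 2) * v)"
    using char_exp_series_conj_bound by blast
  show ?thesis
    by (rule integrable_bilateral_laplace[OF _ C]) (use assms in auto)
qed

lemma char_mellin_conj_holomorphic: "char_mellin (conj_char chi) holomorphic_on {s. Re s > -1}"
proof -
  interpret c: even_primitive_char q "conj_char chi" by (rule conj)
  have "char_mellin (conj_char chi) field_differentiable at s" if s: "Re s > -1" for s
  proof -
    \<comment> \<open>A right edge beyond \<open>Re s\<close>. Since the constant \<open>C\<close>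
      depends on it, holomorphy is proved point by point.\<close>
    define p where "p = \<bar>Re s\<bar> + 2"
    have "p > 1" by (simp add: p_def)
    then obtain C where C: "\<And>v. norm (char_exp_series (conj_char chi) (exp v)) \<le> C * exp (- (- 1) * v)"
      "\<And>v. norm (char_exp_series (conj_char chi) (exp v)) \<le> C * exp (- p * v)"
      using char_exp_series_conj_bound by blast
    have "char_mellin (conj_char chi) holomorphic_on {s. -1 < Re s \<and> Re s < p}"
      unfolding char_mellin_def[abs_def] by (rule holomorphic_bilateral_laplace[OF _ C]) simp
    moreover have "open {s. -1 < Re s \<and> Re s < p}"
      by (simp add: Collect_conj_eq open_Int open_halfspace_Re_gt open_halfspace_Re_lt)
    ultimately show ?thesis using s by (intro holomorphic_on_imp_differentiable_at) (auto simp: p_def)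
  qed
  thus ?thesis unfolding holomorphic_on_def by (simp add: field_differentiable_at_within)
qed

lemma char_mellin_conj_series:
  assumes s: "Re s > 1"
  shows "((\<lambda>d. conj_char chi d / of_nat d powr s * (of_real (2 * pi) powr (- s) * Gamma s)) has_sum char_mellin (conj_char chi) s) {0<..}"
proof -
  interpret c: even_primitive_char q "conj_char chi" by (rule conj)
  \<comment> \<open>Two orders of decay are used: \<open>p\<close> in \<open>(1, Re s)\<close> keeps
    the weights summable and leaves growth rate \<open>Re s - p > 0\<close>;
    \<open>K = Re s + 1\<close> leaves the rate \<open>-1\<close> for large
    \<open>v\<close>.\<close>
  define p where "p = (1 + Re s) / 2"
  have p: "1 < p" "p < Re s" using s by (auto simp: p_def)
  define K where "K = Re s + 1"
  have K: "K > 0" "K > p" using s p by (auto simp: K_def)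
  define f where "f = (\<lambda>d v. exp (s * of_real v) * (conj_char chi d * of_real (exp (- 2 * pi * real d * exp v))))"
  define C where "C = max (p powr p * (2 * pi) powr (- p)) (K powr K * (2 * pi) powr (- K))"
  have bd: "norm (f d v) \<le> r powr r * (2 * pi) powr (- r) * real d powr (- r) * exp ((Re s - r) * v)" if d: "d > 0" and r: "r > 0" for d v r
  proof -
    have "norm (f d v) = exp (Re s * v) * (norm (conj_char chi d) * exp (- (2 * pi * real d * exp v)))"
      by (simp add: f_def norm_mult)
    also have "\<dots> \<le> exp (Re s * v) * (1 * (r powr r * (2 * pi * real d * exp v) powr (- r)))"
      using d r by (intro mult_mono c.norm_chi_le exp_minus_le_powr) auto
    also have "\<dots> = r powr r * (2 * pi) powr (- r) * real d powr (- r) * exp ((Re s - r) * v)"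
      by (simp add: powr_mult exp_powr_real algebra_simps exp_diff exp_minus divide_inverse)
    finally show ?thesis .
  qed
  have "((\<lambda>d. LINT v|lborel. f d v) has_sum (LINT v|lborel. exp (s * of_real v) * char_exp_series (conj_char chi) (exp v))) {0<..}"
  proof (rule has_sum_integral_two_sided_bound(2)[of _ _ "Re s - p" 1 "\<lambda>d. real d powr (- p)" C])
    show "infinite {0::nat<..}" by (rule infinite_Ioi)
    show "(\<lambda>d. real d powr (- p)) summable_on {0<..}" by (rule summable_inverse_powr_pos) fact
    show "f d \<in> borel_measurable borel" for d unfolding f_def by measurable
    show "((\<lambda>d. f d v) has_sum exp (s * of_real v) * char_exp_series (conj_char chi) (exp v)) {0<..}" for v
      unfolding f_def by (intro has_sum_cmult_right c.char_exp_series_has_sum(1)) simp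
    fix d :: nat and v :: real assume d: "d \<in> {0<..}"
    have "norm (f d v) \<le> p powr p * (2 * pi) powr (- p) * real d powr (- p) * exp ((Re s - p) * v)"
      using d p by (intro bd) auto
    also have "\<dots> \<le> C * real d powr (- p) * exp ((Re s - p) * v)"
      by (intro mult_right_mono) (auto simp: C_def)
    finally show "norm (f d v) \<le> C * real d powr (- p) * exp ((Re s - p) * v)" .
    have "norm (f d v) \<le> K powr K * (2 * pi) powr (- K) * real d powr (- K) * exp ((Re s - K) * v)"
      using d K by (intro bd) auto
    also have "\<dots> \<le> C * real d powr (- p) * exp (- 1 * v)"
      using d K p by (intro mult_mono powr_mono) (auto simp: C_def K_def le_max_iff_disj)
    finally show "norm (f d v) \<le> C * real d powr (- p) * exp (- 1 * v)" .
  qed (use p in auto)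
  moreover have "(LINT v|lborel. f d v) = conj_char chi d / of_nat d powr s * (of_real (2 * pi) powr (- s) * Gamma s)" if "d \<in> {0<..}" for d
  proof -
    have "(LINT v|lborel. f d v) = (LINT v|lborel. conj_char chi d * (exp (s * of_real v) * of_real (exp (- (2 * pi * real d) * exp v))))"
      by (simp add: f_def mult_ac)
    also have "\<dots> = conj_char chi d * (of_real (2 * pi * real d) powr (- s) * Gamma s)"
      unfolding integral_mult_right_zero using that s by (subst Gamma_integral_exp_scaled(2)) auto
    also have "complex_of_real (2 * pi * real d) powr (- s) = of_real (2 * pi) powr (- s) * of_nat d powr (- s)"
      using that powr_times_real[of "of_real (2 * pi)" "of_nat d" "- s"] by simp
    finally show ?thesis by (simp add: powr_minus divide_inverse mult_ac)
  qed
  ultimately show ?thesis unfolding char_mellin_def by (rule has_sum_cong_imp)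
qed

text \<open>On this strip the partial fractions can be integrated termwise: each term is a
  reciprocal quadratic with \<open>A = n / q\<close> and exponent \<open>s + 1\<close>, which gives
  a Dirichlet series at \<open>1 - s\<close>. This is the functional equation before any
  continuation.\<close>

lemma char_mellin_conj_reflected_series:
  assumes s: "- 1 < Re s" "Re s < 0"
  shows "((\<lambda>n. chi n / of_nat n powr (1 - s) * (of_nat q powr (1 - s) / (2 * gauss_sum q chi * cos (of_real pi * s / 2)))) has_sum
            char_mellin (conj_char chi) s) {0<..}"
proof -
  interpret c: even_primitive_char q "conj_char chi" by (rule conj)
  define tau where "tau = gauss_sum q chi"
  have tau: "tau \<noteq> 0" unfolding tau_def by (rule gauss_sum_nonzero)
  \<comment> \<open>Since \<open>Re s = - 2 * d\<close>, spending \<open>d\<close> on the summation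
    index leaves the rate \<open>Re s + 1 - (1 - d) = - d\<close> for large
    \<open>v\<close>.\<close>
  define d where "d = - Re s / 2"
  have d: "0 < d" "d \<le> 1" using s by (auto simp: d_def)
  define f where "f = (\<lambda>n v. exp (s * of_real v) * (of_real (real q ^ 2 * exp v) / (of_real pi * tau) * (chi n / of_real (real n ^ 2 + (real q * exp v) ^ 2))))"
  define C where "C = real q ^ 2 / (pi * norm tau)"
  have C: "C \<ge> 0" by (simp add: C_def)
  have q1: "real q \<ge> 1" using q_pos by simp
  have nf: "norm (f n v) \<le> C * exp ((Re s + 1) * v) / D" if "0 < D" "D \<le> real n ^ 2 + (real q * exp v) ^ 2" for n v D
  proof -
    have "norm (f n v) = exp (Re s * v) * (real q ^ 2 * exp v / (pi * norm tau) * (norm (chi n) / (real n ^ 2 + (real q * exp v) ^ 2)))"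
      unfolding f_def norm_mult norm_divide norm_of_real norm_exp_eq_Re by simp
    also have "\<dots> \<le> exp (Re s * v) * (real q ^ 2 * exp v / (pi * norm tau) * (1 / D))"
      using that norm_chi_le[of n] by (intro mult_left_mono frac_le) auto
    also have "\<dots> = C * exp ((Re s + 1) * v) / D" by (simp add: C_def algebra_simps exp_add)
    finally show ?thesis .
  qed
  have "((\<lambda>n. LINT v|lborel. f n v) has_sum (LINT v|lborel. exp (s * of_real v) * char_exp_series (conj_char chi) (exp v))) {0<..}"
  proof (rule has_sum_integral_two_sided_bound(2)[of _ _ "Re s + 1" d "\<lambda>n. real n powr (- (1 + d))" C])
    show "infinite {0::nat<..}" by (rule infinite_Ioi)
    show "(\<lambda>n. real n powr (- (1 + d))) summable_on {0<..}" by (rule summable_inverse_powr_pos) (use d in auto)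
    show "f n \<in> borel_measurable borel" for n unfolding f_def by measurable
    show "((\<lambda>n. f n v) has_sum exp (s * of_real v) * char_exp_series (conj_char chi) (exp v)) {0<..}" for v
    proof -
      have "((\<lambda>n. f n v) has_sum exp (s * of_real v) * (of_real (real q ^ 2 * exp v) / (of_real pi * tau) *
        (of_real pi * gauss_sum q chi / of_real (real q ^ 2 * exp v) * char_exp_series (conj_char chi) (exp v)))) {0<..}"
        unfolding f_def by (intro has_sum_cmult_right char_exp_series_conj_partial_fractions) simp
      thus ?thesis using tau q_pos by (simp add: tau_def)
    qed
    fix n :: nat and v :: real assume n: "n \<in> {0<..}"
    have n1: "real n \<ge> 1" using n by simp
    have "norm (f n v) \<le> C * exp ((Re s + 1) * v) / real n powr (1 + d)"
    proof (rule nf)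
      have "real n powr (1 + d) \<le> real n powr 2" using n1 d by (intro powr_mono) auto
      also have "\<dots> = real n ^ 2" using n1 by (simp add: powr_numeral)
      finally show "real n powr (1 + d) \<le> real n ^ 2 + (real q * exp v) ^ 2" by (simp add: add_increasing2)
    qed (use n in auto)
    thus "norm (f n v) \<le> C * real n powr (- (1 + d)) * exp ((Re s + 1) * v)"
      by (simp only: powr_minus divide_inverse mult_ac)
    have "norm (f n v) \<le> C * exp ((Re s + 1) * v) / (real n powr (1 + d) * exp v powr (1 - d))"
    proof (rule nf)
      have "real n powr (1 + d) * exp v powr (1 - d) \<le> real n powr (1 + d) * (real q * exp v) powr (1 - d)"
        using d q1 by (intro mult_left_mono powr_mono2) auto
      also have "\<dots> \<le> real n ^ 2 + (real q * exp v) ^ 2"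
        using d n1 q1 by (intro powr_mult_powr_le_sum_squares) auto
      finally show "real n powr (1 + d) * exp v powr (1 - d) \<le> real n ^ 2 + (real q * exp v) ^ 2" .
    qed (use n in auto)
    also have "\<dots> = C * real n powr (- (1 + d)) * (exp ((Re s + 1) * v) * exp (- ((1 - d) * v)))"
      by (simp only: powr_minus divide_inverse exp_powr_real inverse_mult_distrib mult_ac exp_minus)
    also have "exp ((Re s + 1) * v) * exp (- ((1 - d) * v)) = exp (- d * v)"
      unfolding exp_add [symmetric] by (simp add: d_def algebra_simps)
    finally show "norm (f n v) \<le> C * real n powr (- (1 + d)) * exp (- d * v)" .
  qed (use s d in auto)
  moreover have "(LINT v|lborel. f n v) = chi n / of_nat n powr (1 - s) * (of_nat q powr (1 - s) / (2 * gauss_sum q chi * cos (of_real pi * s / 2)))" if n: "n \<in> {0<..}" for n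
  proof -
    define A where "A = real n / real q"
    have A: "A > 0" using n q_pos by (simp add: A_def)
    have fe: "f n v = chi n / (of_real pi * tau) * (exp ((s + 1) * of_real v) / (of_real A ^ 2 + of_real (exp (2 * v))))" for v
    proof -
      have "real n ^ 2 + (real q * exp v) ^ 2 = real q ^ 2 * (A ^ 2 + exp (2 * v))"
        using q_pos by (simp only: A_def exp_double) (simp add: field_simps)
      hence "f n v = exp (s * of_real v) * (of_real (real q ^ 2 * exp v) / (of_real pi * tau) * (chi n / of_real (real q ^ 2 * (A ^ 2 + exp (2 * v)))))"
        by (simp only: f_def)
      also have "\<dots> = chi n / (of_real pi * tau) * (exp (s * of_real v) * of_real (exp v) / (of_real (A ^ 2 + exp (2 * v))))"
      proof -
        have alg: "E * (Q * e / P * (c / (Q * D))) = c / P * (E * e / D)" if "Q \<noteq> 0" for E e Q P c D :: complex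
          using that by simp
        show ?thesis unfolding of_real_mult by (rule alg) (use q_pos in simp)
      qed
      also have "exp (s * of_real v) * complex_of_real (exp v) = exp ((s + 1) * of_real v)"
        by (simp add: ring_distribs exp_add exp_of_real)
      finally show ?thesis by simp
    qed
    have "(LINT v|lborel. f n v) = chi n / (of_real pi * tau) * (of_real A powr (s + 1 - 2) * (of_real pi / (2 * sin (of_real pi * (s + 1) / 2))))"
      unfolding fe integral_mult_right_zero using s A by (subst integral_exp_over_quadratic) auto
    also have "sin (of_real pi * (s + 1) / 2) = cos (of_real pi * s / 2)"
    proof -
      have h: "of_real pi * (s + 1) / 2 = of_real pi * s / 2 + of_real (pi / 2)" by (simp add: ring_distribs add_divide_distrib)
      show ?thesis unfolding h sin_add sin_of_real cos_of_real by simp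
    qed
    also have "complex_of_real A powr (s + 1 - 2) = of_nat q powr (1 - s) / of_nat n powr (1 - s)"
    proof -
      have "complex_of_real A powr (s + 1 - 2) = of_real A powr (- (1 - s))" by (simp add: algebra_simps)
      also have "\<dots> = of_nat q powr (1 - s) / of_nat n powr (1 - s)"
        using n q_pos unfolding A_def
        by (subst of_real_divide_powr) (simp_all only: powr_minus, simp_all add: divide_inverse mult.commute)
      finally show ?thesis .
    qed
    finally show ?thesis using tau by (simp add: tau_def mult_ac)
  qed
  ultimately show ?thesis unfolding char_mellin_def by (rule has_sum_cong_imp)
qed

end

section \<open>From the two series to the entire L-function\<close>

lemma cos_half_pi_nonzero:
  assumes "- 1 < Re s" "Re s < 1"
  shows "cos (of_real pi * s / 2) \<noteq> 0"
proof
  assume "cos (of_real pi * s / 2) = 0"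
  moreover have "of_real pi * ((s + 1) / 2) = of_real pi * s / 2 + of_real (pi / 2)"
    by (simp add: ring_distribs add_divide_distrib)
  ultimately have "sin (of_real pi * ((s + 1) / 2)) = 0"
    by (simp only: sin_add sin_of_real cos_of_real) simp
  hence "(s + 1) / 2 \<in> \<int>" by (simp only: sin_pi_times_eq_0_iff)
  then obtain n where "(s + 1) / 2 = of_int n" by (elim Ints_cases)
  hence "s = 2 * of_int n - 1" by (simp add: field_simps)
  hence "Re s = 2 * of_int n - 1" by simp
  hence "0 < n" "n < 1" using assms by auto
  thus False by linarith
qed

lemma rGamma_mult_Gamma: "(z::complex) \<notin> \<int>\<^sub>\<le>\<^sub>0 \<Longrightarrow> Gamma z * rGamma z = 1"
  by (simp add: rGamma_inverse_Gamma Gamma_eq_zero_iff)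

context even_primitive_char
begin

text \<open>\<open>rGamma\<close> is entire, so the right side has no poles and serves as the
  continuation to \<open>Re s > -1\<close>.\<close>

lemma dirichlet_series_conj_eq_mellin:
  assumes "Re s > 1"
  shows "(\<Sum>n. conj_char chi (Suc n) / of_nat (Suc n) powr s) =
    of_real (2 * pi) powr s * char_mellin (conj_char chi) s * rGamma s"
proof -
  interpret c: even_primitive_char q "conj_char chi" by (rule conj)
  have "char_mellin (conj_char chi) s = (\<Sum>n. conj_char chi (Suc n) / of_nat (Suc n) powr s) * (of_real (2 * pi) powr (- s) * Gamma s)"
    using has_sum_unique[OF char_mellin_conj_series[OF assms] has_sum_cmult_left[OF c.dirichlet_series_has_sum[OF assms]]] .
  moreover have "Gamma s * rGamma s = 1"
    using assms by (intro rGamma_mult_Gamma) (auto elim!: nonpos_Ints_cases)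
  ultimately show ?thesis by (simp add: powr_minus mult.assoc)
qed

lemma char_mellin_conj_reflection_strip:
  assumes "- 1 < Re s" "Re s < 0"
  shows "char_mellin (conj_char chi) s * (2 * gauss_sum q chi * cos (of_real pi * s / 2)) / of_nat q powr (1 - s) =
    (\<Sum>n. chi (Suc n) / of_nat (Suc n) powr (1 - s))"
proof -
  have "Re (1 - s) > 1" using assms by simp
  from has_sum_unique[OF char_mellin_conj_reflected_series[OF assms] has_sum_cmult_left[OF dirichlet_series_has_sum[OF this]]]
  have "char_mellin (conj_char chi) s = (\<Sum>n. chi (Suc n) / of_nat (Suc n) powr (1 - s)) *
    (of_nat q powr (1 - s) / (2 * gauss_sum q chi * cos (of_real pi * s / 2)))" .
  thus ?thesis using gauss_sum_nonzero cos_half_pi_nonzero[of s] assms q_pos by simp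
qed

text \<open>The Mellin transform covers \<open>Re s > -1\<close> and the reflected Dirichlet series covers \<open>Re s < 0\<close>; they
  agree on the overlap.\<close>
lemma dirichlet_L_conj_exists:
  "\<exists>f. f holomorphic_on UNIV \<and>
     (\<forall>s. 1 < Re s \<longrightarrow> f s = (\<Sum>n. conj_char chi (Suc n) / of_nat (Suc n) powr s)) \<and>
     (\<forall>s. -1 < Re s \<longrightarrow> f s = of_real (2 * pi) powr s * char_mellin (conj_char chi) s * rGamma s)"
proof -
  interpret c: even_primitive_char q "conj_char chi" by (rule conj)
  define tau where "tau = gauss_sum q chi"
  have tau: "tau \<noteq> 0" unfolding tau_def by (rule gauss_sum_nonzero)
  define L where "L = (\<lambda>s. \<Sum>n. chi (Suc n) / of_nat (Suc n) powr s)"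
  define f1 where "f1 = (\<lambda>s. of_real (2 * pi) powr s * char_mellin (conj_char chi) s * rGamma s)"
  \<comment> \<open>The functional equation solved for the value at \<open>s\<close>; its Dirichlet
    series converges because \<open>Re (1 - s) > 1\<close>.\<close>
  define f2 where "f2 = (\<lambda>s. of_real (2 * pi) powr s * of_nat q powr (1 - s) / (of_real pi * tau) * sin (of_real pi * s / 2) * Gamma (1 - s) * L (1 - s))"
  have hol1: "f1 holomorphic_on {s. Re s > -1}"
    unfolding f1_def using char_mellin_conj_holomorphic by (intro holomorphic_intros) auto
  \<comment> \<open>Holomorphy of the Dirichlet series of \<open>chi\<close> is inherited from the
    Mellin representation, applied to the conjugate character.\<close>
  have holL: "L holomorphic_on {s. Re s > 1}"
  proof -
    have "(\<lambda>s. of_real (2 * pi) powr s * char_mellin chi s * rGamma s) holomorphic_on {s. Re s > 1}"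
    proof -
      have "char_mellin chi holomorphic_on {s. Re s > 1}"
        using c.char_mellin_conj_holomorphic unfolding conj_char_conj_char by (rule holomorphic_on_subset) auto
      thus ?thesis by (intro holomorphic_intros) auto
    qed
    thus ?thesis
      by (rule holomorphic_transform) (use c.dirichlet_series_conj_eq_mellin in \<open>simp add: L_def\<close>)
  qed
  have hol2: "f2 holomorphic_on {s. Re s < 0}"
  proof -
    have "(\<lambda>s. L (1 - s)) holomorphic_on {s. Re s < 0}"
    proof -
      have "(L \<circ> (\<lambda>s. 1 - s)) holomorphic_on {s. Re s < 0}"
        by (rule holomorphic_on_compose_gen[OF _ holL]) (auto intro!: holomorphic_intros)
      thus ?thesis by (simp add: o_def)
    qed
    thus ?thesis
      unfolding f2_def using tau q_pos
      by (intro holomorphic_intros) (auto elim!: nonpos_Ints_cases simp: complex_eq_iff)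
  qed
  have agree: "f1 s = f2 s" if s: "-1 < Re s" "Re s < 0" for s
  proof -
    have cos0: "cos (of_real pi * s / 2) \<noteq> 0" using s by (intro cos_half_pi_nonzero) auto
    have sZ: "s \<notin> \<int>"
    proof
      assume "s \<in> \<int>"
      then obtain n where "s = of_int n" by (elim Ints_cases)
      hence "-1 < n" "n < 0" using s by auto
      thus False by linarith
    qed
    have sin0: "sin (of_real pi * s) \<noteq> 0" using sZ by (simp add: sin_pi_times_eq_0_iff)
    \<comment> \<open>Reflection followed by the double angle formula: the cosine cancels the one in
      the strip identity, and the remaining sine is that of \<open>f2\<close>.\<close>
    have "rGamma s = Gamma (1 - s) * sin (of_real pi * s) / of_real pi"
    proof -
      have "Gamma s \<noteq> 0" using sZ nonpos_Ints_subset_Ints by (subst Gamma_eq_zero_iff) auto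
      thus ?thesis using Gamma_reflection_complex[of s] sin0 unfolding rGamma_inverse_Gamma
        by (simp add: field_simps)
    qed
    also have "sin (of_real pi * s) = 2 * sin (of_real pi * s / 2) * cos (of_real pi * s / 2)"
      using sin_double[of "of_real pi * s / 2"] by simp
    finally have rG: "rGamma s = Gamma (1 - s) * (2 * sin (of_real pi * s / 2) * cos (of_real pi * s / 2)) / of_real pi" .
    have "L (1 - s) = char_mellin (conj_char chi) s * (2 * tau * cos (of_real pi * s / 2)) / of_nat q powr (1 - s)"
      unfolding L_def tau_def using char_mellin_conj_reflection_strip[OF s] by simp
    thus ?thesis unfolding f1_def f2_def rG using tau cos0 q_pos by (simp add: field_simps)
  qed
  define f where "f = (\<lambda>s. if s \<in> {s. Re s > -1} then f1 s else f2 s)"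
  have "f holomorphic_on {s. Re s > -1} \<union> {s. Re s < 0}"
    unfolding f_def by (rule holomorphic_on_If_Un[OF hol1 hol2]) (auto simp: open_halfspace_Re_gt open_halfspace_Re_lt agree)
  moreover have "{s. Re s > -1} \<union> {s. Re s < 0} = UNIV" by auto
  ultimately have "f holomorphic_on UNIV" by simp
  moreover have "f s = f1 s" if "Re s > -1" for s using that by (simp add: f_def)
  moreover have "f1 s = (\<Sum>n. conj_char chi (Suc n) / of_nat (Suc n) powr s)" if "Re s > 1" for s
    unfolding f1_def using dirichlet_series_conj_eq_mellin[OF that] by simp
  ultimately show ?thesis by (intro exI[of _ f]) (simp add: f1_def)
qed

text \<open>\<open>dirichlet_L\<close> is a definite description, so nothing is known of it before
  existence and uniqueness are shown. Uniqueness is the identity theorem on the half plane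
  \<open>Re s > 1\<close>.\<close>

lemma dirichlet_L_conj:
  shows "dirichlet_L (conj_char chi) holomorphic_on UNIV"
    and "Re s > 1 \<Longrightarrow> dirichlet_L (conj_char chi) s = (\<Sum>n. conj_char chi (Suc n) / of_nat (Suc n) powr s)"
    and "Re s > -1 \<Longrightarrow> dirichlet_L (conj_char chi) s = of_real (2 * pi) powr s * char_mellin (conj_char chi) s * rGamma s"
proof -
  obtain f where f: "f holomorphic_on UNIV"
     "\<forall>s. 1 < Re s \<longrightarrow> f s = (\<Sum>n. conj_char chi (Suc n) / of_nat (Suc n) powr s)"
     "\<forall>s. -1 < Re s \<longrightarrow> f s = of_real (2 * pi) powr s * char_mellin (conj_char chi) s * rGamma s"
    using dirichlet_L_conj_exists by blast
  have "dirichlet_L (conj_char chi) = f"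
    unfolding dirichlet_L_def
  proof (rule the_equality)
    show "f holomorphic_on UNIV \<and> (\<forall>s. 1 < Re s \<longrightarrow> f s = (\<Sum>n. conj_char chi (Suc n) / of_nat (Suc n) powr s))"
      using f by blast
    fix g assume g: "g holomorphic_on UNIV \<and> (\<forall>s. 1 < Re s \<longrightarrow> g s = (\<Sum>n. conj_char chi (Suc n) / of_nat (Suc n) powr s))"
    show "g = f"
    proof
      fix s
      show "g s = f s"
      proof (rule analytic_continuation_open[of "{s. Re s > 1}" UNIV g f])
        show "{s. Re s > 1} \<noteq> {}" by (auto intro!: exI[of _ 2])
      qed (use f g in \<open>auto simp: open_halfspace_Re_gt\<close>)
    qed
  qed
  with f show "dirichlet_L (conj_char chi) holomorphic_on UNIV"
    "Re s > 1 \<Longrightarrow> dirichlet_L (conj_char chi) s = (\<Sum>n. conj_char chi (Suc n) / of_nat (Suc n) powr s)"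
    "Re s > -1 \<Longrightarrow> dirichlet_L (conj_char chi) s = of_real (2 * pi) powr s * char_mellin (conj_char chi) s * rGamma s"
    by simp_all
qed

lemma char_mellin_conj_eq_dirichlet_L:
  assumes "Re s > -1" "s \<notin> \<int>"
  shows "char_mellin (conj_char chi) s = Gamma s * dirichlet_L (conj_char chi) s / of_real (2 * pi) powr s"
proof -
  have "Gamma s * rGamma s = 1"
    using assms nonpos_Ints_subset_Ints by (intro rGamma_mult_Gamma) blast
  thus ?thesis using assms by (simp add: dirichlet_L_conj(3))
qed

lemma dirichlet_L_has_sum:
  assumes "Re s > 1"
  shows "((\<lambda>n. chi n / of_nat n powr s) has_sum dirichlet_L chi s) {0<..}"
proof -
  interpret c: even_primitive_char q "conj_char chi" by (rule conj)
  show ?thesis using dirichlet_series_has_sum[OF assms] c.dirichlet_L_conj(2)[OF assms] by simp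
qed

text \<open>Continued from the strip \<open>-1 < Re s < 0\<close>. The cosine remains a factor,
  since dividing by it would create poles at the odd positive integers. It is needed at
  \<open>s = nu - 1 - 2 j\<close>.\<close>

lemma char_mellin_conj_functional_equation:
  assumes "Re s > -1"
  shows "char_mellin (conj_char chi) s * (2 * gauss_sum q chi * cos (of_real pi * s / 2)) / of_nat q powr (1 - s) =
    dirichlet_L chi (1 - s)"
proof (rule analytic_continuation_open[of "{s. -1 < Re s \<and> Re s < 0}" "{s. Re s > -1}"
    "\<lambda>s. char_mellin (conj_char chi) s * (2 * gauss_sum q chi * cos (of_real pi * s / 2)) / of_nat q powr (1 - s)"
    "\<lambda>s. dirichlet_L chi (1 - s)"])
  interpret c: even_primitive_char q "conj_char chi" by (rule conj)
  show "open {s. -1 < Re s \<and> Re s < 0}" 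
    by (simp add: Collect_conj_eq open_Int open_halfspace_Re_gt open_halfspace_Re_lt)
  show "open {s. Re s > -1}" by (rule open_halfspace_Re_gt)
  show "{s. -1 < Re s \<and> Re s < 0} \<noteq> {}" by (auto intro!: exI[of _ "- 1 / 2"])
  show "connected {s. Re s > -1}" by (intro convex_connected convex_halfspace_Re_gt)
  show "(\<lambda>s. char_mellin (conj_char chi) s * (2 * gauss_sum q chi * cos (of_real pi * s / 2)) / of_nat q powr (1 - s)) holomorphic_on {s. Re s > -1}"
    using char_mellin_conj_holomorphic q_pos by (intro holomorphic_intros) auto
  have "(dirichlet_L chi \<circ> (\<lambda>s. 1 - s)) holomorphic_on {s. Re s > -1}"
    using c.dirichlet_L_conj(1) by (intro holomorphic_on_compose_gen[of _ _ _ UNIV] holomorphic_intros) auto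
  thus "(\<lambda>s. dirichlet_L chi (1 - s)) holomorphic_on {s. Re s > -1}" by (simp add: o_def)
  fix s assume "s \<in> {s. -1 < Re s \<and> Re s < 0}"
  thus "char_mellin (conj_char chi) s * (2 * gauss_sum q chi * cos (of_real pi * s / 2)) / of_nat q powr (1 - s) = dirichlet_L chi (1 - s)"
    using char_mellin_conj_reflection_strip[of s] c.dirichlet_L_conj(2)[of "1 - s"] by simp
qed (use assms in auto)

end

section \<open>The Bessel series\<close>

lemma summable_on_real_product:
  fixes f g :: "'a \<Rightarrow> real"
  assumes "f summable_on A" "g summable_on B" "\<And>x. x \<in> A \<Longrightarrow> f x \<ge> 0" "\<And>y. y \<in> B \<Longrightarrow> g y \<ge> 0"
  shows "(\<lambda>(x, y). f x * g y) summable_on A \<times> B"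
proof (rule summable_on_SigmaI)
  show "((\<lambda>y. case (x, y) of (x, y) \<Rightarrow> f x * g y) has_sum (f x * infsum g B)) B" for x
    unfolding prod.case by (intro has_sum_cmult_right has_sum_infsum assms)
  show "(\<lambda>x. f x * infsum g B) summable_on A" by (intro summable_on_cmult_left assms)
qed (use assms in auto)

lemma has_sum_complex_product:
  fixes f g :: "'a \<Rightarrow> complex"
  assumes "(f has_sum a) A" "(g has_sum b) B"
    and "(\<lambda>x. norm (f x)) summable_on A" "(\<lambda>y. norm (g y)) summable_on B"
  shows "((\<lambda>(x, y). f x * g y) has_sum (a * b)) (A \<times> B)"
proof (rule has_sum_SigmaI)
  show "((\<lambda>y. case (x, y) of (x, y) \<Rightarrow> f x * g y) has_sum (f x * b)) B" for x
    unfolding prod.case by (intro has_sum_cmult_right assms)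
  show "((\<lambda>x. f x * b) has_sum (a * b)) A" by (intro has_sum_cmult_left assms)
  have "(\<lambda>(x, y). norm (f x) * norm (g y)) summable_on A \<times> B"
    by (rule summable_on_real_product) (use assms in auto)
  hence "(\<lambda>xy. norm (case xy of (x, y) \<Rightarrow> f x * g y)) summable_on A \<times> B"
    by (simp add: case_prod_unfold norm_mult)
  thus "(\<lambda>(x, y). f x * g y) summable_on A \<times> B" by (rule abs_summable_summable)
qed

text \<open>Pairs \<open>(d, m)\<close> correspond to an integer \<open>k = d * m\<close> with a
  chosen divisor \<open>d\<close>. Unordered summation permits grouping by \<open>k\<close>, and the
  inner sums are finite because \<open>k > 0\<close>.\<close>

lemma has_sum_divisor_sum:
  fixes h :: "nat \<Rightarrow> nat \<Rightarrow> complex"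
  assumes "((\<lambda>(d, m). h d m) has_sum S) ({0<..} \<times> {0<..})"
  shows "((\<lambda>k. \<Sum>d\<in>{d. d dvd k}. h d (k div d)) has_sum S) {0<..}"
proof -
  have "((\<lambda>(k, d). h d (k div d)) has_sum S) (Sigma {0<..} (\<lambda>k. {d. d dvd k})) \<longleftrightarrow>
        ((\<lambda>(d, m). h d m) has_sum S) ({0<..} \<times> {0<..})"
    by (rule has_sum_reindex_bij_witness[of _ "\<lambda>(d, m). (d * m, d)" "\<lambda>(k, d). (d, k div d)"])
       (auto simp: div_greater_zero_iff dvd_imp_le intro: dvd_pos_nat)
  with assms have "((\<lambda>(k, d). h d (k div d)) has_sum S) (Sigma {0<..} (\<lambda>k. {d. d dvd k}))" by simp
  thus ?thesis
  proof (rule has_sum_Sigma')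
    fix k :: nat assume "k \<in> {0<..}"
    hence "finite {d. d dvd k}" by simp
    thus "((\<lambda>y. case (k, y) of (k, d) \<Rightarrow> h d (k div d)) has_sum (\<Sum>d\<in>{d. d dvd k}. h d (k div d))) {d. d dvd k}"
      unfolding prod.case by (rule has_sum_finite)
  qed
qed

text \<open>Averaging over \<open>v\<close> and \<open>- v\<close> replaces the exponential by
  \<open>cosh (nu * v)\<close>; the integrand is then even and the line counts the half line
  twice.\<close>

lemma bessel_K_integral:
  fixes y :: real and nu :: complex
  assumes y: "y > 0"
  shows "(LINT v|lborel. exp (nu * of_real v) * of_real (exp (- y * cosh v))) = 2 * bessel_K nu y"
proof -
  define g where "g = (\<lambda>v. exp (nu * of_real v) * of_real (exp (- y * cosh v)) :: complex)"
  define h where "h = (\<lambda>v. of_real (exp (- y * cosh v)) * cosh (nu * of_real v) :: complex)"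
  define p where "p = \<bar>Re nu\<bar> + 1"
  have p: "p > 0" by (simp add: p_def)
  have ch: "cosh v = (exp v + exp (- v)) / 2" for v :: real by (simp add: cosh_def)
  \<comment> \<open>Both \<open>exp v\<close> and \<open>exp (- v)\<close> are at most
    \<open>2 * cosh v\<close>, so the same estimate controls either end.\<close>
  have cb: "exp (- y * cosh v) \<le> p powr p * (y / 2) powr (- p) * exp (- p * w)" if "w = v \<or> w = - v" for v w :: real
  proof -
    have "exp w \<le> exp v + exp (- v)" using that by auto
    hence "y / 2 * exp w \<le> y * cosh v" using y unfolding ch by simp
    hence "exp (- y * cosh v) \<le> exp (- (y / 2 * exp w))" by simp
    also have "\<dots> \<le> p powr p * (y / 2 * exp w) powr (- p)" using y p by (intro exp_minus_le_powr) auto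
    also have "\<dots> = p powr p * (y / 2) powr (- p) * exp (- p * w)"
      using y by (subst powr_mult) (auto simp: exp_powr_real mult_ac)
    finally show ?thesis .
  qed
  have ig: "integrable lborel g" unfolding g_def
  proof (rule integrable_bilateral_laplace)
    show "norm (complex_of_real (exp (- y * cosh v))) \<le> p powr p * (y / 2) powr (- p) * exp (- (- p) * v)" for v
      using cb[of "- v" v] by simp
    show "norm (complex_of_real (exp (- y * cosh v))) \<le> p powr p * (y / 2) powr (- p) * exp (- p * v)" for v
      using cb[of v v] by simp
    show "(\<lambda>v. complex_of_real (exp (- y * cosh v))) \<in> borel_measurable borel"
      by (intro borel_measurable_continuous_onI continuous_intros)
  qed (auto simp: p_def)
  have ig': "integrable lborel (\<lambda>v. g (- v))"
    using lborel_integrable_real_affine[OF ig, of "-1" 0] by simp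
  have refl: "(LINT v|lborel. f (- v)) = (LINT v|lborel. f v)" for f :: "real \<Rightarrow> complex"
    using lborel_integral_real_affine[of "-1" f 0] by simp
  have hg: "h v = (g v + g (- v)) / 2" for v
    by (simp add: h_def g_def cosh_field_def algebra_simps add_divide_distrib)
  have ih: "integrable lborel h" unfolding hg[abs_def] using ig ig' by simp
  have "(LINT v|lborel. h v) = ((LINT v|lborel. g v) + (LINT v|lborel. g (- v))) / 2"
    unfolding hg using ig ig' by simp
  hence gh: "(LINT v|lborel. g v) = (LINT v|lborel. h v)" unfolding refl by simp
  have hpos: "set_integrable lborel {0..} h" "set_integrable lborel {..<0} h"
    using ih unfolding set_integrable_def by (auto intro!: integrable_mult_indicator)
  have "(LINT v|lborel. h v) = (LINT v|lborel. indicator {0..} v *\<^sub>R h v + indicator {..<0} v *\<^sub>R h v)"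
    by (intro Bochner_Integration.integral_cong) (auto simp: indicator_def)
  also have "\<dots> = (LINT v|lborel. indicator {0..} v *\<^sub>R h v) + (LINT v|lborel. indicator {..<0} v *\<^sub>R h v)"
    using hpos unfolding set_integrable_def by (rule Bochner_Integration.integral_add)
  also have "(LINT v|lborel. indicator {..<0} v *\<^sub>R h v) = (LINT v|lborel. indicator {..<0} (- v) *\<^sub>R h (- v))"
    by (rule refl[symmetric])
  also have "\<dots> = (LINT v|lborel. indicator {0..} v *\<^sub>R h v)"
  proof (rule integral_cong_AE)
    have he: "h (- v) = h v" for v by (simp add: hg add.commute)
    \<comment> \<open>The reflected open half line differs from \<open>{0..}\<close> in the single
      point \<open>0\<close>.\<close>
    show "AE v in lborel. indicator {..<0} (- v) *\<^sub>R h (- v) = indicator {0..} v *\<^sub>R h v"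
      using AE_lborel_singleton[of "0::real"] by eventually_elim (auto simp: indicator_def he)
    have "h \<in> borel_measurable borel" using ih by simp
    thus "(\<lambda>v. indicator {..<0} (- v) *\<^sub>R h (- v)) \<in> borel_measurable lborel"
      "(\<lambda>v. indicator {0..} v *\<^sub>R h v) \<in> borel_measurable lborel" by measurable
  qed
  also have "(LINT v|lborel. indicator {0..} v *\<^sub>R h v) = integral {0..} h"
    using set_borel_integral_eq_integral(2)[OF hpos(1)] by (simp add: set_lebesgue_integral_def)
  also have "integral {0..} h = bessel_K nu y" by (simp add: bessel_K_def h_def)
  finally show ?thesis using gh by (simp add: g_def)
qed

text \<open>The translation by \<open>c\<close> balances the exponentials: \<open>a * exp c\<close>
  and \<open>b * x * exp (- c)\<close> both equal \<open>sqrt (a * b * x)\<close>, so their sum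
  becomes a multiple of \<open>cosh v\<close>.\<close>

lemma bessel_K_pair_integral:
  fixes x a b :: real
  assumes x: "x > 0" and ab: "a > 0" "b > 0"
  shows "(LINT v|lborel. exp (nu * of_real v) * of_real (exp (- 2 * pi * a * exp v - 2 * pi * b * x * exp (- v)))) =
     2 * of_real (b * x / a) powr (nu / 2) * bessel_K nu (4 * pi * sqrt (a * b * x))"
proof -
  define c where "c = ln (b * x / a) / 2"
  have bxa: "b * x / a > 0" using x ab by simp
  have ec2: "exp c ^ 2 = b * x / a"
  proof -
    have "exp c ^ 2 = exp (2 * c)" by (simp only: exp_double)
    also have "2 * c = ln (b * x / a)" by (simp add: c_def)
    finally show ?thesis using bxa by (simp only: exp_ln)
  qed
  hence ec: "exp c = sqrt (b * x / a)" by (intro real_sqrt_unique[symmetric]) auto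
  have e1: "a * exp c = sqrt (a * b * x)"
  proof -
    have "a * exp c = sqrt (a ^ 2) * sqrt (b * x / a)" using ab by (simp add: ec)
    also have "\<dots> = sqrt (a ^ 2 * (b * x / a))" by (simp only: real_sqrt_mult)
    also have "a ^ 2 * (b * x / a) = a * b * x" using ab by (simp add: power2_eq_square)
    finally show ?thesis .
  qed
  have e2: "b * x * exp (- c) = sqrt (a * b * x)"
  proof -
    have "b * x = (a * exp c) * exp c"
      using ab ec2 by (simp add: power2_eq_square mult.assoc)
    hence "b * x * exp (- c) = (a * exp c) * (exp c * exp (- c))" by (simp only: mult.assoc)
    also have "exp c * exp (- c) = 1" by (simp flip: exp_add)
    finally show ?thesis using e1 by simp
  qed
  define f where "f = (\<lambda>v. exp (nu * of_real v) * of_real (exp (- 2 * pi * a * exp v - 2 * pi * b * x * exp (- v))) :: complex)"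
  have fs: "f (v + c) = exp (nu * of_real c) * (exp (nu * of_real v) * of_real (exp (- (4 * pi * sqrt (a * b * x)) * cosh v)))" for v
  proof -
    have "- 2 * pi * a * exp (v + c) - 2 * pi * b * x * exp (- (v + c)) = - 2 * pi * ((a * exp c) * exp v) - 2 * pi * ((b * x * exp (- c)) * exp (- v))"
      by (simp add: exp_add exp_diff exp_minus divide_inverse)
    also have "\<dots> = - (4 * pi * sqrt (a * b * x)) * cosh v"
      unfolding e1 e2 by (simp add: cosh_def algebra_simps)
    finally show ?thesis unfolding f_def by (simp add: ring_distribs exp_add mult_ac)
  qed
  have "(LINT v|lborel. f v) = (LINT v|lborel. f (v + c))" by (rule lborel_integral_shift[symmetric])
  also have "\<dots> = exp (nu * of_real c) * (2 * bessel_K nu (4 * pi * sqrt (a * b * x)))"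
    unfolding fs integral_mult_right_zero using x ab by (subst bessel_K_integral) auto
  also have "exp (nu * of_real c) = of_real (b * x / a) powr (nu / 2)"
    unfolding of_real_powr_eq_exp[OF bxa] by (simp add: c_def)
  finally show ?thesis unfolding f_def by (simp only: mult_ac)
qed

context even_primitive_char
begin

text \<open>The geometric series of the Planck factor times the series of \<open>F\<close> is a
  double series whose terms are Bessel integrals. Their arguments depend on \<open>d * m\<close>
  only, so grouping by this product collects them into \<open>sigma_char\<close>.\<close>

lemma bessel_side_has_sum:
  assumes nu: "Re nu \<ge> 0" and x: "x > 0"
  shows "integrable lborel (\<lambda>v. exp (nu * of_real v) * char_exp_series (conj_char chi) (exp v) * of_real (1 / (exp (2 * pi * x * exp (- v)) - 1)))"
    and "((\<lambda>k. 2 * of_real x powr (nu / 2) * (sigma_char (- nu) (conj_char chi) k * of_nat k powr (nu / 2) * bessel_K nu (4 * pi * sqrt (real k * x)))) has_sum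
      (LINT v|lborel. exp (nu * of_real v) * char_exp_series (conj_char chi) (exp v) * of_real (1 / (exp (2 * pi * x * exp (- v)) - 1)))) {0<..}"
proof -
  interpret c: even_primitive_char q "conj_char chi" by (rule conj)
  define F where "F = char_exp_series (conj_char chi)"
  define P where "P = (\<lambda>v. 1 / (exp (2 * pi * x * exp (- v)) - 1))"
  define f where "f = (\<lambda>(d, m) v. conj_char chi d * (exp (nu * of_real v) * of_real (exp (- 2 * pi * real d * exp v - 2 * pi * real m * x * exp (- v)))))"
  define I where "I = ({0<..} \<times> {0<..} :: (nat \<times> nat) set)"
  \<comment> \<open>The orders of decay \<open>(p, r) = (2, 3)\<close> give the rate
    \<open>Re nu + 1 > 0\<close>, while \<open>(K, 2)\<close> gives
    \<open>Re nu - K + 2 = - 1\<close>; both keep at least \<open>d^-2 * m^-2\<close>.\<close>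
  define K where "K = Re nu + 3"
  define B where "B = (\<lambda>p r. p powr p * (2 * pi) powr (- p) * (r powr r * (2 * pi * x) powr (- r)))"
  define C where "C = max (B 2 3) (B K 2)"
  define a where "a = (\<lambda>(d, m). real d powr (- 2) * real m powr (- 2))"
  have bd: "norm (f (d, m) v) \<le> B p r * (real d powr (- p) * real m powr (- r)) * exp ((Re nu - p + r) * v)"
    if d: "d > 0" "m > 0" and pr: "p > 0" "r > 0" for d m v p r
  proof -
    have "norm (f (d, m) v) = norm (conj_char chi d) * (exp (Re nu * v) * (exp (- (2 * pi * real d * exp v)) * exp (- (2 * pi * real m * x * exp (- v)))))"
      by (simp add: f_def norm_mult flip: exp_add)
    also have "\<dots> \<le> 1 * (exp (Re nu * v) * ((p powr p * (2 * pi * real d * exp v) powr (- p)) * (r powr r * (2 * pi * real m * x * exp (- v)) powr (- r))))"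
      using d pr x by (intro mult_mono c.norm_chi_le exp_minus_le_powr mult_pos_pos mult_nonneg_nonneg) auto
    also have "(2 * pi * real d * exp v) powr (- p) = (2 * pi) powr (- p) * real d powr (- p) * exp (- p * v)"
      using d by (simp add: powr_mult exp_powr_real mult.commute)
    also have "2 * pi * real m * x * exp (- v) = (2 * pi * x) * real m * exp (- v)" by simp
    also have "((2 * pi * x) * real m * exp (- v)) powr (- r) = (2 * pi * x) powr (- r) * real m powr (- r) * exp (r * v)"
      using d x by (subst powr_mult; simp)+ (simp add: exp_powr_real mult.commute)
    also have "1 * (exp (Re nu * v) * (p powr p * ((2 * pi) powr (- p) * real d powr (- p) * exp (- p * v)) * (r powr r * ((2 * pi * x) powr (- r) * real m powr (- r) * exp (r * v))))) =
       B p r * (real d powr (- p) * real m powr (- r)) * (exp (Re nu * v) * exp (- p * v) * exp (r * v))"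
      by (simp only: B_def mult_ac mult_1)
    also have "exp (Re nu * v) * exp (- p * v) * exp (r * v) = exp ((Re nu - p + r) * v)"
      unfolding exp_add [symmetric] by (simp add: algebra_simps)
    finally show ?thesis .
  qed
  have Sf: "((\<lambda>i. f i v) has_sum (exp (nu * of_real v) * F (exp v) * of_real (P v))) I" for v
  proof -
    define y where "y = 2 * pi * x * exp (- v)"
    have y: "y > 0" using x by (simp add: y_def)
    define r where "r = exp (- y)"
    have r: "0 < r" "r < 1" using y by (auto simp: r_def)
    have "(\<lambda>m. complex_of_real r ^ Suc m) sums (of_real r * (1 / (1 - of_real r)))"
      unfolding power_Suc by (intro sums_mult geometric_sums) (use r in simp)
    moreover have "of_real r * (1 / (1 - of_real r)) = complex_of_real (P v)"
    proof -
      have "P v = 1 / (exp y - 1)" by (simp add: P_def y_def)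
      also have "\<dots> = r * (1 / (1 - r))" using r unfolding r_def by (simp add: exp_minus field_simps)
      finally show ?thesis by simp
    qed
    moreover have bij: "bij_betw Suc UNIV {0<..}" by (rule bij_betwI[of _ _ _ "\<lambda>n. n - 1"]) auto
    ultimately have s1: "((\<lambda>m. complex_of_real r ^ m) has_sum of_real (P v)) {0<..}"
    proof -
      assume a: "(\<lambda>m. complex_of_real r ^ Suc m) sums (of_real r * (1 / (1 - of_real r)))" "of_real r * (1 / (1 - of_real r)) = complex_of_real (P v)"
      have "summable (\<lambda>m. norm (complex_of_real r ^ Suc m))"
        using r summable_geometric[of r] by (simp add: norm_mult norm_power summable_mult)
      hence "((\<lambda>m. complex_of_real r ^ Suc m) has_sum of_real (P v)) UNIV"
        using a by (intro norm_summable_imp_has_sum) auto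
      thus ?thesis using has_sum_reindex_bij_betw[OF bij, of "\<lambda>m. complex_of_real r ^ m"] by simp
    qed
    have s2: "(\<lambda>m. norm (complex_of_real r ^ m)) summable_on {0<..}"
    proof (rule summable_on_subset_banach)
      show "(\<lambda>m. norm (complex_of_real r ^ m)) summable_on UNIV"
        using r summable_geometric[of r] by (intro summable_nonneg_imp_summable_on) (auto simp: norm_power)
    qed auto
    have s3: "(\<lambda>d. norm (conj_char chi d * of_real (exp (- 2 * pi * real d * exp v)))) summable_on {0<..}"
    proof (rule summable_on_subset_banach)
      show "(\<lambda>d. norm (conj_char chi d * of_real (exp (- 2 * pi * real d * exp v)))) summable_on UNIV"
        using c.char_exp_series_has_sum(2)[of "exp v"] by (intro summable_nonneg_imp_summable_on) auto
    qed auto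
    have "((\<lambda>(d, m). conj_char chi d * of_real (exp (- 2 * pi * real d * exp v)) * complex_of_real r ^ m) has_sum F (exp v) * of_real (P v)) I"
      unfolding I_def F_def
      by (rule has_sum_complex_product[OF c.char_exp_series_has_sum(1) s1 s3 s2]) simp
    from has_sum_cmult_right[OF this, of "exp (nu * of_real v)"]
    have "((\<lambda>i. exp (nu * of_real v) * (case i of (d, m) \<Rightarrow> conj_char chi d * of_real (exp (- 2 * pi * real d * exp v)) * complex_of_real r ^ m)) has_sum
       exp (nu * of_real v) * F (exp v) * of_real (P v)) I" by (simp only: mult.assoc)
    thus ?thesis
    proof (rule has_sum_cong_imp)
      fix i assume "i \<in> I"
      obtain d m where i: "i = (d, m)" by (cases i)
      have "r ^ m = exp (- 2 * pi * real m * x * exp (- v))"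
        by (simp add: r_def y_def mult_ac flip: exp_of_nat_mult)
      hence "exp (- 2 * pi * real d * exp v - 2 * pi * real m * x * exp (- v)) = exp (- 2 * pi * real d * exp v) * r ^ m"
        by (simp add: algebra_simps flip: exp_add)
      thus "exp (nu * of_real v) * (case i of (d, m) \<Rightarrow> conj_char chi d * of_real (exp (- 2 * pi * real d * exp v)) * complex_of_real r ^ m) = f i v"
        unfolding i f_def prod.case by (simp only: of_real_mult of_real_power mult_ac)
    qed
  qed
  have cI: "countable I" unfolding I_def by simp
  have iI: "infinite I" unfolding I_def by (auto simp: infinite_Ioi finite_cartesian_product_iff)
  have mf: "f i \<in> borel_measurable borel" if "i \<in> I" for i unfolding f_def by (cases i) simp
  have aI: "a summable_on I" unfolding a_def I_def
    by (intro summable_on_real_product summable_inverse_powr_pos) auto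
  have b1: "norm (f i v) \<le> C * a i * exp ((Re nu + 1) * v)" if "i \<in> I" for i v
  proof -
    obtain d m where i: "i = (d, m)" by (cases i)
    have dm: "d > 0" "m > 0" using that by (auto simp: i I_def)
    have "norm (f (d, m) v) \<le> B 2 3 * (real d powr (- 2) * real m powr (- 3)) * exp ((Re nu - 2 + 3) * v)"
      by (rule bd) (use dm in auto)
    also have "\<dots> \<le> C * (real d powr (- 2) * real m powr (- 2)) * exp ((Re nu + 1) * v)"
      using dm by (intro mult_mono powr_mono) (auto simp: C_def B_def le_max_iff_disj add.commute)
    finally show ?thesis by (simp add: i a_def)
  qed
  have b2: "norm (f i v) \<le> C * a i * exp (- 1 * v)" if "i \<in> I" for i v
  proof -
    obtain d m where i: "i = (d, m)" by (cases i)
    have dm: "d > 0" "m > 0" using that by (auto simp: i I_def)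
    have "norm (f (d, m) v) \<le> B K 2 * (real d powr (- K) * real m powr (- 2)) * exp ((Re nu - K + 2) * v)"
      by (rule bd) (use dm nu in \<open>auto simp: K_def\<close>)
    also have "\<dots> \<le> C * (real d powr (- 2) * real m powr (- 2)) * exp (- 1 * v)"
      using dm nu by (intro mult_mono powr_mono) (auto simp: C_def B_def K_def le_max_iff_disj)
    finally show ?thesis by (simp add: i a_def)
  qed
  have a0: "a i \<ge> 0" if "i \<in> I" for i by (simp add: a_def case_prod_unfold)
  have "Re nu + 1 > 0" using nu by simp
  note sw = has_sum_integral_two_sided_bound[OF cI iI mf this zero_less_one aI a0 b1 b2 Sf]
  show "integrable lborel (\<lambda>v. exp (nu * of_real v) * char_exp_series (conj_char chi) (exp v) * of_real (1 / (exp (2 * pi * x * exp (- v)) - 1)))"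
    using sw(1) by (simp only: F_def P_def)
  define J where "J = (\<lambda>d m. conj_char chi d * (2 * of_real (real m * x / real d) powr (nu / 2) * bessel_K nu (4 * pi * sqrt (real d * real m * x))))"
  have "((\<lambda>(d, m). J d m) has_sum (LINT v|lborel. exp (nu * of_real v) * F (exp v) * of_real (P v))) I"
  proof (rule has_sum_cong_imp[OF sw(2)])
    fix i assume "i \<in> I"
    then obtain d m where i: "i = (d, m)" "d > 0" "m > 0" by (auto simp: I_def)
    show "(LINT v|lborel. f i v) = (case i of (d, m) \<Rightarrow> J d m)"
      unfolding i f_def prod.case J_def integral_mult_right_zero
      using i x by (subst bessel_K_pair_integral) auto
  qed
  from has_sum_divisor_sum[OF this[unfolded I_def]]
  have "((\<lambda>k. \<Sum>d\<in>{d. d dvd k}. J d (k div d)) has_sum (LINT v|lborel. exp (nu * of_real v) * F (exp v) * of_real (P v))) {0<..}" .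
  hence "((\<lambda>k. 2 * of_real x powr (nu / 2) * (sigma_char (- nu) (conj_char chi) k * of_nat k powr (nu / 2) * bessel_K nu (4 * pi * sqrt (real k * x)))) has_sum
      (LINT v|lborel. exp (nu * of_real v) * F (exp v) * of_real (P v))) {0<..}"
  proof (rule has_sum_cong_imp)
    fix k :: nat assume "k \<in> {0<..}"
    hence k: "k > 0" by simp
    have "J d (k div d) = 2 * of_real x powr (nu / 2) * ((of_nat d powr (- nu) * conj_char chi d) * of_nat k powr (nu / 2) * bessel_K nu (4 * pi * sqrt (real k * x)))"
      if "d \<in> {d. d dvd k}" for d
    proof -
      have "d dvd k" using that by simp
      then obtain m where km: "k = d * m" by (elim dvdE)
      have dm: "d > 0" "m > 0" using k km by auto
      \<comment> \<open>As \<open>m = k / d\<close>, the power \<open>(m / d)^(nu / 2)\<close> is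
        \<open>k^(nu / 2) * d^(- nu)\<close>, which is the divisor weight.\<close>
      have "complex_of_real (real m * x / real d) powr (nu / 2) = of_real x powr (nu / 2) * of_nat d powr (- nu) * of_nat k powr (nu / 2)"
      proof -
        have "complex_of_real (real m * x / real d) powr (nu / 2) = exp (nu / 2 * of_real (ln (real m) + ln x - ln (real d)))"
          using dm x by (subst of_real_powr_eq_exp) (simp_all add: ln_div ln_mult)
        moreover have "of_real x powr (nu / 2) * of_nat d powr (- nu) * of_nat k powr (nu / 2) =
          exp (nu / 2 * of_real (ln x) + - nu * of_real (ln (real d)) + nu / 2 * of_real (ln (real d) + ln (real m)))"
          using dm x of_real_powr_eq_exp[of "real d" "- nu"] of_real_powr_eq_exp[of "real k" "nu / 2"] k
          unfolding exp_add by (simp add: of_real_powr_eq_exp km ln_mult)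
        ultimately show ?thesis by (simp add: algebra_simps)
      qed
      thus ?thesis using dm unfolding J_def km by (simp add: mult_ac)
    qed
    thus "(\<Sum>d\<in>{d. d dvd k}. J d (k div d)) = 2 * of_real x powr (nu / 2) * (sigma_char (- nu) (conj_char chi) k * of_nat k powr (nu / 2) * bessel_K nu (4 * pi * sqrt (real k * x)))"
      unfolding sigma_char_def sum_distrib_left sum_distrib_right by (intro sum.cong) auto
  qed
  thus "((\<lambda>k. 2 * of_real x powr (nu / 2) * (sigma_char (- nu) (conj_char chi) k * of_nat k powr (nu / 2) * bessel_K nu (4 * pi * sqrt (real k * x)))) has_sum
      (LINT v|lborel. exp (nu * of_real v) * char_exp_series (conj_char chi) (exp v) * of_real (1 / (exp (2 * pi * x * exp (- v)) - 1)))) {0<..}"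
    by (simp only: F_def P_def)
qed

end

section \<open>The Planck remainder\<close>

lemma of_nat_powr_even: "n > 0 \<Longrightarrow> (of_nat n :: complex) powr (2 * of_nat j) = of_nat n ^ (2 * j)"
  using powr_nat'[of "of_nat n :: complex" "2 * j"] by simp

lemma zeta_series_has_sum:
  assumes "j > 0"
  shows "((\<lambda>m. 1 / of_nat m ^ (2 * j)) has_sum zeta_series (2 * of_nat j)) {0<..}"
    and "(\<lambda>m. norm (1 / of_nat m ^ (2 * j) :: complex)) summable_on {0<..}"
proof -
  have j: "real (2 * j) > 1" using assms by simp
  show n: "(\<lambda>m. norm (1 / of_nat m ^ (2 * j) :: complex)) summable_on {0<..}"
  proof (rule norm_summable_on_if_le_powr[OF j, of _ 1])
    fix n :: nat assume "n > 0"
    thus "norm (1 / of_nat n ^ (2 * j) :: complex) \<le> 1 * real n powr - real (2 * j)"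
      using powr_realpow[of "real n" "2 * j"]
      by (simp only: norm_divide norm_power norm_of_nat norm_one powr_minus divide_inverse of_nat_0_less_iff) (simp add: norm_inverse norm_power)
  qed
  from has_sum_infsum[OF abs_summable_summable[OF this]]
  have h: "((\<lambda>m. 1 / of_nat m ^ (2 * j)) has_sum (\<Sum>\<^sub>\<infinity>m\<in>{0<..}. 1 / of_nat m ^ (2 * j) :: complex)) {0<..}" .
  from has_sum_pos_imp_sums_Suc[OF this]
  have "(\<Sum>\<^sub>\<infinity>m\<in>{0<..}. 1 / of_nat m ^ (2 * j) :: complex) = (\<Sum>m. 1 / of_nat (Suc m) ^ (2 * j))"
    by (simp add: sums_iff)
  also have "\<dots> = zeta_series (2 * of_nat j)"
    unfolding zeta_series_def by (subst of_nat_powr_even) auto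
  finally show "((\<lambda>m. 1 / of_nat m ^ (2 * j)) has_sum zeta_series (2 * of_nat j)) {0<..}"
    using h by simp
qed

text \<open>Expanding \<open>1 / (m^2 + y^2)\<close> in powers of \<open>y^2 / m^2\<close> and
  stopping after \<open>N\<close> terms leaves \<open>(- y^2)^N\<close> times the summand of this
  series.\<close>

definition planck_remainder :: "nat \<Rightarrow> real \<Rightarrow> complex" where
  "planck_remainder N y = (\<Sum>\<^sub>\<infinity>m\<in>{0<..}. 1 / of_real (real m ^ (2 * N) * (real m ^ 2 + y ^ 2)))"

lemma planck_remainder_has_sum:
  shows "((\<lambda>m. 1 / of_real (real m ^ (2 * N) * (real m ^ 2 + y ^ 2))) has_sum planck_remainder N y) {0<..}"
    and "(\<lambda>m. norm (1 / of_real (real m ^ (2 * N) * (real m ^ 2 + y ^ 2)) :: complex)) summable_on {0<..}"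
proof -
  show n: "(\<lambda>m. norm (1 / of_real (real m ^ (2 * N) * (real m ^ 2 + y ^ 2)) :: complex)) summable_on {0<..}"
  proof (rule norm_summable_on_if_le_powr[of 2 _ 1])
    fix n :: nat assume n: "n > 0"
    have "norm (1 / of_real (real n ^ (2 * N) * (real n ^ 2 + y ^ 2)) :: complex) = 1 / (real n ^ (2 * N) * (real n ^ 2 + y ^ 2))"
      by (simp only: norm_divide norm_of_real norm_one) simp
    also have "\<dots> \<le> 1 / (1 * real n ^ 2)"
      using n by (intro divide_left_mono mult_mono mult_pos_pos add_pos_nonneg) auto
    also have "\<dots> = 1 * real n powr (- 2)" using n by (simp add: powr_minus powr_numeral divide_inverse)
    finally show "norm (1 / of_real (real n ^ (2 * N) * (real n ^ 2 + y ^ 2)) :: complex) \<le> 1 * real n powr (- 2)" .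
  qed simp
  show "((\<lambda>m. 1 / of_real (real m ^ (2 * N) * (real m ^ 2 + y ^ 2))) has_sum planck_remainder N y) {0<..}"
    unfolding planck_remainder_def by (rule has_sum_infsum[OF abs_summable_summable[OF n]])
qed

text \<open>One geometric step,
  \<open>1 / (m^2 + y^2) = 1 / m^2 - y^2 / (m^2 * (m^2 + y^2))\<close>, divided by
  \<open>m^(2 N)\<close> and summed over \<open>m\<close>.\<close>

lemma planck_remainder_Suc:
  "planck_remainder N y = zeta_series (2 * of_nat (Suc N)) - of_real (y ^ 2) * planck_remainder (Suc N) y"
proof -
  have "((\<lambda>m. 1 / of_nat m ^ (2 * Suc N) + (- of_real (y ^ 2)) * (1 / of_real (real m ^ (2 * Suc N) * (real m ^ 2 + y ^ 2)))) has_sum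
     zeta_series (2 * of_nat (Suc N)) + (- of_real (y ^ 2)) * planck_remainder (Suc N) y) {0<..}"
    by (intro has_sum_add has_sum_cmult_right zeta_series_has_sum planck_remainder_has_sum) simp
  hence "((\<lambda>m. 1 / of_nat m ^ (2 * Suc N) - of_real (y ^ 2) * (1 / of_real (real m ^ (2 * Suc N) * (real m ^ 2 + y ^ 2)))) has_sum
     zeta_series (2 * of_nat (Suc N)) - of_real (y ^ 2) * planck_remainder (Suc N) y) {0<..}"
    by (simp only: mult_minus_left diff_conv_add_uminus)
  hence "((\<lambda>m. 1 / of_real (real m ^ (2 * N) * (real m ^ 2 + y ^ 2))) has_sum
     zeta_series (2 * of_nat (Suc N)) - of_real (y ^ 2) * planck_remainder (Suc N) y) {0<..}"
  proof (rule has_sum_cong_imp)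
    fix m :: nat assume "m \<in> {0<..}"
    hence m: "m > 0" by simp
    have "1 / M - Y * (1 / (M * (m2 + Y))) = 1 / (K * (m2 + Y))" if "M = K * m2" "K \<noteq> 0" "m2 \<noteq> 0" "m2 + Y \<noteq> 0" for M Y K m2 :: real
      using that by (simp add: divide_simps)
    from this[of "real m ^ (2 * Suc N)" "real m ^ (2 * N)" "real m ^ 2" "y ^ 2"]
    have "1 / real m ^ (2 * Suc N) - y ^ 2 * (1 / (real m ^ (2 * Suc N) * (real m ^ 2 + y ^ 2))) = 1 / (real m ^ (2 * N) * (real m ^ 2 + y ^ 2))"
      using m by (simp add: power2_eq_square sum_power2_eq_zero_iff[unfolded power2_eq_square])
    hence "complex_of_real (1 / real m ^ (2 * Suc N) - y ^ 2 * (1 / (real m ^ (2 * Suc N) * (real m ^ 2 + y ^ 2)))) = of_real (1 / (real m ^ (2 * N) * (real m ^ 2 + y ^ 2)))"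
      by (simp only:)
    thus "1 / of_nat m ^ (2 * Suc N) - of_real (y ^ 2) * (1 / of_real (real m ^ (2 * Suc N) * (real m ^ 2 + y ^ 2))) = (1 / of_real (real m ^ (2 * N) * (real m ^ 2 + y ^ 2)) :: complex)"
      by (simp only: of_real_diff of_real_mult of_real_divide of_real_power of_real_1 of_real_of_nat_eq)
  qed
  with planck_remainder_has_sum(1) show ?thesis by (rule has_sum_unique)
qed

text \<open>Finitely many geometric steps give an exact identity for every \<open>y > 0\<close>, not
  just for small \<open>y\<close>, so it can be integrated over all \<open>v\<close>. The start
  \<open>N = 0\<close> is the cotangent expansion.\<close>

lemma planck_expansion:
  assumes y: "y > 0"
  shows "complex_of_real (1 / (exp (2 * pi * y) - 1)) =
     - 1 / 2 + of_real (1 / (2 * pi * y)) +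
     (\<Sum>j<N. (- 1) ^ j * of_real (y ^ (2 * j + 1) / pi) * zeta_series (2 * of_nat (Suc j))) +
     (- 1) ^ N * of_real (y ^ (2 * N + 1) / pi) * planck_remainder N y"
proof (induction N)
  case 0
  have "((\<lambda>m. 1 / of_real (real m ^ (2 * 0) * (real m ^ 2 + y ^ 2))) has_sum planck_remainder 0 y) {0<..}"
    by (rule planck_remainder_has_sum)
  from has_sum_pos_imp_sums_Suc[OF this]
  have "(\<lambda>m. complex_of_real (1 / (real (Suc m) ^ 2 + y ^ 2))) sums planck_remainder 0 y" by simp
  moreover have "(\<lambda>m. complex_of_real (1 / (real (Suc m) ^ 2 + y ^ 2))) sums of_real (pi / y * (1 / (exp (2 * pi * y) - 1) + 1 / 2 - 1 / (2 * pi * y)))"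
    by (rule sums_of_real[OF planck_partial_fractions[OF y]])
  ultimately have "planck_remainder 0 y = of_real (pi / y * (1 / (exp (2 * pi * y) - 1) + 1 / 2 - 1 / (2 * pi * y)))"
    by (rule sums_unique2)
  hence "complex_of_real (y / pi) * planck_remainder 0 y = of_real (y / pi * (pi / y * (1 / (exp (2 * pi * y) - 1) + 1 / 2 - 1 / (2 * pi * y))))"
    by (simp only: of_real_mult)
  also have "y / pi * (pi / y * (1 / (exp (2 * pi * y) - 1) + 1 / 2 - 1 / (2 * pi * y))) = 1 / (exp (2 * pi * y) - 1) + 1 / 2 - 1 / (2 * pi * y)"
    using y by (simp flip: mult.assoc)
  finally show ?case by simp
next
  case (Suc N)
  have "y ^ (2 * N + 1) / pi * y ^ 2 = y ^ (2 * Suc N + 1) / pi" by (simp add: power_add power2_eq_square)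
  hence "complex_of_real (y ^ (2 * N + 1) / pi) * of_real (y ^ 2) = of_real (y ^ (2 * Suc N + 1) / pi)"
    by (metis of_real_mult)
  hence "(- 1) ^ N * of_real (y ^ (2 * N + 1) / pi) * planck_remainder N y =
    (- 1) ^ N * of_real (y ^ (2 * N + 1) / pi) * zeta_series (2 * of_nat (Suc N)) +
    (- 1) ^ Suc N * of_real (y ^ (2 * Suc N + 1) / pi) * planck_remainder (Suc N) y"
    unfolding planck_remainder_Suc[of N y] by (simp only: power_Suc ring_distribs) (simp flip: mult.assoc)
  thus ?case unfolding Suc.IH by (simp only: sum.lessThan_Suc add.assoc)
qed

context even_primitive_char
begin

text \<open>The pair \<open>(m, n)\<close> contributes the integral over two quadratics with
  \<open>A = n / q\<close> and \<open>B = x / m\<close>. Taking out the common scale leaves a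
  quotient depending on \<open>m * n\<close> only, so grouping by this product yields
  \<open>sigma_bar_char\<close>.\<close>

lemma remainder_side_has_sum:
  fixes nu :: complex and N :: nat and x :: real
  assumes nu: "nu \<notin> \<int>" "Re nu \<ge> 0" and N: "2 * real N \<le> Re nu + 1" "Re nu - 1 < 2 * real N"
    and x: "x > 0" "\<not> (\<exists>m::nat. m > 0 \<and> real q * x = real m)"
  defines "mu \<equiv> nu - 2 * of_nat N"
  shows "integrable lborel (\<lambda>v. exp ((mu - 1) * of_real v) * char_exp_series (conj_char chi) (exp v) * planck_remainder N (x * exp (- v)))"
    and "((\<lambda>k. of_nat q powr (2 - mu) / (2 * gauss_sum q chi * sin (of_real pi * mu / 2)) *
           (sigma_bar_char (- nu) chi k *
             ((of_nat k powr mu - of_real (real q * x) powr mu) / (of_nat k ^ 2 - of_real (real q * x) ^ 2)))) has_sum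
      (LINT v|lborel. exp ((mu - 1) * of_real v) * char_exp_series (conj_char chi) (exp v) * planck_remainder N (x * exp (- v)))) {0<..}"
proof -
  define tau where "tau = gauss_sum q chi"
  have tau: "tau \<noteq> 0" unfolding tau_def by (rule gauss_sum_nonzero)
  define F where "F = char_exp_series (conj_char chi)"
  define f where "f = (\<lambda>(m, n) v. exp (mu * of_real v) * (of_real (real q ^ 2) / (of_real pi * tau)) *
     (1 / of_real (real m ^ (2 * N) * (real m ^ 2 + (x * exp (- v)) ^ 2)) * (chi n / of_real (real n ^ 2 + (real q * exp v) ^ 2))))"
  define I where "I = ({0<..} \<times> {0<..} :: (nat \<times> nat) set)"
  have mu: "Re mu = Re nu - 2 * real N" "- 1 \<le> Re mu" "Re mu < 1" using N by (auto simp: mu_def)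
  \<comment> \<open>Half the distance of \<open>Re mu\<close> from \<open>1\<close>. It makes the
    weights \<open>m^-(1 + d)\<close> and \<open>n^-(1 + d)\<close> summable and survives as the
    decay rate for large \<open>v\<close>, as \<open>1 - Re mu - d = d\<close>.\<close>
  define d where "d = (1 - Re mu) / 2"
  have d: "0 < d" "d \<le> 1" using mu by (auto simp: d_def)
  \<comment> \<open>The power of \<open>exp v\<close> gained from the remainder as \<open>v\<close>
    tends to minus infinity. For \<open>N > 0\<close> the extra factor \<open>m^(2 N)\<close> makes
    the sum over \<open>m\<close> converge, so all of \<open>y^2\<close> is available. For
    \<open>N = 0\<close> part of it is spent on that sum, which is affordable since then
    \<open>Re mu = Re nu \<ge> 0\<close>.\<close>
  define e where "e = (if N = 0 then 1 - d else 2)"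
  have al: "Re mu + e > 0"
  proof (cases "N = 0")
    case True
    hence "Re mu \<ge> 0" using mu nu by simp
    thus ?thesis using True by (simp add: e_def d_def field_simps)
  qed (use mu in \<open>auto simp: e_def\<close>)
  define C0 where "C0 = real q ^ 2 / (pi * norm tau)"
  define C where "C = C0 * max 1 (x powr (- e))"
  define a where "a = (\<lambda>(m, n). real m powr (- (1 + d)) * real n powr (- (1 + d)))"
  have C0: "C0 \<ge> 0" by (simp add: C0_def)
  have q1: "real q \<ge> 1" using q_pos by simp
  have pw2: "real n powr (1 + d) \<le> real n ^ 2" if "n > 0" for n
  proof -
    have "real n powr (1 + d) \<le> real n powr 2" using that d by (intro powr_mono) auto
    thus ?thesis using that by (simp add: powr_numeral)
  qed
  have nf: "norm (f (m, n) v) \<le> C0 * exp (Re mu * v) / (D1 * D2)"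
    if "0 < D1" "D1 \<le> real m ^ (2 * N) * (real m ^ 2 + (x * exp (- v)) ^ 2)" "0 < D2" "D2 \<le> real n ^ 2 + (real q * exp v) ^ 2" for m n v D1 D2
  proof -
    have "norm (f (m, n) v) = exp (Re mu * v) * C0 * (1 / (real m ^ (2 * N) * (real m ^ 2 + (x * exp (- v)) ^ 2)) * (norm (chi n) / (real n ^ 2 + (real q * exp v) ^ 2)))"
      unfolding f_def prod.case norm_mult norm_divide norm_of_real norm_exp_eq_Re C0_def by simp
    also have "\<dots> \<le> exp (Re mu * v) * C0 * (1 / D1 * (1 / D2))"
      using that norm_chi_le[of n] C0 by (intro mult_left_mono mult_mono frac_le) auto
    also have "\<dots> = C0 * exp (Re mu * v) / (D1 * D2)" by simp
    finally show ?thesis .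
  qed
  have cI: "countable I" unfolding I_def by simp
  have iI: "infinite I" unfolding I_def by (auto simp: infinite_Ioi finite_cartesian_product_iff)
  have mf: "f i \<in> borel_measurable borel" if "i \<in> I" for i unfolding f_def by (cases i) simp
  have aI: "a summable_on I" unfolding a_def I_def
    by (intro summable_on_real_product summable_inverse_powr_pos) (use d in auto)
  have a0: "a i \<ge> 0" if "i \<in> I" for i by (simp add: a_def case_prod_unfold)
  have be: "1 - Re mu - d > 0" using mu by (simp add: d_def)
  have b1: "norm (f i v) \<le> C * a i * exp ((Re mu + e) * v)" if "i \<in> I" for i v
  proof -
    obtain m n where i: "i = (m, n)" by (cases i)
    have mn: "m > 0" "n > 0" using that by (auto simp: i I_def)
    define y where "y = x * exp (- v)"
    have y: "y > 0" using x by (simp add: y_def)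
    have "norm (f (m, n) v) \<le> C0 * exp (Re mu * v) / ((real m powr (1 + d) * y powr e) * real n powr (1 + d))"
    proof (rule nf)
      show "real m powr (1 + d) * y powr e \<le> real m ^ (2 * N) * (real m ^ 2 + (x * exp (- v)) ^ 2)"
      proof (cases "N = 0")
        case True
        thus ?thesis using powr_mult_powr_le_sum_squares[of "real m" y d] d mn y by (simp add: e_def y_def)
      next
        case False
        have "real m powr (1 + d) * y powr e \<le> real m ^ 2 * y ^ 2"
          using pw2[OF mn(1)] False y by (intro mult_mono) (auto simp: e_def powr_numeral)
        also have "\<dots> \<le> real m ^ (2 * N) * (real m ^ 2 + y ^ 2)"
          using False mn by (intro mult_mono power_increasing) auto
        finally show ?thesis by (simp add: y_def)
      qed
      show "real n powr (1 + d) \<le> real n ^ 2 + (real q * exp v) ^ 2"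
        using pw2[OF mn(2)] by (simp add: add_increasing2)
    qed (use mn y in auto)
    also have "\<dots> = C0 * x powr (- e) * a (m, n) * (exp (Re mu * v) * exp (e * v))"
    proof -
      have "inverse (y powr e) = x powr (- e) * exp (e * v)"
      proof -
        have "y powr e = x powr e * exp (- v) powr e" using x by (simp only: y_def powr_mult exp_ge_zero less_imp_le)
        also have "exp (- v) powr e = exp (- (e * v))" by (simp only: exp_powr_real mult_minus_left mult_minus_right mult.commute[of e])
        finally show ?thesis by (simp only: inverse_mult_distrib exp_minus inverse_inverse_eq powr_minus)
      qed
      thus ?thesis by (simp only: a_def prod.case divide_inverse inverse_mult_distrib powr_minus[of "real m"] powr_minus[of "real n"] mult_ac)
    qed
    also have "exp (Re mu * v) * exp (e * v) = exp ((Re mu + e) * v)" by (simp add: ring_distribs exp_add)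
    also have "C0 * x powr (- e) * a (m, n) * exp ((Re mu + e) * v) \<le> C * a (m, n) * exp ((Re mu + e) * v)"
      using C0 a0[of "(m, n)"] that unfolding C_def i by (intro mult_right_mono mult_left_mono) auto
    finally show ?thesis by (simp add: i)
  qed
  have b2: "norm (f i v) \<le> C * a i * exp (- (1 - Re mu - d) * v)" if "i \<in> I" for i v
  proof -
    obtain m n where i: "i = (m, n)" by (cases i)
    have mn: "m > 0" "n > 0" using that by (auto simp: i I_def)
    have "norm (f (m, n) v) \<le> C0 * exp (Re mu * v) / (real m powr (1 + d) * (real n powr (1 + d) * exp v powr (1 - d)))"
    proof (rule nf)
      have "1 * real m powr (1 + d) \<le> real m ^ (2 * N) * (real m ^ 2 + (x * exp (- v)) ^ 2)"
        using mn pw2[OF mn(1)] by (intro mult_mono) (auto simp: add_increasing2)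
      thus "real m powr (1 + d) \<le> real m ^ (2 * N) * (real m ^ 2 + (x * exp (- v)) ^ 2)" by simp
      have "real n powr (1 + d) * exp v powr (1 - d) \<le> real n powr (1 + d) * (real q * exp v) powr (1 - d)"
        using d q1 by (intro mult_left_mono powr_mono2) auto
      also have "\<dots> \<le> real n ^ 2 + (real q * exp v) ^ 2"
        using d mn q1 by (intro powr_mult_powr_le_sum_squares) auto
      finally show "real n powr (1 + d) * exp v powr (1 - d) \<le> real n ^ 2 + (real q * exp v) ^ 2" .
    qed (use mn in auto)
    also have "\<dots> = C0 * 1 * a (m, n) * (exp (Re mu * v) * exp (- ((1 - d) * v)))"
      by (simp only: a_def prod.case divide_inverse inverse_mult_distrib powr_minus[of "real m"] powr_minus[of "real n"] exp_powr_real exp_minus mult_ac mult_1)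
    also have "exp (Re mu * v) * exp (- ((1 - d) * v)) = exp (- (1 - Re mu - d) * v)"
      unfolding exp_add [symmetric] by (simp add: algebra_simps)
    also have "C0 * 1 * a (m, n) * exp (- (1 - Re mu - d) * v) \<le> C * a (m, n) * exp (- (1 - Re mu - d) * v)"
      using C0 a0[of "(m, n)"] that unfolding C_def i by (intro mult_right_mono mult_left_mono) auto
    finally show ?thesis by (simp add: i)
  qed
  have Sf: "((\<lambda>i. f i v) has_sum (exp ((mu - 1) * of_real v) * F (exp v) * planck_remainder N (x * exp (- v)))) I" for v
  proof -
    have nn: "(\<lambda>n. norm (chi n / of_real (real n ^ 2 + (real q * exp v) ^ 2))) summable_on {0<..}"
    proof (rule norm_summable_on_if_le_powr[of 2 _ 1])
      fix n :: nat assume n: "n > 0"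
      have "norm (chi n / of_real (real n ^ 2 + (real q * exp v) ^ 2)) = norm (chi n) / (real n ^ 2 + (real q * exp v) ^ 2)"
        by (simp only: norm_divide norm_of_real) simp
      also have "\<dots> \<le> 1 / real n ^ 2" using n norm_chi_le[of n] by (intro frac_le) auto
      also have "\<dots> = 1 * real n powr (- 2)" using n by (simp add: powr_minus powr_numeral divide_inverse)
      finally show "norm (chi n / of_real (real n ^ 2 + (real q * exp v) ^ 2)) \<le> 1 * real n powr (- 2)" .
    qed simp
    have "((\<lambda>(m, n). 1 / of_real (real m ^ (2 * N) * (real m ^ 2 + (x * exp (- v)) ^ 2)) * (chi n / of_real (real n ^ 2 + (real q * exp v) ^ 2))) has_sum
       planck_remainder N (x * exp (- v)) * (of_real pi * gauss_sum q chi / of_real (real q ^ 2 * exp v) * F (exp v))) I"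
      unfolding I_def F_def
      by (rule has_sum_complex_product[OF planck_remainder_has_sum(1) char_exp_series_conj_partial_fractions planck_remainder_has_sum(2) nn]) simp
    from has_sum_cmult_right[OF this, of "exp (mu * of_real v) * (of_real (real q ^ 2) / (of_real pi * tau))"]
    have "((\<lambda>i. f i v) has_sum (exp (mu * of_real v) * (of_real (real q ^ 2) / (of_real pi * tau)) *
      (planck_remainder N (x * exp (- v)) * (of_real pi * gauss_sum q chi / of_real (real q ^ 2 * exp v) * F (exp v))))) I"
      by (simp only: f_def case_prod_unfold)
    also have "exp (mu * of_real v) * (of_real (real q ^ 2) / (of_real pi * tau)) *
      (planck_remainder N (x * exp (- v)) * (of_real pi * gauss_sum q chi / of_real (real q ^ 2 * exp v) * F (exp v))) =
      exp (mu * of_real v) / of_real (exp v) * F (exp v) * planck_remainder N (x * exp (- v))"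
    proof -
      have alg: "E * (Q / (P * T)) * (R * (P * T / (Q * V) * G)) = E / V * G * R" if "Q \<noteq> 0" "P \<noteq> 0" "T \<noteq> 0" for E Q P T R V G :: complex
        using that by simp
      show ?thesis unfolding tau_def [symmetric] of_real_mult by (rule alg) (use tau q_pos in auto)
    qed
    also have "exp (mu * of_real v) / of_real (exp v) = exp ((mu - 1) * of_real v)"
      by (simp add: left_diff_distrib exp_diff exp_of_real)
    finally show ?thesis .
  qed
  note sw = has_sum_integral_two_sided_bound[OF cI iI mf al be aI a0 b1 b2 Sf]
  show "integrable lborel (\<lambda>v. exp ((mu - 1) * of_real v) * char_exp_series (conj_char chi) (exp v) * planck_remainder N (x * exp (- v)))"
    using sw(1) by (simp only: F_def)
  have sinmu: "sin (of_real pi * mu / 2) \<noteq> 0"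
  proof
    assume "sin (of_real pi * mu / 2) = 0"
    hence "mu / 2 \<in> \<int>" using sin_pi_times_eq_0_iff[of "mu / 2"] by simp
    hence "2 * (mu / 2) + 2 * of_nat N \<in> \<int>" by (intro Ints_add Ints_mult) auto
    moreover have "2 * (mu / 2) + 2 * of_nat N = nu" unfolding mu_def by (simp add: field_simps)
    ultimately show False using nu by (simp only:)
  qed
  define Dk where "Dk = (\<lambda>k::nat. (of_nat k powr mu - of_real (real q * x) powr mu) / (of_nat k ^ 2 - of_real (real q * x) ^ 2) :: complex)"
  define K where "K = of_nat q powr (2 - mu) / (2 * tau * sin (of_real pi * mu / 2))"
  define J where "J = (\<lambda>m n. K * (of_nat m powr (- nu) * chi n) * Dk (m * n))"
  have "((\<lambda>(m, n). J m n) has_sum (LINT v|lborel. exp ((mu - 1) * of_real v) * F (exp v) * planck_remainder N (x * exp (- v)))) I"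
  proof (rule has_sum_cong_imp[OF sw(2)])
    fix i assume "i \<in> I"
    then obtain m n where i: "i = (m, n)" "m > 0" "n > 0" by (auto simp: I_def)
    define A where "A = real n / real q"
    define B where "B = x / real m"
    have AB: "A > 0" "B > 0" using i q_pos x by (auto simp: A_def B_def)
    have AnB: "A \<noteq> B"
    proof
      assume "A = B"
      hence "real q * x = real (m * n)" using i q_pos by (simp add: A_def B_def field_simps)
      moreover have "m * n > 0" using i by simp
      ultimately show False using x(2) by blast
    qed
    \<comment> \<open>Multiplying \<open>m^2 + (x * exp (- v))^2\<close> by
      \<open>exp (2 * v)\<close> gives \<open>m^2 * (B^2 + exp (2 * v))\<close>; this raises the
      exponent from \<open>mu\<close> to \<open>mu + 2\<close>.\<close>
    have fe: "f (m, n) v = chi n / (of_real pi * tau * of_real (real m ^ (2 * N + 2))) *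
       (exp ((mu + 2) * of_real v) / ((of_real A ^ 2 + of_real (exp (2 * v))) * (of_real B ^ 2 + of_real (exp (2 * v)))))" for v
    proof -
      have e2: "exp (2 * v) * exp (- v) ^ 2 = 1"
        by (simp only: exp_double power_mult_distrib[symmetric] exp_add[symmetric]) simp
      have 1: "real n ^ 2 + (real q * exp v) ^ 2 = real q ^ 2 * (A ^ 2 + exp (2 * v))"
        using q_pos by (simp only: A_def exp_double) (simp add: field_simps)
      have 2: "real m ^ (2 * N) * (real m ^ 2 + (x * exp (- v)) ^ 2) = real m ^ (2 * N + 2) * (B ^ 2 + exp (2 * v)) * exp (- v) ^ 2"
      proof -
        have "real m ^ (2 * N + 2) * (B ^ 2 + exp (2 * v)) * exp (- v) ^ 2 =
           real m ^ (2 * N) * ((real m * B) ^ 2 * exp (- v) ^ 2 + real m ^ 2 * (exp (2 * v) * exp (- v) ^ 2))"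
          by (simp only: power_add power_mult_distrib) (simp add: algebra_simps)
        also have "real m * B = x" using i by (simp add: B_def)
        finally show ?thesis by (simp only: e2 power_mult_distrib mult_1_right add.commute)
      qed
      have alg: "E * (Q / P) * (1 / (M * b * V) * (c / (Q * a'))) = c / (P * M) * ((E / V) / (a' * b))" if "Q \<noteq> 0" for E Q P M b V c a' :: complex
        using that by (simp add: mult_ac)
      have ee: "exp (mu * of_real v) / of_real (exp (- v) ^ 2) = exp ((mu + 2) * of_real v)"
      proof -
        have "exp (2 * v) = 1 / exp (- v) ^ 2" using e2 by (simp add: field_simps)
        hence "complex_of_real (exp (2 * v)) = 1 / of_real (exp (- v) ^ 2)" by (simp only: of_real_divide of_real_1)
        moreover have "exp ((mu + 2) * of_real v) = exp (mu * of_real v) * complex_of_real (exp (2 * v))"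
          unfolding exp_of_real [symmetric] exp_add [symmetric] by (simp add: algebra_simps)
        ultimately show ?thesis by simp
      qed
      have "f (m, n) v = chi n / (of_real pi * tau * of_real (real m ^ (2 * N + 2))) *
       ((exp (mu * of_real v) / of_real (exp (- v) ^ 2)) / (of_real (A ^ 2 + exp (2 * v)) * of_real (B ^ 2 + exp (2 * v))))"
        unfolding f_def prod.case 1 2 unfolding of_real_mult by (rule alg) (use q_pos in auto)
      thus ?thesis unfolding ee by simp
    qed
    have "(LINT v|lborel. f (m, n) v) = chi n / (of_real pi * tau * of_real (real m ^ (2 * N + 2))) *
       (of_real pi / (2 * sin (of_real pi * mu / 2)) * ((of_real A powr mu - of_real B powr mu) / (of_real A ^ 2 - of_real B ^ 2)))"
      unfolding fe integral_mult_right_zero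
      using mu AB AnB sinmu by (subst integral_exp_over_two_quadratics) auto
    also have "\<dots> = J m n"
    proof -
      \<comment> \<open>The common denominator: \<open>A = m n / r\<close> and
        \<open>B = q x / r\<close>, while the quotient is homogeneous of degree
        \<open>mu - 2\<close>.\<close>
      define r where "r = real q * real m"
      have r: "r > 0" using q_pos i by (simp add: r_def)
      have rA: "A = real (m * n) / r" "B = (real q * x) / r"
        using q_pos i by (auto simp: A_def B_def r_def field_simps)
      have pA: "complex_of_real A powr mu = of_nat (m * n) powr mu / of_real r powr mu"
        unfolding rA using r i by (subst of_real_divide_powr) auto
      have pB: "complex_of_real B powr mu = of_real (real q * x) powr mu / of_real r powr mu"
        unfolding rA using r x q_pos by (subst of_real_divide_powr) auto
      have sA: "complex_of_real A ^ 2 = of_nat (m * n) ^ 2 / of_real r ^ 2" "complex_of_real B ^ 2 = of_real (real q * x) ^ 2 / of_real r ^ 2"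
        unfolding rA by (simp_all add: power_divide)
      have e1: "(of_real A powr mu - of_real B powr mu) / (of_real A ^ 2 - of_real B ^ 2) = of_real r ^ 2 / of_real r powr mu * Dk (m * n)"
        unfolding pA pB sA Dk_def diff_divide_distrib [symmetric] using r by simp
      have e2: "of_real r ^ 2 / of_real r powr mu = of_nat q powr (2 - mu) * of_nat m powr (2 - mu)"
      proof -
        have "complex_of_real r ^ 2 / of_real r powr mu = of_real r powr (2 - mu)"
          using r by (simp add: powr_diff)
        also have "\<dots> = of_nat q powr (2 - mu) * of_nat m powr (2 - mu)"
          unfolding r_def using powr_times_real[of "of_nat q" "of_nat m" "2 - mu"] by simp
        finally show ?thesis .
      qed
      \<comment> \<open>\<open>2 - mu - (2 N + 2) = - nu\<close>, so all powers of \<open>m\<close>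
        combine to the divisor weight.\<close>
      have e3: "of_nat m powr (2 - mu) / of_real (real m ^ (2 * N + 2)) = of_nat m powr (- nu)"
      proof -
        have "of_nat m powr (- nu) * of_nat m powr (of_nat (2 * N + 2)) = of_nat m powr (2 - mu)"
          unfolding powr_add [symmetric] by (simp add: mu_def algebra_simps)
        moreover have "of_nat m powr (of_nat (2 * N + 2)) = complex_of_real (real m ^ (2 * N + 2))"
          using i by (subst powr_nat') auto
        ultimately show ?thesis using i by (simp add: field_simps)
      qed
      have alg: "c / (p * t * M) * (p / (2 * s) * (Q * X * Y)) = Q / (2 * t * s) * (X / M * c) * Y" if "p \<noteq> 0" for c p t M s Q X Y :: complex
        using that by (simp add: mult_ac)
      show ?thesis unfolding e1 e2 J_def K_def e3 [symmetric] by (rule alg) simp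
    qed
    finally show "(LINT v|lborel. f i v) = (case i of (m, n) \<Rightarrow> J m n)" by (simp add: i)
  qed
  from has_sum_divisor_sum[OF this[unfolded I_def]]
  have "((\<lambda>k. \<Sum>d\<in>{d. d dvd k}. J d (k div d)) has_sum (LINT v|lborel. exp ((mu - 1) * of_real v) * F (exp v) * planck_remainder N (x * exp (- v)))) {0<..}" .
  moreover have "(\<Sum>d\<in>{d. d dvd k}. J d (k div d)) = K * (sigma_bar_char (- nu) chi k * Dk k)" for k
    unfolding J_def sigma_bar_char_def sum_distrib_left sum_distrib_right by (intro sum.cong) (auto simp: mult_ac)
  ultimately show "((\<lambda>k. of_nat q powr (2 - mu) / (2 * gauss_sum q chi * sin (of_real pi * mu / 2)) *
           (sigma_bar_char (- nu) chi k *
             ((of_nat k powr mu - of_real (real q * x) powr mu) / (of_nat k ^ 2 - of_real (real q * x) ^ 2)))) has_sum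
      (LINT v|lborel. exp ((mu - 1) * of_real v) * char_exp_series (conj_char chi) (exp v) * planck_remainder N (x * exp (- v)))) {0<..}"
    by (simp only: F_def K_def Dk_def tau_def)
qed

end

section \<open>The identity\<close>

lemma sin_half_pi_shift: "sin (of_real pi * (nu - 2 * of_nat N) / 2 :: complex) = (- 1) ^ N * sin (of_real pi * nu / 2)"
proof -
  have "of_real pi * (nu - 2 * of_nat N) / 2 = of_real pi * nu / 2 - complex_of_real (pi * real N)"
    by (simp add: field_simps)
  thus ?thesis by (simp only: sin_diff sin_of_real cos_of_real) simp
qed

lemma cos_half_pi_shift: "cos (of_real pi * (nu - 1 - 2 * of_nat j) / 2 :: complex) = (- 1) ^ j * sin (of_real pi * nu / 2)"
proof -
  have "of_real pi * (nu - 1 - 2 * of_nat j) / 2 = of_real pi * (nu - 2 * of_nat j) / 2 - complex_of_real (pi / 2)"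
    by (simp add: field_simps)
  hence "cos (of_real pi * (nu - 1 - 2 * of_nat j) / 2 :: complex) = sin (of_real pi * (nu - 2 * of_nat j) / 2)"
    by (simp only: cos_diff sin_of_real cos_of_real) simp
  thus ?thesis by (simp only: sin_half_pi_shift)
qed

context even_primitive_char
begin

text \<open>It equals \<open>2 * x^(nu / 2)\<close> times the Bessel series, so the left side of the
  theorem is \<open>4 * pi\<close> times it.\<close>

definition bessel_side_integral :: "complex \<Rightarrow> real \<Rightarrow> complex" where
  "bessel_side_integral nu x = (LINT v|lborel. exp (nu * of_real v) * char_exp_series (conj_char chi) (exp v) *
      of_real (1 / (exp (2 * pi * x * exp (- v)) - 1)))"

definition divisor_quotient :: "complex \<Rightarrow> real \<Rightarrow> nat \<Rightarrow> nat \<Rightarrow> complex" where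
  "divisor_quotient nu x N k = sigma_bar_char (- nu) chi k *
     ((of_nat k powr (nu - 2 * of_nat N) - of_real (real q * x) powr (nu - 2 * of_nat N))
      / (of_nat k ^ 2 - of_real (real q * x) ^ 2))"

text \<open>With \<open>y = x * exp (- v)\<close>, the powers of \<open>y\<close> in the Planck
  expansion only shift the Mellin exponent: \<open>1 / y\<close> by \<open>1\<close> and
  \<open>y^(2 j + 1)\<close> by \<open>- (2 j + 1)\<close>.\<close>

lemma bessel_side_integral_expansion:
  assumes nu: "nu \<notin> \<int>" "Re nu \<ge> 0" and N: "2 * real N \<le> Re nu + 1" "Re nu - 1 < 2 * real N"
    and x: "x > 0" "\<not> (\<exists>m::nat. m > 0 \<and> real q * x = real m)"
  shows "bessel_side_integral nu x =
     - 1 / 2 * char_mellin (conj_char chi) nu + of_real (1 / (2 * pi * x)) * char_mellin (conj_char chi) (nu + 1)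
     + (\<Sum>j<N. (- 1) ^ j * of_real (x ^ (2 * j + 1) / pi) * zeta_series (2 * of_nat (Suc j)) * char_mellin (conj_char chi) (nu - 1 - 2 * of_nat j))
     + (- 1) ^ N * of_real (x ^ (2 * N + 1) / pi) *
       (LINT v|lborel. exp ((nu - 2 * of_nat N - 1) * of_real v) * char_exp_series (conj_char chi) (exp v) * planck_remainder N (x * exp (- v)))"
proof -
  define F where "F = (\<lambda>v. char_exp_series (conj_char chi) (exp v))"
  define R where "R = (\<lambda>v. exp ((nu - 2 * of_nat N - 1) * of_real v) * F v * planck_remainder N (x * exp (- v)))"
  have pt: "exp (nu * of_real v) * F v * of_real (1 / (exp (2 * pi * x * exp (- v)) - 1)) =
     - 1 / 2 * (exp (nu * of_real v) * F v) + of_real (1 / (2 * pi * x)) * (exp ((nu + 1) * of_real v) * F v)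
     + (\<Sum>j<N. (- 1) ^ j * of_real (x ^ (2 * j + 1) / pi) * zeta_series (2 * of_nat (Suc j)) * (exp ((nu - 1 - 2 * of_nat j) * of_real v) * F v))
     + (- 1) ^ N * of_real (x ^ (2 * N + 1) / pi) * R v" for v
  proof -
    define E where "E = exp (nu * of_real v)"
    define y where "y = x * exp (- v)"
    have y: "y > 0" using x by (simp add: y_def)
    have pw: "E * of_real (y ^ (2 * j + 1) / pi) = of_real (x ^ (2 * j + 1) / pi) * exp ((nu - 1 - 2 * of_nat j) * of_real v)" for j
    proof -
      have e1: "y ^ (2 * j + 1) / pi = x ^ (2 * j + 1) / pi * exp (real (2 * j + 1) * (- v))"
        unfolding y_def power_mult_distrib exp_of_nat_mult by simp
      have e2: "E * of_real (exp (real (2 * j + 1) * (- v))) = exp ((nu - 1 - 2 * of_nat j) * of_real v)"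
        unfolding E_def exp_of_real [symmetric] exp_add [symmetric] by (simp add: algebra_simps)
      show ?thesis unfolding e1 of_real_mult e2 [symmetric] by (simp only: mult_ac)
    qed
    have p1: "E * of_real (1 / (2 * pi * y)) = of_real (1 / (2 * pi * x)) * exp ((nu + 1) * of_real v)"
    proof -
      have e1: "1 / (2 * pi * y) = 1 / (2 * pi * x) * exp v" by (simp add: y_def exp_minus field_simps)
      have e2: "E * of_real (exp v) = exp ((nu + 1) * of_real v)"
        unfolding E_def exp_of_real [symmetric] exp_add [symmetric] by (simp add: algebra_simps)
      show ?thesis unfolding e1 of_real_mult e2 [symmetric] by (simp only: mult_ac)
    qed
    have "E * F v * of_real (1 / (exp (2 * pi * y) - 1)) = 
      - 1 / 2 * (E * F v) + (E * of_real (1 / (2 * pi * y))) * F v +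
      (\<Sum>j<N. (- 1) ^ j * zeta_series (2 * of_nat (Suc j)) * (E * of_real (y ^ (2 * j + 1) / pi)) * F v) +
      (- 1) ^ N * (E * of_real (y ^ (2 * N + 1) / pi)) * F v * planck_remainder N y"
      unfolding planck_expansion[OF y, of N] by (simp only: ring_distribs sum_distrib_left sum_distrib_right mult_ac)
    also have "\<dots> = - 1 / 2 * (E * F v) + of_real (1 / (2 * pi * x)) * (exp ((nu + 1) * of_real v) * F v)
     + (\<Sum>j<N. (- 1) ^ j * of_real (x ^ (2 * j + 1) / pi) * zeta_series (2 * of_nat (Suc j)) * (exp ((nu - 1 - 2 * of_nat j) * of_real v) * F v))
     + (- 1) ^ N * of_real (x ^ (2 * N + 1) / pi) * (exp ((nu - 1 - 2 * of_nat N) * of_real v) * F v * planck_remainder N y)"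
      unfolding pw p1 by (simp only: mult_ac)
    also have "nu - 1 - 2 * of_nat N = nu - 2 * of_nat N - 1" by simp
    finally show ?thesis by (simp only: E_def y_def R_def mult.assoc)
  qed
  have i1: "integrable lborel (\<lambda>v. exp (s * of_real v) * F v)" if "Re s > -1" for s
    unfolding F_def by (rule char_mellin_conj_integrable[OF that])
  have i2: "integrable lborel R"
    unfolding R_def F_def by (rule remainder_side_has_sum(1)[OF nu N x])
  have c: "(LINT v|lborel. exp (s * of_real v) * F v) = char_mellin (conj_char chi) s" for s
    by (simp add: char_mellin_def F_def)
  \<comment> \<open>From \<open>j \<le> N - 1\<close> and \<open>2 N \<le> Re nu + 1\<close> this
    real part is even nonnegative.\<close>
  have rj: "Re (nu - 1 - 2 * of_nat j) > -1" if "j < N" for j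
  proof -
    have "real j + 1 \<le> real N" using that by simp
    thus ?thesis using N by simp
  qed
  have J: "integrable lborel (\<lambda>v. - 1 / 2 * (exp (nu * of_real v) * F v))"
    "integrable lborel (\<lambda>v. of_real (1 / (2 * pi * x)) * (exp ((nu + 1) * of_real v) * F v))"
    "\<And>j. j < N \<Longrightarrow> integrable lborel (\<lambda>v. (- 1) ^ j * of_real (x ^ (2 * j + 1) / pi) * zeta_series (2 * of_nat (Suc j)) * (exp ((nu - 1 - 2 * of_nat j) * of_real v) * F v))"
    "integrable lborel (\<lambda>v. (- 1) ^ N * of_real (x ^ (2 * N + 1) / pi) * R v)"
    by (intro integrable_mult_right i1 i2 rj; use nu in simp)+
  have J3: "integrable lborel (\<lambda>v. \<Sum>j<N. (- 1) ^ j * of_real (x ^ (2 * j + 1) / pi) * zeta_series (2 * of_nat (Suc j)) * (exp ((nu - 1 - 2 * of_nat j) * of_real v) * F v))"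
    by (intro Bochner_Integration.integrable_sum J) simp
  have sumJ: "(LINT v|lborel. (\<Sum>j<N. (- 1) ^ j * of_real (x ^ (2 * j + 1) / pi) * zeta_series (2 * of_nat (Suc j)) * (exp ((nu - 1 - 2 * of_nat j) * of_real v) * F v))) =
    (\<Sum>j<N. (- 1) ^ j * of_real (x ^ (2 * j + 1) / pi) * zeta_series (2 * of_nat (Suc j)) * char_mellin (conj_char chi) (nu - 1 - 2 * of_nat j))"
    by (subst Bochner_Integration.integral_sum) (use J(3) in \<open>simp_all only: integral_mult_right_zero c lessThan_iff\<close>)
  have "bessel_side_integral nu x = (LINT v|lborel. exp (nu * of_real v) * F v * of_real (1 / (exp (2 * pi * x * exp (- v)) - 1)))"
    by (simp only: bessel_side_integral_def F_def)
  also have "\<dots> = - 1 / 2 * char_mellin (conj_char chi) nu + of_real (1 / (2 * pi * x)) * char_mellin (conj_char chi) (nu + 1)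
     + (\<Sum>j<N. (- 1) ^ j * of_real (x ^ (2 * j + 1) / pi) * zeta_series (2 * of_nat (Suc j)) * char_mellin (conj_char chi) (nu - 1 - 2 * of_nat j))
     + (- 1) ^ N * of_real (x ^ (2 * N + 1) / pi) * (LINT v|lborel. R v)"
    unfolding pt
    by (simp only: Bochner_Integration.integral_add[OF Bochner_Integration.integrable_add[OF Bochner_Integration.integrable_add[OF J(1,2)] J3] J(4)]
         Bochner_Integration.integral_add[OF Bochner_Integration.integrable_add[OF J(1,2)] J3]
         Bochner_Integration.integral_add[OF J(1,2)] sumJ integral_mult_right_zero c)
  finally show ?thesis by (simp only: R_def F_def)
qed

text \<open>The least admissible \<open>N\<close> is the one for which all integrals in the expansion converge.\<close>
lemma identity_least_N:
  assumes nu: "nu \<notin> \<int>" "Re nu \<ge> 0" and N: "2 * real N \<le> Re nu + 1" "Re nu - 1 < 2 * real N"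
    and x: "x > 0" "\<not> (\<exists>m::nat. m > 0 \<and> real q * x = real m)"
  shows "\<exists>S. (divisor_quotient nu x N has_sum S) {0<..} \<and>
    4 * of_real pi * bessel_side_integral nu x =
      - (Gamma nu * dirichlet_L (conj_char chi) nu) / of_real (2 * pi) powr (nu - 1)
      + 2 * Gamma (1 + nu) * dirichlet_L (conj_char chi) (1 + nu) / of_real (2 * pi) powr (nu + 1) * of_real x powr (-1)
      + 2 * of_nat q powr (1 - nu) / (gauss_sum q chi * sin (of_real pi * nu / 2)) *
        ((\<Sum>j<N. zeta_series (2 * of_nat (Suc j)) * dirichlet_L chi (2 * of_nat (Suc j) - nu) * of_real (real q * x) ^ (2 * j + 1))
         + of_real (real q * x) ^ (2 * N + 1) * S)"
proof -
  define tau where "tau = gauss_sum q chi"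
  have tau: "tau \<noteq> 0" unfolding tau_def by (rule gauss_sum_nonzero)
  define sn where "sn = sin (of_real pi * nu / 2)"
  have sn: "sn \<noteq> 0"
  proof
    assume "sn = 0"
    hence "nu / 2 \<in> \<int>" using sin_pi_times_eq_0_iff[of "nu / 2"] by (simp add: sn_def)
    hence "2 * (nu / 2) \<in> \<int>" by (intro Ints_mult) auto
    thus False using nu by simp
  qed
  define G where "G = char_mellin (conj_char chi)"
  define T where "T = (LINT v|lborel. exp ((nu - 2 * of_nat N - 1) * of_real v) * char_exp_series (conj_char chi) (exp v) * planck_remainder N (x * exp (- v)))"
  \<comment> \<open>The constant in front of the remainder series, its sine rewritten with the sign
    \<open>(- 1) ^ N\<close>. It is nonzero, so convergence and the sum \<open>S\<close> of
    \<open>divisor_quotient\<close> follow by division.\<close>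
  define K where "K = of_nat q powr (2 - (nu - 2 * of_nat N)) / (2 * tau * ((- 1) ^ N * sn))"
  define Q where "Q = (of_nat q :: complex) powr (1 - nu)"
  have qp: "(of_nat q :: complex) powr (2 - (nu - 2 * of_nat N)) = Q * of_nat q ^ (2 * N + 1)" for N
  proof -
    have "2 - (nu - 2 * of_nat N) = (1 - nu) + of_nat (2 * N + 1)" by simp
    moreover have "(of_nat q :: complex) powr of_nat (2 * N + 1) = of_nat q ^ (2 * N + 1)"
      using q_pos by (intro powr_nat') auto
    ultimately show ?thesis unfolding Q_def by (simp only: powr_add)
  qed
  have K: "K \<noteq> 0" using tau sn q_pos by (simp add: K_def)
  define S where "S = T / K"
  have "((\<lambda>k. K * divisor_quotient nu x N k) has_sum T) {0<..}"
    using remainder_side_has_sum(2)[OF nu N x]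
    by (simp only: K_def T_def divisor_quotient_def tau_def sn_def sin_half_pi_shift)
  from has_sum_cmult_right[OF this, of "1 / K"] have hS: "(divisor_quotient nu x N has_sum S) {0<..}"
    using K by (simp add: S_def)
  have TK: "T = K * S" using K by (simp add: S_def)
  have "4 * of_real pi * bessel_side_integral nu x = 
     4 * of_real pi * (- 1 / 2 * G nu) + 4 * of_real pi * (of_real (1 / (2 * pi * x)) * G (nu + 1))
     + (\<Sum>j<N. 4 * of_real pi * ((- 1) ^ j * of_real (x ^ (2 * j + 1) / pi) * zeta_series (2 * of_nat (Suc j)) * G (nu - 1 - 2 * of_nat j)))
     + 4 * of_real pi * ((- 1) ^ N * of_real (x ^ (2 * N + 1) / pi) * T)"
    unfolding bessel_side_integral_expansion[OF nu N x] G_def T_def ring_distribs sum_distrib_left ..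
  also have "4 * of_real pi * (- 1 / 2 * G nu) = - (Gamma nu * dirichlet_L (conj_char chi) nu) / of_real (2 * pi) powr (nu - 1)"
  proof -
    have "G nu = Gamma nu * dirichlet_L (conj_char chi) nu / of_real (2 * pi) powr nu"
      unfolding G_def using nu by (intro char_mellin_conj_eq_dirichlet_L) auto
    moreover have "complex_of_real (2 * pi) powr (nu - 1) = of_real (2 * pi) powr nu / of_real (2 * pi)"
      by (simp add: powr_diff)
    ultimately show ?thesis by simp
  qed
  also have "4 * of_real pi * (of_real (1 / (2 * pi * x)) * G (nu + 1)) =
      2 * Gamma (1 + nu) * dirichlet_L (conj_char chi) (1 + nu) / of_real (2 * pi) powr (nu + 1) * of_real x powr (-1)"
  proof -
    have "nu + 1 \<notin> \<int>"
    proof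
      assume "nu + 1 \<in> \<int>"
      hence "nu + 1 - 1 \<in> \<int>" by (intro Ints_diff) auto
      thus False using nu by simp
    qed
    hence "G (nu + 1) = Gamma (nu + 1) * dirichlet_L (conj_char chi) (nu + 1) / of_real (2 * pi) powr (nu + 1)"
      unfolding G_def using nu by (intro char_mellin_conj_eq_dirichlet_L) auto
    moreover have "complex_of_real x powr (-1) = 1 / of_real x" using x by (simp add: powr_minus divide_inverse)
    moreover have "4 * of_real pi * (of_real (1 / (2 * pi * x)) * g) = 2 * g * (1 / of_real x)" for g :: complex
      using x by (simp add: field_simps)
    ultimately show ?thesis by (simp add: add.commute mult_ac)
  qed
  also have "(\<Sum>j<N. 4 * of_real pi * ((- 1) ^ j * of_real (x ^ (2 * j + 1) / pi) * zeta_series (2 * of_nat (Suc j)) * G (nu - 1 - 2 * of_nat j))) =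
    (\<Sum>j<N. 2 * Q / (tau * sn) * (zeta_series (2 * of_nat (Suc j)) * dirichlet_L chi (2 * of_nat (Suc j) - nu) * of_real (real q * x) ^ (2 * j + 1)))"
  proof (rule sum.cong[OF refl])
    fix j assume "j \<in> {..<N}"
    hence "real j + 1 \<le> real N" by simp
    hence "Re (nu - 1 - 2 * of_nat j) > -1" using N by simp
    \<comment> \<open>At \<open>s = nu - 1 - 2 j\<close> the cosine is
      \<open>(- 1) ^ j * sin (pi * nu / 2)\<close>, whose sign cancels that of the Planck expansion,
      and \<open>1 - s\<close> is \<open>2 (j + 1) - nu\<close>.\<close>
    from char_mellin_conj_functional_equation[OF this]
    have "G (nu - 1 - 2 * of_nat j) * (2 * tau * ((- 1) ^ j * sn)) / of_nat q powr (2 - (nu - 2 * of_nat j)) = dirichlet_L chi (2 * of_nat (Suc j) - nu)"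
      unfolding cos_half_pi_shift G_def tau_def sn_def by (simp add: algebra_simps)
    hence L: "dirichlet_L chi (2 * of_nat (Suc j) - nu) = G (nu - 1 - 2 * of_nat j) * (2 * tau * ((- 1) ^ j * sn)) / (Q * of_nat q ^ (2 * j + 1))"
      unfolding qp by simp
    have "4 * p * (e * (X / p) * z * g) = 2 * Q' / (tau * sn) * (z * (g * (2 * tau * (e * sn)) / (Q' * q')) * (q' * X))"
      if "p \<noteq> 0" "Q' \<noteq> 0" "q' \<noteq> 0" for p e X z g Q' q' :: complex
      using that tau sn by (simp add: field_simps)
    from this[of "of_real pi" Q "of_nat q ^ (2 * j + 1)" "(- 1) ^ j" "of_real x ^ (2 * j + 1)" "zeta_series (2 * of_nat (Suc j))" "G (nu - 1 - 2 * of_nat j)"]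
    show "4 * of_real pi * ((- 1) ^ j * of_real (x ^ (2 * j + 1) / pi) * zeta_series (2 * of_nat (Suc j)) * G (nu - 1 - 2 * of_nat j)) =
       2 * Q / (tau * sn) * (zeta_series (2 * of_nat (Suc j)) * dirichlet_L chi (2 * of_nat (Suc j) - nu) * of_real (real q * x) ^ (2 * j + 1))"
      unfolding L of_real_mult power_mult_distrib of_real_divide of_real_power of_real_of_nat_eq
      using q_pos by (simp add: Q_def)
  qed
  also have "4 * of_real pi * ((- 1) ^ N * of_real (x ^ (2 * N + 1) / pi) * T) = 2 * Q / (tau * sn) * (of_real (real q * x) ^ (2 * N + 1) * S)"
  proof -
    have "4 * p * (e * (X / p) * ((Q' * q') / (2 * tau * (e * sn)) * S)) = 2 * Q' / (tau * sn) * ((q' * X) * S)"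
      if "p \<noteq> 0" "e \<noteq> 0" for p e X Q' q' :: complex
      using that tau sn by (simp add: field_simps)
    from this[of "of_real pi" "(- 1) ^ N" "of_real x ^ (2 * N + 1)" Q "of_nat q ^ (2 * N + 1)"]
    show ?thesis
      unfolding TK K_def qp of_real_mult power_mult_distrib of_real_divide of_real_power of_real_of_nat_eq by simp
  qed
  finally have "4 * of_real pi * bessel_side_integral nu x =
      - (Gamma nu * dirichlet_L (conj_char chi) nu) / of_real (2 * pi) powr (nu - 1)
      + 2 * Gamma (1 + nu) * dirichlet_L (conj_char chi) (1 + nu) / of_real (2 * pi) powr (nu + 1) * of_real x powr (-1)
      + 2 * Q / (tau * sn) *
        ((\<Sum>j<N. zeta_series (2 * of_nat (Suc j)) * dirichlet_L chi (2 * of_nat (Suc j) - nu) * of_real (real q * x) ^ (2 * j + 1))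
         + of_real (real q * x) ^ (2 * N + 1) * S)"
    by (simp only: distrib_left sum_distrib_left add.assoc)
  with hS show ?thesis unfolding Q_def tau_def sn_def by blast
qed

text \<open>With \<open>s = 2 (N + 1) - nu\<close> the divisor weight turns \<open>k^(- s)\<close>
  into \<open>d^(- 2 (N + 1)) * m^(- s)\<close> for \<open>k = d * m\<close>, so the series is a
  product. The hypothesis says exactly \<open>Re s > 1\<close>.\<close>

lemma sigma_bar_dirichlet_series:
  assumes "Re nu - 1 < 2 * real N"
  shows "((\<lambda>k. sigma_bar_char (- nu) chi k * of_nat k powr (nu - 2 * of_nat (Suc N))) has_sum
           (zeta_series (2 * of_nat (Suc N)) * dirichlet_L chi (2 * of_nat (Suc N) - nu))) {0<..}"
proof -
  define s where "s = 2 * of_nat (Suc N) - nu"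
  have s: "Re s > 1" using assms by (simp add: s_def)
  have "((\<lambda>(m, n). 1 / of_nat m ^ (2 * Suc N) * (chi n / of_nat n powr s)) has_sum (zeta_series (2 * of_nat (Suc N)) * dirichlet_L chi s)) ({0<..} \<times> {0<..})"
    by (rule has_sum_complex_product[OF zeta_series_has_sum(1) dirichlet_L_has_sum[OF s] zeta_series_has_sum(2) dirichlet_series_abs_summable[OF s]]) auto
  from has_sum_divisor_sum[OF this]
  have "((\<lambda>k. \<Sum>d\<in>{d. d dvd k}. 1 / of_nat d ^ (2 * Suc N) * (chi (k div d) / of_nat (k div d) powr s)) has_sum (zeta_series (2 * of_nat (Suc N)) * dirichlet_L chi s)) {0<..}" .
  thus ?thesis unfolding s_def [symmetric]
  proof (rule has_sum_cong_imp)
    fix k :: nat assume "k \<in> {0<..}"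
    hence k: "k > 0" by simp
    have "1 / of_nat d ^ (2 * Suc N) * (chi (k div d) / of_nat (k div d) powr s) = of_nat d powr (- nu) * chi (k div d) * of_nat k powr (- s)"
      if "d \<in> {d. d dvd k}" for d
    proof -
      have "d dvd k" using that by simp
      then obtain m where km: "k = d * m" by (elim dvdE)
      have dm: "d > 0" "m > 0" using k km by auto
      have e1: "(of_nat k :: complex) powr (- s) = of_nat d powr (- s) * of_nat m powr (- s)"
        unfolding km using powr_times_real[of "of_nat d" "of_nat m" "- s"] by simp
      have e2: "(of_nat d :: complex) powr (- nu) * of_nat d powr (- s) = 1 / of_nat d ^ (2 * Suc N)"
      proof -
        have "(of_nat d :: complex) powr (- nu) * of_nat d powr (- s) = of_nat d powr (- (2 * of_nat (Suc N)))"
          unfolding powr_add [symmetric] s_def by (simp add: algebra_simps)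
        thus ?thesis unfolding powr_minus of_nat_powr_even[OF dm(1)] by (simp add: divide_inverse)
      qed
      have kd: "k div d = m" using dm by (simp add: km)
      have e3: "of_nat d powr (- nu) * chi m * of_nat k powr (- s) = 1 / of_nat d ^ (2 * Suc N) * (chi m * of_nat m powr (- s))"
        unfolding e1 e2 [symmetric] by (simp only: mult_ac)
      show ?thesis unfolding kd e3 by (simp add: powr_minus divide_inverse)
    qed
    thus "(\<Sum>d\<in>{d. d dvd k}. 1 / of_nat d ^ (2 * Suc N) * (chi (k div d) / of_nat (k div d) powr s)) = sigma_bar_char (- nu) chi k * of_nat k powr (nu - 2 * of_nat (Suc N))"
      unfolding sigma_bar_char_def sum_distrib_right by (intro sum.cong) (auto simp: s_def)
  qed
qed

text \<open>With \<open>mu = nu - 2 (N + 1)\<close> and \<open>y = q x\<close>, the quotient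
  \<open>(k^(mu + 2) - y^(mu + 2)) / (k^2 - y^2)\<close> equals
  \<open>k^mu + y^2 * (k^mu - y^mu) / (k^2 - y^2)\<close>; the first summand forms the series of
  \<open>sigma_bar_dirichlet_series\<close>.\<close>

lemma divisor_quotient_Suc:
  assumes N: "Re nu - 1 < 2 * real N" and x: "x > 0" "\<not> (\<exists>m::nat. m > 0 \<and> real q * x = real m)"
    and S: "(divisor_quotient nu x N has_sum S) {0<..}"
  shows "(divisor_quotient nu x (Suc N) has_sum
     ((S - zeta_series (2 * of_nat (Suc N)) * dirichlet_L chi (2 * of_nat (Suc N) - nu)) / of_real (real q * x) ^ 2)) {0<..}"
proof -
  define y where "y = real q * x"
  have y: "y > 0" using x q_pos by (simp add: y_def)
  define Z where "Z = zeta_series (2 * of_nat (Suc N)) * dirichlet_L chi (2 * of_nat (Suc N) - nu)"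
  have "((\<lambda>k. 1 / of_real y ^ 2 * (divisor_quotient nu x N k + (- 1) * (sigma_bar_char (- nu) chi k * of_nat k powr (nu - 2 * of_nat (Suc N))))) has_sum
     (1 / of_real y ^ 2 * (S + (- 1) * Z))) {0<..}"
    unfolding Z_def by (intro has_sum_cmult_right has_sum_add S sigma_bar_dirichlet_series N)
  hence "((\<lambda>k. 1 / of_real y ^ 2 * (divisor_quotient nu x N k + (- 1) * (sigma_bar_char (- nu) chi k * of_nat k powr (nu - 2 * of_nat (Suc N))))) has_sum
     ((S - Z) / of_real y ^ 2)) {0<..}" by simp
  thus ?thesis unfolding Z_def y_def [symmetric]
  proof (rule has_sum_cong_imp)
    fix k :: nat assume "k \<in> {0<..}"
    hence k: "k > 0" by simp
    define mu where "mu = nu - 2 * of_nat (Suc N)"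
    have mu2: "nu - 2 * of_nat N = mu + 2" by (simp add: mu_def)
    have kp: "(of_nat k :: complex) powr (mu + 2) = of_nat k powr mu * of_nat k ^ 2" using k by (simp add: powr_add)
    have yp: "complex_of_real y powr (mu + 2) = of_real y powr mu * of_real y ^ 2" using y by (simp add: powr_add)
    have ne: "(of_nat k :: complex) ^ 2 - of_real y ^ 2 \<noteq> 0"
    proof
      assume "(of_nat k :: complex) ^ 2 - of_real y ^ 2 = 0"
      hence "complex_of_real (real k ^ 2) = of_real (y ^ 2)" by simp
      hence "real k ^ 2 = y ^ 2" by (simp only: of_real_eq_iff)
      hence "real k = y" using y by (simp add: power2_eq_iff)
      hence "k > 0 \<and> real q * x = real k" using k by (simp add: y_def)
      thus False using x(2) by blast
    qed
    have alg: "1 / Y * (s * ((a * k2 - b * Y) / (k2 - Y)) + (- 1) * (s * a)) = s * ((a - b) / (k2 - Y))"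
      if "k2 - Y \<noteq> 0" "Y \<noteq> 0" for Y s a b k2 :: complex
      using that by (simp add: divide_simps) (simp add: algebra_simps)
    show "1 / of_real y ^ 2 * (divisor_quotient nu x N k + (- 1) * (sigma_bar_char (- nu) chi k * of_nat k powr (nu - 2 * of_nat (Suc N)))) = divisor_quotient nu x (Suc N) k"
      unfolding divisor_quotient_def mu2 mu_def [symmetric] y_def [symmetric] kp yp
      by (rule alg) (use ne y in auto)
  qed
qed

text \<open>The floor itself lies in the window of \<open>identity_least_N\<close>. Each further
  step detaches one Dirichlet series, which becomes the next summand of the finite sum.\<close>

lemma identity_all_N:
  assumes nu: "nu \<notin> \<int>" "Re nu \<ge> 0" and N: "\<lfloor>(Re nu + 1) / 2\<rfloor> \<le> int N"
    and x: "x > 0" "\<not> (\<exists>m::nat. m > 0 \<and> real q * x = real m)"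
  shows "\<exists>S. (divisor_quotient nu x N has_sum S) {0<..} \<and>
    4 * of_real pi * bessel_side_integral nu x =
      - (Gamma nu * dirichlet_L (conj_char chi) nu) / of_real (2 * pi) powr (nu - 1)
      + 2 * Gamma (1 + nu) * dirichlet_L (conj_char chi) (1 + nu) / of_real (2 * pi) powr (nu + 1) * of_real x powr (-1)
      + 2 * of_nat q powr (1 - nu) / (gauss_sum q chi * sin (of_real pi * nu / 2)) *
        ((\<Sum>j<N. zeta_series (2 * of_nat (Suc j)) * dirichlet_L chi (2 * of_nat (Suc j) - nu) * of_real (real q * x) ^ (2 * j + 1))
         + of_real (real q * x) ^ (2 * N + 1) * S)"
proof -
  define N0 where "N0 = nat \<lfloor>(Re nu + 1) / 2\<rfloor>"
  have fl: "\<lfloor>(Re nu + 1) / 2\<rfloor> \<ge> 0" using nu by simp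
  have N0: "real N0 = of_int \<lfloor>(Re nu + 1) / 2\<rfloor>" using fl by (simp add: N0_def)
  have N0a: "2 * real N0 \<le> Re nu + 1" using of_int_floor_le[of "(Re nu + 1) / 2"] by (simp add: N0)
  have N0b: "Re nu - 1 < 2 * real N0"
  proof -
    have "(Re nu + 1) / 2 < real N0 + 1" unfolding N0 by (rule real_of_int_floor_add_one_gt)
    thus ?thesis by (simp add: field_simps)
  qed
  have "N0 \<le> N" using N by (simp add: N0_def nat_le_iff)
  thus ?thesis
  proof (induction N rule: dec_induct)
    case base
    show ?case by (rule identity_least_N[OF nu N0a N0b x])
  next
    case (step N)
    then obtain S where S: "(divisor_quotient nu x N has_sum S) {0<..}"
      and eq: "4 * of_real pi * bessel_side_integral nu x =
      - (Gamma nu * dirichlet_L (conj_char chi) nu) / of_real (2 * pi) powr (nu - 1)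
      + 2 * Gamma (1 + nu) * dirichlet_L (conj_char chi) (1 + nu) / of_real (2 * pi) powr (nu + 1) * of_real x powr (-1)
      + 2 * of_nat q powr (1 - nu) / (gauss_sum q chi * sin (of_real pi * nu / 2)) *
        ((\<Sum>j<N. zeta_series (2 * of_nat (Suc j)) * dirichlet_L chi (2 * of_nat (Suc j) - nu) * of_real (real q * x) ^ (2 * j + 1))
         + of_real (real q * x) ^ (2 * N + 1) * S)" by blast
    have "Re nu - 1 < 2 * real N" using N0b step(1) by (smt (verit) of_nat_le_iff)
    note S' = divisor_quotient_Suc[OF this x S]
    have y: "complex_of_real (real q * x) \<noteq> 0" using x q_pos by simp
    \<comment> \<open>\<open>Z\<close> is the new summand; the extra factor \<open>Y ^ 2\<close> in
      the prefactor cancels the division in the new sum.\<close>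
    have alg: "A + Y ^ (2 * N + 1) * S = (A + Z * Y ^ (2 * N + 1)) + Y ^ (2 * Suc N + 1) * ((S - Z) / Y ^ 2)" if "Y \<noteq> 0" for A Y Z :: complex
    proof -
      have "Y ^ (2 * Suc N + 1) = Y ^ (2 * N + 1) * Y ^ 2" by (simp add: power2_eq_square)
      moreover have "a * Y ^ 2 * (b / Y ^ 2) = a * b" for a b using that by simp
      ultimately have "Y ^ (2 * Suc N + 1) * ((S - Z) / Y ^ 2) = Y ^ (2 * N + 1) * (S - Z)" by metis
      thus ?thesis by (simp add: algebra_simps)
    qed
    show ?case
      by (intro exI conjI, rule S', subst eq, subst alg[OF y, of _ "zeta_series (2 * of_nat (Suc N)) * dirichlet_L chi (2 * of_nat (Suc N) - nu)"]) (simp only: sum.lessThan_Suc)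
  qed
qed

end

text \<open>Convergence of both series is part of the claim, because \<open>suminf\<close> has no
  specified value on a divergent series.\<close>

theorem theorem3p1:
  fixes nu :: complex and q :: nat and chi :: "nat \<Rightarrow> complex" and N :: int and x :: real
  assumes "nu \<notin> \<int>" and "Re nu \<ge> 0"
    and "dirichlet_char q chi" and "\<not> principal_char q chi" and "even_char q chi"
    and "primitive_char q chi"
    and "N \<ge> \<lfloor>(Re nu + 1) / 2\<rfloor>"
    and "x > 0" and "\<not> (\<exists>m::nat. m > 0 \<and> real q * x = real m)"
  shows "let L = (\<lambda>n::nat. sigma_char (-nu) (conj_char chi) (Suc n) * of_nat (Suc n) powr (nu / 2)
                      * bessel_K nu (4 * pi * sqrt (real (Suc n) * x)));
             R = (\<lambda>n::nat. sigma_bar_char (-nu) chi (Suc n) *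
                   ((of_nat (Suc n) powr (nu - 2 * of_int N) - of_real (real q * x) powr (nu - 2 * of_int N))
                    / (of_nat (Suc n) ^ 2 - of_real (real q * x) ^ 2)))
         in summable L \<and> summable R \<and>
    8 * of_real pi * of_real x powr (nu / 2) * (\<Sum>n. L n) =
      - (Gamma nu * dirichlet_L (conj_char chi) nu) / of_real (2 * pi) powr (nu - 1)
      + 2 * Gamma (1 + nu) * dirichlet_L (conj_char chi) (1 + nu) / of_real (2 * pi) powr (nu + 1)
          * of_real x powr (-1)
      + 2 * of_nat q powr (1 - nu) / (gauss_sum q chi * sin (of_real pi * nu / 2)) *
        ((\<Sum>j\<in>{1..N}. zeta_series (2 * of_int j) * dirichlet_L chi (2 * of_int j - nu)
                        * of_real (real q * x) powi (2 * j - 1))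
         + of_real (real q * x) powi (2 * N + 1) * (\<Sum>n. R n))"
proof -
  interpret even_primitive_char q chi by unfold_locales fact+
  define n where "n = nat N"
  \<comment> \<open>The lower bound for \<open>N\<close> is nonnegative, so \<open>N\<close> can be
    replaced by a natural number.\<close>
  have fl: "\<lfloor>(Re nu + 1) / 2\<rfloor> \<ge> 0" using assms(2) by simp
  have N: "N = int n" using order_trans[OF fl assms(7)] by (simp add: n_def)
  define L where "L = (\<lambda>n::nat. sigma_char (-nu) (conj_char chi) (Suc n) * of_nat (Suc n) powr (nu / 2)
                      * bessel_K nu (4 * pi * sqrt (real (Suc n) * x)))"
  define R where "R = (\<lambda>n::nat. sigma_bar_char (-nu) chi (Suc n) *
                   ((of_nat (Suc n) powr (nu - 2 * of_int N) - of_real (real q * x) powr (nu - 2 * of_int N))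
                    / (of_nat (Suc n) ^ 2 - of_real (real q * x) ^ 2)))"
  have "\<lfloor>(Re nu + 1) / 2\<rfloor> \<le> int n" using assms(7) N by simp
  from identity_all_N[OF assms(1,2) this assms(8,9)] obtain S where
    S: "(divisor_quotient nu x n has_sum S) {0<..}"
    and eq: "4 * of_real pi * bessel_side_integral nu x =
      - (Gamma nu * dirichlet_L (conj_char chi) nu) / of_real (2 * pi) powr (nu - 1)
      + 2 * Gamma (1 + nu) * dirichlet_L (conj_char chi) (1 + nu) / of_real (2 * pi) powr (nu + 1) * of_real x powr (-1)
      + 2 * of_nat q powr (1 - nu) / (gauss_sum q chi * sin (of_real pi * nu / 2)) *
        ((\<Sum>j<n. zeta_series (2 * of_nat (Suc j)) * dirichlet_L chi (2 * of_nat (Suc j) - nu) * of_real (real q * x) ^ (2 * j + 1))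
         + of_real (real q * x) ^ (2 * n + 1) * S)" by blast
  have R: "R sums S"
    using has_sum_pos_imp_sums_Suc[OF S] unfolding R_def divisor_quotient_def N of_int_of_nat_eq .
  \<comment> \<open>The factor \<open>8 * pi * x^(nu / 2)\<close> is \<open>4 * pi * c\<close>, and
    \<open>c\<close> is what separates the Bessel series from
    \<open>bessel_side_integral\<close>.\<close>
  define c where "c = 2 * complex_of_real x powr (nu / 2)"
  have c: "c \<noteq> 0" using assms(8) by (simp add: c_def)
  have "(\<lambda>n. c * L n) sums bessel_side_integral nu x"
    using has_sum_pos_imp_sums_Suc[OF bessel_side_has_sum(2)[OF assms(2,8)]]
    unfolding L_def c_def bessel_side_integral_def .
  from sums_mult[OF this, of "1 / c"] have L: "L sums (bessel_side_integral nu x / c)" using c by simp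
  have lhs: "8 * of_real pi * of_real x powr (nu / 2) * (\<Sum>n. L n) = 4 * of_real pi * bessel_side_integral nu x"
  proof -
    have "8 * of_real pi * of_real x powr (nu / 2) * (\<Sum>n. L n) = 4 * of_real pi * (c * (bessel_side_integral nu x / c))"
      using L by (simp add: sums_iff c_def)
    thus ?thesis using c by simp
  qed
  have sumj: "(\<Sum>j\<in>{1..N}. zeta_series (2 * of_int j) * dirichlet_L chi (2 * of_int j - nu) * of_real (real q * x) powi (2 * j - 1)) =
     (\<Sum>j<n. zeta_series (2 * of_nat (Suc j)) * dirichlet_L chi (2 * of_nat (Suc j) - nu) * of_real (real q * x) ^ (2 * j + 1))"
  proof (rule sum.reindex_bij_witness[of _ "\<lambda>j. int (Suc j)" "\<lambda>j. nat (j - 1)"])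
    fix j assume j: "j \<in> {1..N}"
    define i where "i = nat (j - 1)"
    have ji: "j = int (Suc i)" using j by (simp add: i_def)
    have "2 * j - 1 = int (2 * i + 1)" by (simp add: ji)
    hence "complex_of_real (real q * x) powi (2 * j - 1) = of_real (real q * x) ^ (2 * i + 1)"
      by (simp only: power_int_of_nat)
    thus "zeta_series (2 * of_nat (Suc (nat (j - 1)))) * dirichlet_L chi (2 * of_nat (Suc (nat (j - 1))) - nu) * of_real (real q * x) ^ (2 * nat (j - 1) + 1) =
      zeta_series (2 * of_int j) * dirichlet_L chi (2 * of_int j - nu) * of_real (real q * x) powi (2 * j - 1)"
      unfolding i_def [symmetric] by (simp only: ji of_int_of_nat_eq)
  qed (auto simp: N)
  have pN: "complex_of_real (real q * x) powi (2 * N + 1) = of_real (real q * x) ^ (2 * n + 1)"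
  proof -
    have "2 * N + 1 = int (2 * n + 1)" by (simp add: N)
    thus ?thesis by (simp only: power_int_of_nat)
  qed
  have "summable L" "summable R" "(\<Sum>n. R n) = S" using L R by (auto simp: sums_iff)
  thus ?thesis unfolding Let_def L_def [symmetric] R_def [symmetric] sumj pN lhs eq by simp
qed

end
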